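(* Let $W:\mathbb R^2\to\mathbb R$ be smooth and positive. For small $\epsilon>0$ let $\Gamma_\epsilon\subset\mathbb R^2$ be a simple smooth closed curve of length $\ell=\ell(\epsilon)$, and let $u_\epsilon$ solve $$-\epsilon^2\Delta u+\big[1+\epsilon^2W(\mathbf y)\big]u-|u|^2u=0\ \text{ in }\mathbb R^2,\qquad \int_{\mathbb R^2}|u|^2\,\mathrm d\mathbf y=a\epsilon^2,$$ where $\epsilon^2=-1/\lambda$ and $a>0$ is a parameter such that $\epsilon\to0$ (equivalently $-\lambda\to+\infty$) as $a\to\mathbf a$. Assume (A1), (A2) and the concentration hypothesis (C) described in the context. Then: (1) there is a constant $\ell_0>0$ independent of $\epsilon$ with $\ell\ge\ell_0$ for all $\epsilon>0$; (2) $\mathbf a=+\infty$, i.e. $a\to+\infty$ as $\epsilon\to0$; (3) for all $\theta\in[0,\ell)$, $$\frac{3\epsilon^2W_t(0,\theta)}{2\big[1+\epsilon^2W(0,\theta)\big]}+\kappa(\theta)=o(1)\quad\text{as }\epsilon\to0.$$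
   Context: (A1) $\gamma_\epsilon(\theta)$, $\theta\in[0,\ell)$, is the positively oriented arclength parametrization of $\Gamma_\epsilon$, $\kappa(\theta)$ its curvature, and there is $C_0$ independent of $\epsilon$ with $|\kappa(\theta)|,|\kappa'(\theta)|\le C_0$. Then there is a small $M_0>0$ independent of $\epsilon$ such that points near $\Gamma_\epsilon$ are written in Fermi coordinates $\mathbf y=\gamma_\epsilon(\theta)+t\nu_\epsilon(\theta)$, $|t|<M_0$, $\theta\in[0,\ell)$, with $\nu_\epsilon$ the unit outer normal; for a function $W$ we write $W(t,\theta)$ for $W(\mathbf y)$. (A2) There are constants $C>0$ and $\varrho\in(0,1)$ independent of $\epsilon$ with $\int_0^\ell[1+\epsilon^2W(0,\theta)]\,\mathrm d\theta\le C\epsilon^{\varrho-1}$; $\max\{\epsilon^2|W_t(t,\theta)|,\epsilon^2|W_{tt}(t,\theta)|\}\le C[1+\epsilon^2W(0,\theta)]$ for all $\theta\in[0,\ell)$, $|t|<M_0$; and $\epsilon^2|W_\theta|,\epsilon^2|W_{\theta\theta}|,\epsilon^2|W_{\theta\theta\theta}|,\epsilon^2|W_{t\theta}|,\epsilon^2|W_{tt\theta}|,\epsilon^2|W_{t\theta\theta}|$, all evaluated at $(0,\theta)$, are $\le C[1+\epsilon^2W(0,\theta)]$ for all $\theta\in[0,\ell)$. (C) Let $U$ be the unique positive solution of $U''-U+U^3=0$ on $\mathbb R$, $U'(0)=0$, $U(\pm\infty)=0$. Let $\beta(\theta)=[1+\epsilon^2W(0,\theta)]^{1/2}$. Let $\chi$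 be a smooth cut-off with $\chi(t)=1$ for $|t|<M_1$ and $\chi(t)=0$ for $|t|>2M_1=:M_2$, where $M_2<M_0$. Then $u_\epsilon=\mathbf u+\phi$ where $\mathbf u(t,\theta)=\chi(t)\beta(\theta)U(\beta(\theta)t/\epsilon)$ in Fermi coordinates (and $\mathbf u=0$ outside this tube), and, writing $\|\cdot\|$ for the $L^2$ norm over $\{|t|<M_2\}$, $$\Big\|\tfrac{\partial^{J}\phi}{\partial t^{J_1}\partial\theta^{J_2}}\Big\|=\frac{O(\epsilon^\varrho)}{\int_0^\ell\beta^5\,\mathrm d\theta}\Big\|\tfrac{\partial^{J}\mathbf u}{\partial t^{J_1}\partial\theta^{J_2}}\Big\|,\qquad \Big\|\tfrac{\partial^{j}\phi}{\partial\theta^{j}}\Big\|=\frac{O(\epsilon^\varrho)}{\int_0^\ell\beta^5\,\mathrm d\theta}\Big\|\tfrac{\partial^{j}\mathbf u}{\partial\theta^{j}}\Big\|,$$ for all multi-indices $J=(J_1,J_2)$ with $|J|\le1$ or $J=(1,1)$, and for $j=2,3$. *)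

theory Defs
  imports "HOL-Complex_Analysis.Winding_Numbers"
begin

text \<open>The plane R^2 is identified with the complex numbers (x,y) = x + i y.\<close>

definition pdir :: "complex \<Rightarrow> (complex \<Rightarrow> real) \<Rightarrow> complex \<Rightarrow> real" where
  "pdir v f z = deriv (\<lambda>s. f (z + of_real s * v)) 0"

fun iter_pd :: "complex list \<Rightarrow> (complex \<Rightarrow> real) \<Rightarrow> complex \<Rightarrow> real" where
  "iter_pd [] f = f"
| "iter_pd (v # vs) f = pdir v (iter_pd vs f)"

definition smooth2 :: "(complex \<Rightarrow> real) \<Rightarrow> bool" where
  "smooth2 f \<longleftrightarrow> (\<forall>vs. set vs \<subseteq> {1, \<i>} \<longrightarrow>
      continuous_on UNIV (iter_pd vs f) \<and>
      (\<forall>v\<in>{1, \<i>}. \<forall>z. (\<lambda>s. iter_pd vs f (z + of_real s * v)) differentiable (at 0)))"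

definition laplacian :: "(complex \<Rightarrow> real) \<Rightarrow> complex \<Rightarrow> real" where
  "laplacian f z = iter_pd [1, 1] f z + iter_pd [\<i>, \<i>] f z"

definition smooth1 :: "(real \<Rightarrow> real) \<Rightarrow> bool" where
  "smooth1 f \<longleftrightarrow> (\<forall>k x. ((deriv ^^ k) f) differentiable (at x))"

definition vd :: "(real \<Rightarrow> complex) \<Rightarrow> real \<Rightarrow> complex" where
  "vd g = (\<lambda>t. vector_derivative g (at t))"

definition smooth_curve :: "(real \<Rightarrow> complex) \<Rightarrow> bool" where
  "smooth_curve g \<longleftrightarrow> (\<forall>k t. ((vd ^^ k) g) differentiable (at t))"

text \<open>Unit outer normal of a positively oriented arclength curve: the unit tangent
  rotated clockwise by 90 degrees.\<close>
definition normal :: "(real \<Rightarrow> complex) \<Rightarrow> real \<Rightarrow> complex" where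
  "normal g \<theta> = - \<i> * vd g \<theta>"

text \<open>Signed curvature: g'' = kappa * i * g' (positive for a counterclockwise circle).\<close>
definition curv :: "(real \<Rightarrow> complex) \<Rightarrow> real \<Rightarrow> real" where
  "curv g \<theta> = Im (vd (vd g) \<theta> * cnj (vd g \<theta>))"

definition fermi :: "(real \<Rightarrow> complex) \<Rightarrow> real \<Rightarrow> real \<Rightarrow> complex" where
  "fermi g t \<theta> = g \<theta> + of_real t * normal g \<theta>"

definition pt :: "(real \<Rightarrow> real \<Rightarrow> real) \<Rightarrow> real \<Rightarrow> real \<Rightarrow> real" where
  "pt f = (\<lambda>t \<theta>. deriv (\<lambda>s. f s \<theta>) t)"

definition pth :: "(real \<Rightarrow> real \<Rightarrow> real) \<Rightarrow> real \<Rightarrow> real \<Rightarrow> real" where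
  "pth f = (\<lambda>t \<theta>. deriv (\<lambda>s. f t s) \<theta>)"

definition tubeL2 :: "real \<Rightarrow> real \<Rightarrow> (real \<Rightarrow> real \<Rightarrow> real) \<Rightarrow> real" where
  "tubeL2 M2 l f = sqrt (integral ({-M2<..<M2} \<times> {0..l}) (\<lambda>(t, \<theta>). (f t \<theta>)\<^sup>2))"

end

theory Submission
  imports Defs
begin

text \<open>
  The profile is \<open>U = sqrt 2 / cosh\<close>: its energy vanishes, which makes the equation for \<open>1 / U\<close> linear.
  Fix \<open>\<theta>\<close>, write the equation in Fermi coordinates, multiply it by \<open>(\<delta>\<^sup>2 - t\<^sup>2) u\<^sub>t\<close> and
  integrate over \<open>\<bar>t\<bar> < \<delta>\<close>. The curvature term of the Laplacian contributes
  \<open>\<kappa> \<epsilon>\<^sup>2 \<integral> u\<^sub>t\<^sup>2 \<approx> (4/3) \<kappa> \<epsilon> \<beta>\<^sup>3\<close>, the potential contributes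
  \<open>(\<epsilon>\<^sup>2 W\<^sub>t / 2) \<integral> u\<^sup>2 \<approx> 2 \<epsilon>\<^sup>2 W\<^sub>t \<epsilon> \<beta>\<close>, and all other terms are
  \<open>O(\<epsilon> \<beta>\<^sup>3 (\<epsilon> + \<epsilon>\<^sup>\<rho>))\<close>: those without \<open>\<theta>\<close>-derivatives carry a factor \<open>t\<close>, which gains
  \<open>\<epsilon>\<close> on the soliton, and the error \<open>\<phi>\<close> is controlled on the slice by the tube norms of \<open>\<phi>\<close>
  and of its \<open>\<theta>\<close>-derivative. Since a closed curve with bounded curvature cannot be short, the mass
  \<open>\<integral> u\<^sup>2\<close> in the tube is at least of order \<open>\<epsilon>\<close>, which forces \<open>a\<close> to infinity.
\<close>

section \<open>Continuously differentiable functions of two real variables\<close>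

text \<open>The weight \<open>\<delta>\<^sup>2 - t\<^sup>2\<close> removes the boundary terms, and
  where the derivative hits it, the resulting \<open>- 2 * t\<close> supplies the factor t. The
  claim is pointwise in \<theta> while the hypothesis bounds whole tube norms, so every slice bound
  costs one more \<theta>-derivative; this is what the bounds on third-order and mixed derivatives
  are for. The hypothesis gives a relative error only. It becomes absolute because the squared tube
  norms of the ansatz are at most a constant times \<open>\<epsilon> * I5\<close>, or
  \<open>I5 / \<epsilon>\<close> after a t-derivative, where \<open>I5\<close> is the integral of
  \<open>\<beta> ^ 5\<close>: one factor \<open>1 / I5\<close> survives, and it is at most
  \<open>1 / L0\<close>. Hence the lower bound on the length comes before all estimates. The quartic
  term needs a sup bound on \<phi> too, obtained by balancing \<phi> and its t-derivative on the
  slice. No bound on \<beta> is available; main terms and errors both scale like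
  \<open>\<epsilon> * \<beta> ^ 3\<close>, so \<beta> cancels. Everything is proved at one fixed
  \<epsilon> with constants free of \<epsilon>; limits are taken only at the end.\<close>

fun ck :: "nat \<Rightarrow> (real \<Rightarrow> real \<Rightarrow> real) \<Rightarrow> bool" where
  "ck 0 f \<longleftrightarrow> continuous_on UNIV (\<lambda>(t, \<theta>). f t \<theta>)"
| "ck (Suc k) f \<longleftrightarrow> continuous_on UNIV (\<lambda>(t, \<theta>). f t \<theta>)
     \<and> (\<forall>t \<theta>. (\<lambda>s. f s \<theta>) differentiable at t \<and> (\<lambda>s. f t s) differentiable at \<theta>)
     \<and> ck k (pt f) \<and> ck k (pth f)"

lemma ck_cont: "ck k f \<Longrightarrow> continuous_on UNIV (\<lambda>(t, \<theta>). f t \<theta>)"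
  by (cases k) auto

lemma pt_eqI: "(\<And>t \<theta>. ((\<lambda>s. f s \<theta>) has_real_derivative f' t \<theta>) (at t)) \<Longrightarrow> pt f = f'"
  unfolding pt_def by (intro ext DERIV_imp_deriv) auto

lemma pth_eqI: "(\<And>t \<theta>. ((\<lambda>s. f t s) has_real_derivative f' t \<theta>) (at \<theta>)) \<Longrightarrow> pth f = f'"
  unfolding pth_def by (intro ext DERIV_imp_deriv) auto

lemma ck_pt_deriv: "ck (Suc k) f \<Longrightarrow> ((\<lambda>s. f s \<theta>) has_real_derivative pt f t \<theta>) (at t)"
  unfolding pt_def ck.simps by (simp add: DERIV_deriv_iff_real_differentiable)

lemma ck_pth_deriv: "ck (Suc k) f \<Longrightarrow> ((\<lambda>s. f t s) has_real_derivative pth f t \<theta>) (at \<theta>)"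
  unfolding pth_def ck.simps by (simp add: DERIV_deriv_iff_real_differentiable)

text \<open>\<open>ck\<close> demands joint continuity at every level, since separate partial
  derivatives alone do not give it, and integrals over the tube rely on it. With explicit candidates
  for the two derivatives, closure of the class under each operation is an induction on k.\<close>

lemma ck_SucI:
  assumes "continuous_on UNIV (\<lambda>(t, \<theta>). f t \<theta>)"
    and t: "\<And>t \<theta>. ((\<lambda>s. f s \<theta>) has_real_derivative ft t \<theta>) (at t)"
    and th: "\<And>t \<theta>. ((\<lambda>s. f t s) has_real_derivative fh t \<theta>) (at \<theta>)"
    and "ck k ft" "ck k fh"
  shows "ck (Suc k) f"
proof -
  have "(\<lambda>s. f s \<theta>) differentiable at t" "(\<lambda>s. f t s) differentiable at \<theta>" for t \<theta>
    using t th real_differentiable_def by blast+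
  then show ?thesis using assms pt_eqI[of f ft, OF t] pth_eqI[of f fh, OF th] by simp
qed

lemma ck_SucD: "ck (Suc k) f \<Longrightarrow> ck k f"
proof (induction k arbitrary: f)
  case (Suc k)
  from Suc.prems have p: "ck (Suc k) (pt f)" "ck (Suc k) (pth f)"
    unfolding ck.simps(2)[of "Suc k"] by blast+
  show ?case unfolding ck.simps(2)[of k] using Suc.IH[OF p(1)] Suc.IH[OF p(2)] Suc.prems
    unfolding ck.simps(2)[of "Suc k"] by blast
qed simp

lemma ck_pt: "ck (Suc k) f \<Longrightarrow> ck k (pt f)" and ck_pth: "ck (Suc k) f \<Longrightarrow> ck k (pth f)"
  by simp_all

lemma ck_const: "ck k (\<lambda>t \<theta>. c)"
proof (induction k arbitrary: c)
  case 0 show ?case by simp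
next
  case (Suc k)
  show ?case by (rule ck_SucI[where ft="\<lambda>_ _. 0" and fh="\<lambda>_ _. 0"]) (auto simp: Suc)
qed

lemma ck_t: "ck k (\<lambda>t \<theta>. t)"
proof (cases k)
  case 0 then show ?thesis by (auto simp: split_def intro!: continuous_intros)
next
  case (Suc k)
  show ?thesis unfolding Suc
    by (rule ck_SucI[where ft="\<lambda>_ _. 1" and fh="\<lambda>_ _. 0"])
      (auto simp: split_def ck_const intro!: continuous_intros)
qed

lemma ck_th: "ck k (\<lambda>t \<theta>. \<theta>)"
proof (cases k)
  case 0 then show ?thesis by (auto simp: split_def intro!: continuous_intros)
next
  case (Suc k)
  show ?thesis unfolding Suc
    by (rule ck_SucI[where ft="\<lambda>_ _. 0" and fh="\<lambda>_ _. 1"])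
      (auto simp: split_def ck_const intro!: continuous_intros)
qed

lemma ck_add: "ck k f \<Longrightarrow> ck k g \<Longrightarrow> ck k (\<lambda>t \<theta>. f t \<theta> + g t \<theta>)"
proof (induction k arbitrary: f g)
  case 0 then show ?case unfolding ck.simps split_def by (intro continuous_on_add)
next
  case (Suc k)
  have "continuous_on UNIV (\<lambda>(t, \<theta>). f t \<theta> + g t \<theta>)"
    using ck_cont[OF Suc.prems(1)] ck_cont[OF Suc.prems(2)] unfolding split_def by (rule continuous_on_add)
  then show ?case
    by (rule ck_SucI[OF _ DERIV_add[OF ck_pt_deriv[OF Suc.prems(1)] ck_pt_deriv[OF Suc.prems(2)]]
        DERIV_add[OF ck_pth_deriv[OF Suc.prems(1)] ck_pth_deriv[OF Suc.prems(2)]]])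
      (intro Suc.IH ck_pt[OF Suc.prems(1)] ck_pt[OF Suc.prems(2)] ck_pth[OF Suc.prems(1)] ck_pth[OF Suc.prems(2)])+
qed

lemma ck_mult: "ck k f \<Longrightarrow> ck k g \<Longrightarrow> ck k (\<lambda>t \<theta>. f t \<theta> * g t \<theta>)"
proof (induction k arbitrary: f g)
  case 0 then show ?case unfolding ck.simps split_def by (intro continuous_on_mult)
next
  case (Suc k)
  have "continuous_on UNIV (\<lambda>(t, \<theta>). f t \<theta> * g t \<theta>)"
    using ck_cont[OF Suc.prems(1)] ck_cont[OF Suc.prems(2)] unfolding split_def by (rule continuous_on_mult)
  then show ?case
    by (rule ck_SucI[OF _ DERIV_mult[OF ck_pt_deriv[OF Suc.prems(1)] ck_pt_deriv[OF Suc.prems(2)]]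
        DERIV_mult[OF ck_pth_deriv[OF Suc.prems(1)] ck_pth_deriv[OF Suc.prems(2)]]])
      (intro ck_add Suc.IH ck_pt[OF Suc.prems(1)] ck_pt[OF Suc.prems(2)] ck_pth[OF Suc.prems(1)]
        ck_pth[OF Suc.prems(2)] ck_SucD[OF Suc.prems(1)] ck_SucD[OF Suc.prems(2)])+
qed

lemma ck_diff: "ck k f \<Longrightarrow> ck k g \<Longrightarrow> ck k (\<lambda>t \<theta>. f t \<theta> - g t \<theta>)"
  using ck_add[of k f "\<lambda>t \<theta>. (-1) * g t \<theta>"] ck_mult[OF ck_const[of k "-1"], of g] by simp

lemma pt_diff: "ck (Suc k) f \<Longrightarrow> ck (Suc k) g \<Longrightarrow> pt (\<lambda>t \<theta>. f t \<theta> - g t \<theta>) = (\<lambda>t \<theta>. pt f t \<theta> - pt g t \<theta>)"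
  by (intro pt_eqI DERIV_diff ck_pt_deriv)

lemma pth_diff: "ck (Suc k) f \<Longrightarrow> ck (Suc k) g \<Longrightarrow> pth (\<lambda>t \<theta>. f t \<theta> - g t \<theta>) = (\<lambda>t \<theta>. pth f t \<theta> - pth g t \<theta>)"
  by (intro pth_eqI DERIV_diff ck_pth_deriv)

lemma ck_inverse:
  assumes "\<And>t \<theta>. f t \<theta> \<noteq> 0"
  shows "ck k f \<Longrightarrow> ck k (\<lambda>t \<theta>. inverse (f t \<theta>))"
proof (induction k)
  case 0 then show ?case using assms by (auto simp: split_def intro!: continuous_intros)
next
  case (Suc k)
  have I: "ck k (\<lambda>t \<theta>. inverse (f t \<theta>))" using Suc.IH[OF ck_SucD[OF Suc.prems]] .
  have c: "continuous_on UNIV (\<lambda>(t, \<theta>). inverse (f t \<theta>))"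
    using ck_cont[OF Suc.prems] assms unfolding split_def by (intro continuous_on_inverse) auto
  have m: "- x = (-1) * x" for x :: real by simp
  show ?case
    by (rule ck_SucI[OF c DERIV_inverse'[OF ck_pt_deriv[OF Suc.prems] assms] DERIV_inverse'[OF ck_pth_deriv[OF Suc.prems] assms]])
      (subst m, intro ck_mult ck_const I ck_pt[OF Suc.prems] ck_pth[OF Suc.prems])+
qed

lemma ck_sqrt:
  assumes "\<And>t \<theta>. f t \<theta> > 0"
  shows "ck k f \<Longrightarrow> ck k (\<lambda>t \<theta>. sqrt (f t \<theta>))"
proof (induction k)
  case 0 then show ?case using assms by (auto simp: split_def intro!: continuous_intros)
next
  case (Suc k)
  have "ck k (\<lambda>t \<theta>. sqrt (f t \<theta>))" using Suc.IH[OF ck_SucD[OF Suc.prems]] .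
  then have I: "ck k (\<lambda>t \<theta>. inverse (sqrt (f t \<theta>)))"
    by (rule ck_inverse[rotated]) (use assms in \<open>simp add: order_less_imp_not_eq2\<close>)
  have c: "continuous_on UNIV (\<lambda>(t, \<theta>). sqrt (f t \<theta>))"
    using ck_cont[OF Suc.prems] unfolding split_def by (rule continuous_on_real_sqrt)
  show ?case
    by (rule ck_SucI[OF c DERIV_chain2[OF DERIV_real_sqrt[OF assms] ck_pt_deriv[OF Suc.prems]]
        DERIV_chain2[OF DERIV_real_sqrt[OF assms] ck_pth_deriv[OF Suc.prems]]])
      (simp_all only: divide_inverse, (intro ck_mult ck_const I ck_pt[OF Suc.prems] ck_pth[OF Suc.prems])+)
qed

lemma continuous_on_compose_UNIV:
  "continuous_on UNIV h \<Longrightarrow> continuous_on S f \<Longrightarrow> continuous_on S (\<lambda>x. h (f x))"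
  by (rule continuous_on_compose2) auto

lemma DERIV_continuous_on_UNIV:
  "(\<And>x::real. (h has_real_derivative h' x) (at x)) \<Longrightarrow> continuous_on UNIV h"
  by (rule DERIV_continuous_on) (auto intro: has_field_derivative_at_within)

text \<open>The family \<open>h\<close> lists an outer function with all its derivatives. The index
  j stays arbitrary in the induction because differentiating once passes from \<open>h j\<close> to
  \<open>h (Suc j)\<close>.\<close>

lemma ck_compose:
  assumes h: "\<And>j x. (h j has_real_derivative h (Suc j) x) (at x)"
  shows "ck k f \<Longrightarrow> ck k (\<lambda>t \<theta>. h j (f t \<theta>))"
proof (induction k arbitrary: j)
  case 0
  then show ?case using continuous_on_compose_UNIV[OF DERIV_continuous_on_UNIV[OF h]]
    by (simp add: split_def)
next
  case (Suc k)
  have c: "continuous_on UNIV (\<lambda>(t, \<theta>). h j (f t \<theta>))"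
    using continuous_on_compose_UNIV[OF DERIV_continuous_on_UNIV[OF h]] ck_cont[OF Suc.prems]
    by (simp add: split_def)
  show ?case
    by (rule ck_SucI[OF c DERIV_chain2[OF h ck_pt_deriv[OF Suc.prems]] DERIV_chain2[OF h ck_pth_deriv[OF Suc.prems]]])
      (rule ck_mult[OF Suc.IH[OF ck_SucD[OF Suc.prems]] ck_pt[OF Suc.prems]]
         ck_mult[OF Suc.IH[OF ck_SucD[OF Suc.prems]] ck_pth[OF Suc.prems]])+
qed

text \<open>This avoids formulas for the higher derivatives of the profile: by the differential
  equation, derivatives of \<open>h\<close> and \<open>h'\<close> are polynomials in
  \<open>h\<close> and \<open>h'\<close>. Neither function can be treated alone, so the induction
  carries both.\<close>

lemma ck_compose_ode:
  assumes "\<And>x. (h has_real_derivative h' x) (at x)"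
    and "\<And>x. (h' has_real_derivative h x - h x ^ 3) (at x)"
  shows "ck k f \<Longrightarrow> ck k (\<lambda>t \<theta>. h (f t \<theta>)) \<and> ck k (\<lambda>t \<theta>. h' (f t \<theta>))"
proof (induction k)
  case 0
  show ?case using 0 unfolding split_def ck.simps
    by (intro conjI) (rule continuous_on_compose_UNIV[OF DERIV_continuous_on_UNIV[OF assms(1)]]
      continuous_on_compose_UNIV[OF DERIV_continuous_on_UNIV[OF assms(2)]], assumption)+
next
  case (Suc k)
  have c: "continuous_on UNIV (\<lambda>(t, \<theta>). h (f t \<theta>))" "continuous_on UNIV (\<lambda>(t, \<theta>). h' (f t \<theta>))"
    using ck_cont[OF Suc.prems] unfolding split_def
    by (rule continuous_on_compose_UNIV[OF DERIV_continuous_on_UNIV[OF assms(1)]]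
      continuous_on_compose_UNIV[OF DERIV_continuous_on_UNIV[OF assms(2)]])+
  have I: "ck k (\<lambda>t \<theta>. h (f t \<theta>))" "ck k (\<lambda>t \<theta>. h' (f t \<theta>))" using Suc.IH[OF ck_SucD[OF Suc.prems]] by auto
  have J: "ck k (\<lambda>t \<theta>. h (f t \<theta>) - h (f t \<theta>) ^ 3)"
    unfolding power3_eq_cube by (rule ck_diff[OF I(1) ck_mult[OF ck_mult[OF I(1) I(1)] I(1)]])
  note d = ck_pt_deriv[OF Suc.prems] ck_pth_deriv[OF Suc.prems] and p = ck_pt[OF Suc.prems] ck_pth[OF Suc.prems]
  have "ck (Suc k) (\<lambda>t \<theta>. h (f t \<theta>))"
    by (rule ck_SucI[OF c(1) DERIV_chain2[OF assms(1) d(1)] DERIV_chain2[OF assms(1) d(2)]])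
      (rule ck_mult[OF I(2) p(1)] ck_mult[OF I(2) p(2)])+
  moreover have "ck (Suc k) (\<lambda>t \<theta>. h' (f t \<theta>))"
    by (rule ck_SucI[OF c(2) DERIV_chain2[OF assms(2) d(1)] DERIV_chain2[OF assms(2) d(2)]])
      (rule ck_mult[OF J p(1)] ck_mult[OF J p(2)])+
  ultimately show ?case ..
qed

section \<open>Smooth functions on the plane and the chain rule\<close>

lemma smooth2_cont: "smooth2 f \<Longrightarrow> continuous_on UNIV f"
  unfolding smooth2_def by (drule spec[of _ "[]"]) simp

lemma iter_pd_append: "iter_pd (vs @ ws) f = iter_pd vs (iter_pd ws f)"
  by (induction vs) auto

lemma smooth2_pdir:
  assumes "smooth2 f" "v \<in> {1, \<i>}"
  shows "smooth2 (pdir v f)"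
proof -
  have "iter_pd vs (pdir v f) = iter_pd (vs @ [v]) f" for vs
    by (simp add: iter_pd_append)
  then show ?thesis using assms unfolding smooth2_def
    by (auto simp del: iter_pd.simps)
qed

lemma smooth2_pdir_deriv:
  assumes "smooth2 f" "v \<in> {1, \<i>}"
  shows "((\<lambda>s. f (z + of_real s * v)) has_real_derivative pdir v f z) (at 0)"
proof -
  have "(\<lambda>s. f (z + of_real s * v)) differentiable (at 0)"
    using assms unfolding smooth2_def by (elim allE[of _ "[]"]) auto
  then show ?thesis unfolding pdir_def by (simp add: DERIV_deriv_iff_real_differentiable)
qed

text \<open>\<open>smooth2\<close> speaks only of derivatives along the two axes. Existence of one
  partial derivative and existence with continuity of the other give a total derivative, and with it
  the chain rule along arbitrary paths.\<close>

lemma smooth2_has_derivative_pair: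
  assumes f: "smooth2 f"
  shows "((\<lambda>(x, y). f (Complex x y)) has_derivative
    (\<lambda>(h, k). h * pdir 1 f (Complex x y) + k * pdir \<i> f (Complex x y))) (at (x, y))"
proof -
  let ?f = "\<lambda>x y. f (Complex x y)"
  have Dx: "((\<lambda>x. ?f x y) has_real_derivative pdir 1 f (Complex x y)) (at x)" for x y
  proof -
    have "(\<lambda>s. f (Complex x y + of_real s * 1)) = (\<lambda>s. f (Complex (s + x) y))"
      by (auto simp: complex_eq_iff intro!: ext arg_cong[where f=f])
    then show ?thesis using smooth2_pdir_deriv[OF f, of 1 "Complex x y"]
      DERIV_shift[of "\<lambda>x. ?f x y" _ 0 x] by (simp add: add.commute)
  qed
  have Dx': "((\<lambda>x. ?f x y) has_derivative (\<lambda>h. pdir 1 f (Complex x y) * h)) (at x)" for x y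
    using Dx by (simp add: has_field_derivative_def)
  have Dy: "((\<lambda>y. ?f x y) has_real_derivative pdir \<i> f (Complex x y)) (at y)" for x y
  proof -
    have "(\<lambda>s. f (Complex x y + of_real s * \<i>)) = (\<lambda>s. f (Complex x (s + y)))"
      by (auto simp: complex_eq_iff intro!: ext arg_cong[where f=f])
    then show ?thesis using smooth2_pdir_deriv[OF f, of \<i> "Complex x y"]
      DERIV_shift[of "\<lambda>y. ?f x y" _ 0 y] by (simp add: add.commute)
  qed
  have cy: "continuous_on UNIV (pdir \<i> f)" using smooth2_cont[OF smooth2_pdir[OF f]] by simp
  have cc: "continuous_on UNIV (\<lambda>p::real\<times>real. Complex (fst p) (snd p))"
    unfolding Complex_eq by (intro continuous_intros)
  have "continuous_on UNIV (\<lambda>(x, y). blinfun_mult_right (pdir \<i> f (Complex x y)))"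
    unfolding split_def
    by (intro bounded_linear.continuous_on[OF bounded_linear_blinfun_mult_right]
        continuous_on_compose2[OF cy cc]) auto
  then have c: "continuous (at (x, y) within UNIV \<times> UNIV) (\<lambda>(x, y). blinfun_mult_right (pdir \<i> f (Complex x y)))"
    by (simp add: continuous_on_eq_continuous_within)
  have "((\<lambda>(x, y). ?f x y) has_derivative
    (\<lambda>(h, k). pdir 1 f (Complex x y) * h + blinfun_mult_right (pdir \<i> f (Complex x y)) k)) (at (x, y) within UNIV \<times> UNIV)"
    by (rule has_derivative_partialsI[OF _ _ c])
      (use Dx' Dy in \<open>auto simp: has_field_derivative_def\<close>)
  then show ?thesis by (simp add: mult.commute)
qed

lemma smooth2_chain:
  assumes f: "smooth2 f" and X: "(X has_real_derivative X') (at s)" and Y: "(Y has_real_derivative Y') (at s)"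
  shows "((\<lambda>s. f (Complex (X s) (Y s))) has_real_derivative
    pdir 1 f (Complex (X s) (Y s)) * X' + pdir \<i> f (Complex (X s) (Y s)) * Y') (at s)"
proof -
  have "((\<lambda>s. (X s, Y s)) has_derivative (\<lambda>h. (X' * h, Y' * h))) (at s)"
    using X Y by (auto simp: has_field_derivative_def intro: has_derivative_Pair)
  from has_derivative_compose[OF this smooth2_has_derivative_pair[OF f]]
  show ?thesis unfolding has_field_derivative_def
    by (auto simp: algebra_simps elim!: has_derivative_eq_rhs)
qed

lemma ck_smooth2:
  "smooth2 f \<Longrightarrow> ck k X \<Longrightarrow> ck k Y \<Longrightarrow> ck k (\<lambda>t \<theta>. f (Complex (X t \<theta>) (Y t \<theta>)))"
proof (induction k arbitrary: f)
  case 0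
  then have "continuous_on UNIV (\<lambda>p. Complex (X (fst p) (snd p)) (Y (fst p) (snd p)))"
    unfolding Complex_eq by (auto simp: split_def intro!: continuous_intros)
  then show ?case using continuous_on_compose_UNIV[OF smooth2_cont[OF 0(1)]] by (simp add: split_def)
next
  case (Suc k)
  have "continuous_on UNIV (\<lambda>p. Complex (X (fst p) (snd p)) (Y (fst p) (snd p)))"
    using ck_cont[OF Suc(3)] ck_cont[OF Suc(4)]
    unfolding Complex_eq by (auto simp: split_def intro!: continuous_intros)
  then have c: "continuous_on UNIV (\<lambda>(t, \<theta>). f (Complex (X t \<theta>) (Y t \<theta>)))"
    using continuous_on_compose_UNIV[OF smooth2_cont[OF Suc(2)]] by (simp add: split_def)
  show ?case
    by (rule ck_SucI[OF c smooth2_chain[OF Suc(2) ck_pt_deriv[OF Suc(3)] ck_pt_deriv[OF Suc(4)]]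
        smooth2_chain[OF Suc(2) ck_pth_deriv[OF Suc(3)] ck_pth_deriv[OF Suc(4)]]])
      (intro ck_add ck_mult Suc.IH smooth2_pdir Suc(2) ck_SucD[OF Suc(3)] ck_SucD[OF Suc(4)]
        ck_pt[OF Suc(3)] ck_pth[OF Suc(3)] ck_pt[OF Suc(4)] ck_pth[OF Suc(4)]; simp)+
qed

lemma ck_cont_fst: "ck k f \<Longrightarrow> continuous_on S (\<lambda>t. f t \<theta>)"
  and ck_cont_snd: "ck k f \<Longrightarrow> continuous_on S (\<lambda>\<theta>. f t \<theta>)"
proof -
  assume "ck k f"
  from ck_cont[OF this] have c: "continuous_on UNIV (\<lambda>p. f (fst p) (snd p))" by (simp add: split_def)
  show "continuous_on S (\<lambda>t. f t \<theta>)"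
    by (rule continuous_on_compose2[OF c, of S "\<lambda>t. (t, \<theta>)", simplified]) (auto intro!: continuous_intros)
  show "continuous_on S (\<lambda>\<theta>. f t \<theta>)"
    by (rule continuous_on_compose2[OF c, of S "\<lambda>\<theta>. (t, \<theta>)", simplified]) (auto intro!: continuous_intros)
qed

text \<open>Write \<open>f t x\<close> as its value at a base point plus the integral of
  \<open>pth f\<close>, differentiate in t under the integral sign, then recover the
  \<theta>-derivative by the fundamental theorem of calculus. The concentration hypothesis bounds
  \<open>pt (pth \<phi>)\<close>, while the slice estimate of \<open>pt \<phi>\<close> needs
  \<open>pth (pt \<phi>)\<close>.\<close>

lemma ck_clairaut:
  assumes f: "ck (Suc (Suc 0)) f"
  shows "pt (pth f) = pth (pt f)"
proof (rule pth_eqI[symmetric])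
  fix t \<theta> :: real
  have f1: "ck (Suc 0) (pth f)" "ck (Suc 0) f" "ck 0 (pt (pth f))"
    by (rule ck_pth[OF f], rule ck_SucD[OF f], rule ck_pt[OF ck_pth[OF f]])
  define c where "c = pt (pth f) "
  have cc: "continuous_on UNIV (\<lambda>(t, \<theta>). c t \<theta>)" unfolding c_def by (rule ck_cont[OF f1(3)])
  \<comment> \<open>With this base point \<theta> is interior to \<open>{?a..\<theta>+1}\<close>, so
    the derivative within the interval is a two-sided one.\<close>
  let ?a = "\<theta> - 1"
  have E: "pt f t x = pt f t ?a + integral {?a..x} (c t)" if "x \<in> {?a..\<theta>+1}" for x
  proof -
    have "((\<lambda>t. integral (cbox ?a x) (pth f t)) has_field_derivative integral (cbox ?a x) (c t)) (at t within UNIV)"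
      by (rule leibniz_rule_field_derivative)
        (use ck_pt_deriv[OF f1(1)] in \<open>auto simp: c_def intro!: integrable_continuous_real ck_cont_snd[OF f1(1)]
           continuous_on_subset[OF cc[unfolded c_def]]\<close>)
    then have 1: "((\<lambda>t. f t ?a + integral {?a..x} (pth f t)) has_real_derivative 
        (pt f t ?a + integral {?a..x} (c t))) (at t)"
      by (auto intro!: DERIV_add ck_pt_deriv[OF f1(2)])
    have "f t ?a + integral {?a..x} (pth f t) = f t x" for t
    proof -
      have "(pth f t has_integral (f t x - f t ?a)) {?a..x}"
        using that ck_pth_deriv[OF f1(2)]
        by (intro fundamental_theorem_of_calculus)
          (auto simp: has_real_derivative_iff_has_vector_derivative[symmetric] intro: has_field_derivative_at_within)
      then show ?thesis by (simp add: integral_unique)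
    qed
    then have "((\<lambda>t. f t x) has_real_derivative (pt f t ?a + integral {?a..x} (c t))) (at t)"
      using 1 by simp
    then show ?thesis using ck_pt_deriv[OF f1(2)] DERIV_unique by blast
  qed
  have ct: "continuous_on {?a..\<theta>+1} (c t)"
    using ck_cont_snd[OF f1(3)] by (simp add: c_def)
  have "((\<lambda>x. pt f t ?a + integral {?a..x} (c t)) has_real_derivative c t \<theta>) (at \<theta> within {?a..\<theta>+1})"
    using DERIV_add[OF DERIV_const integral_has_real_derivative[OF ct, of \<theta>]] by simp
  then have "((\<lambda>x. pt f t x) has_real_derivative c t \<theta>) (at \<theta> within {?a..\<theta>+1})"
    by (rule has_field_derivative_transform_within[where d=1, OF _ zero_less_one]) (simp, rule E[symmetric])
  then show "((\<lambda>x. pt f t x) has_real_derivative c t \<theta>) (at \<theta>)"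
    by (simp add: at_within_Icc_at)
qed

section \<open>The soliton profile and a Sobolev inequality\<close>

lemma soliton_explicit:
  fixes U :: "real \<Rightarrow> real"
  assumes U_diff: "\<And>x. U differentiable (at x)" "\<And>x. deriv U differentiable (at x)"
    and U_ode: "\<And>x. deriv (deriv U) x - U x + U x ^ 3 = 0"
    and U_pos: "\<And>x. U x > 0" and U_d0: "deriv U 0 = 0"
    and U_top: "(U \<longlongrightarrow> 0) at_top"
  shows "U x = sqrt 2 / cosh x"
proof -
  have D1: "(U has_real_derivative deriv U x) (at x)" for x
    using U_diff(1) by (simp add: DERIV_deriv_iff_real_differentiable)
  have D2: "(deriv U has_real_derivative (U x - U x ^ 3)) (at x)" for x
  proof -
    have "deriv (deriv U) x = U x - U x ^ 3" using U_ode[of x] by simp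
    then show ?thesis using U_diff(2)[of x] DERIV_deriv_iff_real_differentiable by metis
  qed
  define E where "E x = (deriv U x)\<^sup>2 - (U x)\<^sup>2 + U x ^ 4 / 2" for x
  have "(E has_real_derivative 0) (at x)" for x
    unfolding E_def
    by (auto intro!: derivative_eq_intros D1 D2 simp: algebra_simps power2_eq_square power3_eq_cube power4_eq_xxxx)
  then have Econst: "E x = E y" for x y by (rule DERIV_isconst_all[rule_format]) 
  \<comment> \<open>Decay of \<open>deriv U\<close> is not assumed. The mean value theorem on
    [n, n+1] yields points tending to infinity along which it vanishes in the limit, and that
    suffices to evaluate the constant energy.\<close>
  have "\<exists>\<xi>. real n < \<xi> \<and> U (real n + 1) - U (real n) = deriv U \<xi>" for n
    using MVT2[of "real n" "real n + 1" U "deriv U"] D1 by auto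
  then obtain \<xi> where \<xi>: "\<And>n. real n < \<xi> n" "\<And>n. U (real n + 1) - U (real n) = deriv U (\<xi> n)"
    by metis
  have top: "filterlim \<xi> at_top sequentially"
    by (rule filterlim_at_top_mono[OF filterlim_real_sequentially]) (intro always_eventually allI less_imp_le \<xi>(1))
  have "filterlim (\<lambda>n. real n + 1) at_top sequentially"
    by (rule filterlim_at_top_mono[OF filterlim_real_sequentially]) auto
  then have "(\<lambda>n. U (real n + 1) - U (real n)) \<longlonglongrightarrow> 0 - 0"
    by (intro tendsto_diff filterlim_compose[OF U_top] filterlim_real_sequentially)
  then have "(\<lambda>n. deriv U (\<xi> n)) \<longlonglongrightarrow> 0" using \<xi>(2) by simp
  then have "(\<lambda>n. E (\<xi> n)) \<longlonglongrightarrow> 0\<^sup>2 - 0\<^sup>2 + 0 ^ 4 / 2"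
    unfolding E_def by (intro tendsto_intros filterlim_compose[OF U_top top]) auto
  then have "(\<lambda>n. E x) \<longlonglongrightarrow> 0" for x
    unfolding Econst[of "\<xi> _" x] by simp
  then have E0: "E x = 0" for x using LIMSEQ_unique tendsto_const by blast
  then have en: "(deriv U x)\<^sup>2 = (U x)\<^sup>2 - U x ^ 4 / 2" for x unfolding E_def by (simp add: algebra_simps)
  have "(U 0)\<^sup>2 * ((U 0)\<^sup>2 - 2) = 0" using en[of 0] U_d0 by (simp add: algebra_simps power2_eq_square power4_eq_xxxx)
  then have "(U 0)\<^sup>2 = 2" using U_pos[of 0] by auto
  then have U0: "U 0 = sqrt 2" using U_pos[of 0] by (metis less_eq_real_def real_sqrt_abs2 real_sqrt_unique)
  define P where "P x = inverse (U x)" for x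
  define Q where "Q x = - deriv U x / (U x)\<^sup>2" for x
  have U_ne: "U x \<noteq> 0" for x using U_pos[of x] by simp
  have DP: "(P has_real_derivative Q x) (at x)" for x
    unfolding P_def Q_def using DERIV_inverse'[OF D1 U_ne]
    by (rule DERIV_cong) (simp add: field_simps power2_eq_square)
  have DQ: "(Q has_real_derivative P x) (at x)" for x
  proof -
    have "(Q has_real_derivative ((- (U x - U x ^ 3)) * (U x)\<^sup>2 - (- deriv U x) * (2 * U x * deriv U x)) / ((U x)\<^sup>2 * (U x)\<^sup>2)) (at x)"
      unfolding Q_def by (rule derivative_eq_intros D1 D2 refl | simp add: U_ne power2_eq_square)+
    \<comment> \<open>Inserting \<open>en\<close> cancels the terms of degree five and leaves
      \<open>U x ^ 3\<close>; with a nonzero energy the equation for \<open>P\<close> would not be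
      linear.\<close>
    moreover have "((- (U x - U x ^ 3)) * (U x)\<^sup>2 - (- deriv U x) * (2 * U x * deriv U x)) / ((U x)\<^sup>2 * (U x)\<^sup>2) = P x"
    proof -
      have sq: "(- deriv U x) * (2 * U x * deriv U x) = - 2 * U x * (deriv U x)\<^sup>2" by (simp add: power2_eq_square)
      have "(- (U x - U x ^ 3)) * (U x)\<^sup>2 - (- deriv U x) * (2 * U x * deriv U x) = U x ^ 3"
        unfolding sq en by (simp add: algebra_simps power2_eq_square power3_eq_cube power4_eq_xxxx)
      then show ?thesis unfolding P_def using U_ne[of x] by (simp add: field_simps power2_eq_square power3_eq_cube)
    qed
    ultimately show ?thesis by simp
  qed
  \<comment> \<open>\<open>Q\<close> is the derivative of \<open>P\<close> and \<open>P\<close> the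
    derivative of \<open>Q\<close>, so \<open>P + Q\<close> and \<open>P - Q\<close> are multiples
    of the growing and of the decaying exponential.\<close>
  have "((\<lambda>x. (P x + Q x) * exp (-x)) has_real_derivative 0) (at x)" for x
    by (rule derivative_eq_intros DP DQ refl)+ (simp add: algebra_simps)
  then have A: "(P x + Q x) * exp (-x) = (P 0 + Q 0) * exp (-0)" by (rule DERIV_isconst_all[rule_format])
  have "((\<lambda>x. (P x - Q x) * exp x) has_real_derivative 0) (at x)" for x
    by (rule derivative_eq_intros DP DQ refl)+ (simp add: algebra_simps)
  then have B: "(P x - Q x) * exp x = (P 0 - Q 0) * exp 0" by (rule DERIV_isconst_all[rule_format])
  have 0: "Q 0 = 0" "P 0 = inverse (sqrt 2)" unfolding Q_def P_def using U_d0 U0 by auto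
  have "P x + Q x = exp x / sqrt 2" using A 0 by (simp add: exp_minus field_simps)
  moreover have "P x - Q x = exp (-x) / sqrt 2" using B 0 by (simp add: exp_minus field_simps)
  ultimately have "2 * P x = (exp x + exp (-x)) / sqrt 2" by (simp add: add_divide_distrib)
  then have "P x = cosh x / sqrt 2" by (simp add: cosh_def)
  then show ?thesis unfolding P_def by (metis inverse_divide inverse_inverse_eq)
qed

section \<open>Interpolation on an interval\<close>

lemma abs_mult_le_weighted:
  fixes x y c :: real
  assumes "c > 0"
  shows "2 * \<bar>x * y\<bar> \<le> c * x\<^sup>2 + y\<^sup>2 / c"
proof -
  have "0 \<le> (c * \<bar>x\<bar> - \<bar>y\<bar>)\<^sup>2 / c" using assms by simp
  also have "\<dots> = c * x\<^sup>2 + y\<^sup>2 / c - 2 * \<bar>x * y\<bar>"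
    using assms by (simp add: power2_diff field_simps power_mult_distrib abs_mult) (simp add: power2_eq_square)
  finally show ?thesis by simp
qed

text \<open>Compare \<open>(g x)\<^sup>2\<close> with \<open>(g y)\<^sup>2\<close> through the
  derivative \<open>2 * g * g'\<close>, then average over y. The weight c is left free: c = 1 serves
  along the curve, c = \<open>1 / \<epsilon>\<close> across it, where a derivative costs a factor
  \<open>1 / \<epsilon>\<close>.\<close>

lemma sobolev_interval:
  fixes g g' :: "real \<Rightarrow> real"
  assumes ab: "a < b" and x: "x \<in> {a..b}" and c: "c > 0"
    and g: "\<And>x. x \<in> {a..b} \<Longrightarrow> (g has_real_derivative g' x) (at x within {a..b})"
    and g': "continuous_on {a..b} g'"
  shows "(g x)\<^sup>2 \<le> (1 / (b - a) + c) * integral {a..b} (\<lambda>s. (g s)\<^sup>2) + 1 / c * integral {a..b} (\<lambda>s. (g' s)\<^sup>2)"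
proof -
  have gc: "continuous_on {a..b} g" using g DERIV_continuous_on by blast
  define R where "R = integral {a..b} (\<lambda>s. c * (g s)\<^sup>2 + (g' s)\<^sup>2 / c)"
  have ci: "continuous_on {a..b} (\<lambda>s. c * (g s)\<^sup>2 + (g' s)\<^sup>2 / c)"
    using c by (intro continuous_intros gc g') auto
  have seg: "\<bar>(g v)\<^sup>2 - (g u)\<^sup>2\<bar> \<le> R" if "a \<le> u" "u \<le> v" "v \<le> b" for u v
  proof -
    have sub: "{u..v} \<subseteq> {a..b}" using that by auto
    have d: "((\<lambda>s. (g s)\<^sup>2) has_real_derivative 2 * (g s * g' s)) (at s within {u..v})" if "s \<in> {u..v}" for s
      using that sub
      by (auto intro!: derivative_eq_intros DERIV_subset[OF g sub])
    have "((\<lambda>s. 2 * (g s * g' s)) has_integral ((g v)\<^sup>2 - (g u)\<^sup>2)) {u..v}"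
      using that d by (intro fundamental_theorem_of_calculus)
        (auto simp: has_real_derivative_iff_has_vector_derivative[symmetric])
    then have "\<bar>(g v)\<^sup>2 - (g u)\<^sup>2\<bar> = \<bar>integral {u..v} (\<lambda>s. 2 * (g s * g' s))\<bar>" by (simp only: integral_unique)
    also have "\<dots> \<le> integral {u..v} (\<lambda>s. c * (g s)\<^sup>2 + (g' s)\<^sup>2 / c)"
    proof (rule Henstock_Kurzweil_Integration.integral_norm_bound_integral[where f="\<lambda>s. 2 * (g s * g' s)", unfolded real_norm_def])
      show "(\<lambda>s. 2 * (g s * g' s)) integrable_on {u..v}"
        using sub by (intro integrable_continuous_real continuous_intros)
          (auto intro: continuous_on_subset[OF gc] continuous_on_subset[OF g'])
      show "(\<lambda>s. c * (g s)\<^sup>2 + (g' s)\<^sup>2 / c) integrable_on {u..v}"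
        by (rule integrable_continuous_real[OF continuous_on_subset[OF ci sub]])
      show "\<bar>2 * (g s * g' s)\<bar> \<le> c * (g s)\<^sup>2 + (g' s)\<^sup>2 / c" for s
        using abs_mult_le_weighted[OF c, of "g s" "g' s"] by (simp add: abs_mult)
    qed
    also have "\<dots> \<le> R" unfolding R_def
      using c sub by (intro integral_subset_le integrable_continuous_real ci continuous_on_subset[OF ci sub]) auto
    finally show ?thesis .
  qed
  have "(g x)\<^sup>2 \<le> (g y)\<^sup>2 + R" if "y \<in> {a..b}" for y
    using seg[of x y] seg[of y x] x that by (cases "x \<le> y") auto
  then have "integral {a..b} (\<lambda>y. (g x)\<^sup>2) \<le> integral {a..b} (\<lambda>y. (g y)\<^sup>2 + R)"
    by (intro integral_le integrable_continuous_real continuous_intros gc) auto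
  also have "\<dots> = integral {a..b} (\<lambda>y. (g y)\<^sup>2) + integral {a..b} (\<lambda>y. R)"
    by (intro Henstock_Kurzweil_Integration.integral_add integrable_continuous_real continuous_intros gc)
  finally have "(b - a) * (g x)\<^sup>2 \<le> integral {a..b} (\<lambda>s. (g s)\<^sup>2) + (b - a) * R"
    using ab by simp
  then have "(g x)\<^sup>2 \<le> 1 / (b - a) * integral {a..b} (\<lambda>s. (g s)\<^sup>2) + R"
    using ab by (simp add: field_simps)
  moreover have "R = c * integral {a..b} (\<lambda>s. (g s)\<^sup>2) + 1 / c * integral {a..b} (\<lambda>s. (g' s)\<^sup>2)"
  proof -
    have "R = integral {a..b} (\<lambda>s. c * (g s)\<^sup>2) + integral {a..b} (\<lambda>s. (g' s)\<^sup>2 / c)" unfolding R_def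
      using c by (intro Henstock_Kurzweil_Integration.integral_add integrable_continuous_real continuous_intros gc g') auto
    then show ?thesis by simp
  qed
  ultimately show ?thesis by (simp add: algebra_simps)
qed

section \<open>The local Pohozaev identity\<close>

lemma sq_le_twice: "(x::real)\<^sup>2 \<le> 2 * y\<^sup>2 + 2 * (x - y)\<^sup>2"
  using zero_le_power2[of "x - 2 * y"] by (simp add: power2_eq_square algebra_simps)

text \<open>For m the relative size of x - y, the weights m and \<open>2 / m\<close> make both terms
  of order m: the square of x - y will integrate to order \<open>m\<^sup>2\<close>.\<close>

lemma sq_diff_le:
  fixes x y m :: real
  assumes "0 < m" "m \<le> 1"
  shows "\<bar>x\<^sup>2 - y\<^sup>2\<bar> \<le> m * y\<^sup>2 + 2 / m * (x - y)\<^sup>2"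
proof -
  have "x\<^sup>2 - y\<^sup>2 = 2 * (y * (x - y)) + (x - y)\<^sup>2" by (simp add: power2_eq_square algebra_simps)
  then have "\<bar>x\<^sup>2 - y\<^sup>2\<bar> \<le> 2 * \<bar>y * (x - y)\<bar> + (x - y)\<^sup>2"
    using zero_le_power2[of "x - y"] by linarith
  also have "\<dots> \<le> m * y\<^sup>2 + (x - y)\<^sup>2 / m + (x - y)\<^sup>2"
    using abs_mult_le_weighted[OF assms(1), of y "x - y"] by simp
  also have "\<dots> \<le> m * y\<^sup>2 + (x - y)\<^sup>2 / m + (x - y)\<^sup>2 / m" using mult_left_le[OF assms(2), of "(x - y)\<^sup>2"] assms(1)
    by (intro add_left_mono) (simp add: le_divide_eq)
  finally show ?thesis by simp
qed

lemma fourth_le: "(x::real) ^ 4 \<le> 8 * y ^ 4 + 8 * (x - y) ^ 4"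
proof -
  have e: "z ^ 4 = (z\<^sup>2)\<^sup>2" for z :: real by simp
  have "(x\<^sup>2)\<^sup>2 \<le> (2 * y\<^sup>2 + 2 * (x - y)\<^sup>2)\<^sup>2"
    by (rule power_mono[OF sq_le_twice]) simp
  also have "\<dots> \<le> 2 * (2 * y\<^sup>2)\<^sup>2 + 2 * (2 * (x - y)\<^sup>2)\<^sup>2"
    using sq_le_twice[of "2 * y\<^sup>2 + 2 * (x - y)\<^sup>2" "2 * y\<^sup>2"] by simp
  finally show ?thesis unfolding e by (simp add: power_mult_distrib)
qed

text \<open>In a strip that is narrow compared with the radius of curvature the Jacobian
  \<open>1 + \<kappa> * t\<close> stays above 1/2. Replacing the weighted coefficient of the
  curvature term by \<open>\<delta>\<^sup>2\<close> then costs only O(|t|), an error that gains a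
  factor \<epsilon> on the soliton.\<close>

lemma curvature_weight:
  fixes \<kappa> t \<delta> C :: real
  assumes "\<bar>t\<bar> \<le> \<delta>" "\<delta> \<le> 1" "\<bar>\<kappa>\<bar> \<le> C" "C * \<delta> \<le> 1/2"
  shows "1/2 \<le> 1 + \<kappa> * t"
    and "\<bar>(\<delta>\<^sup>2 - t\<^sup>2) / (1 + \<kappa> * t) - \<delta>\<^sup>2\<bar> \<le> 4 * \<bar>t\<bar>"
    and "0 \<le> (\<delta>\<^sup>2 - t\<^sup>2) / (1 + \<kappa> * t) ^ 2" "(\<delta>\<^sup>2 - t\<^sup>2) / (1 + \<kappa> * t) ^ 2 \<le> 4"
    and "0 \<le> (\<delta>\<^sup>2 - t\<^sup>2) / (1 + \<kappa> * t) ^ 3" "(\<delta>\<^sup>2 - t\<^sup>2) / (1 + \<kappa> * t) ^ 3 \<le> 8"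
    and "0 \<le> \<delta>\<^sup>2 - t\<^sup>2" "\<delta>\<^sup>2 - t\<^sup>2 \<le> 1" "t\<^sup>2 \<le> \<bar>t\<bar>"
proof -
  have \<delta>0: "0 \<le> \<delta>" using assms by linarith
  have "\<bar>\<kappa> * t\<bar> \<le> C * \<delta>" unfolding abs_mult using assms \<delta>0 by (intro mult_mono) auto
  then have kt: "\<bar>\<kappa> * t\<bar> \<le> 1/2" using assms by linarith
  then show J: "1/2 \<le> 1 + \<kappa> * t" by linarith
  have t1: "\<bar>t\<bar> \<le> 1" using assms by linarith
  show t2: "t\<^sup>2 \<le> \<bar>t\<bar>" using mult_left_mono[OF t1, of "\<bar>t\<bar>"] by (simp add: power2_eq_square)
  show e0: "0 \<le> \<delta>\<^sup>2 - t\<^sup>2" using assms(1) \<delta>0 by (simp add: abs_le_square_iff[symmetric])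
  have "\<delta>\<^sup>2 \<le> 1" using assms \<delta>0 by (simp add: power_le_one)
  then show e1: "\<delta>\<^sup>2 - t\<^sup>2 \<le> 1" using zero_le_power2[of t] by linarith
  have pos: "0 < 1 + \<kappa> * t" using J by linarith
  show "0 \<le> (\<delta>\<^sup>2 - t\<^sup>2) / (1 + \<kappa> * t) ^ 2" "0 \<le> (\<delta>\<^sup>2 - t\<^sup>2) / (1 + \<kappa> * t) ^ 3"
    using e0 pos by simp_all
  have "(1/2) ^ 2 \<le> (1 + \<kappa> * t) ^ 2" "(1/2) ^ 3 \<le> (1 + \<kappa> * t) ^ 3" by (rule power_mono[OF J], simp)+
  then show "(\<delta>\<^sup>2 - t\<^sup>2) / (1 + \<kappa> * t) ^ 2 \<le> 4" "(\<delta>\<^sup>2 - t\<^sup>2) / (1 + \<kappa> * t) ^ 3 \<le> 8"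
    using e1 pos by (simp_all add: divide_le_eq power_divide)
  have "(\<delta>\<^sup>2 - t\<^sup>2) / (1 + \<kappa> * t) - \<delta>\<^sup>2 = (- t\<^sup>2 - \<delta>\<^sup>2 * (\<kappa> * t)) / (1 + \<kappa> * t)"
    using pos by (simp add: field_simps)
  moreover have "\<bar>- t\<^sup>2 - \<delta>\<^sup>2 * (\<kappa> * t)\<bar> \<le> 2 * \<bar>t\<bar>"
  proof -
    have "\<bar>\<delta>\<^sup>2 * (\<kappa> * t)\<bar> = (\<delta> * (\<delta> * \<bar>\<kappa>\<bar>)) * \<bar>t\<bar>" using \<delta>0 by (simp add: abs_mult power2_eq_square)
    also have "\<dots> \<le> 1 * \<bar>t\<bar>"
    proof (rule mult_right_mono)
      have "\<delta> * \<bar>\<kappa>\<bar> \<le> 1" using mult_left_mono[OF assms(3) \<delta>0] assms(4) by (simp add: mult.commute)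
      then show "\<delta> * (\<delta> * \<bar>\<kappa>\<bar>) \<le> 1" using mult_le_one[OF assms(2), of "\<delta> * \<bar>\<kappa>\<bar>"] \<delta>0 by simp
    qed simp
    finally show ?thesis using t2 zero_le_power2[of t] unfolding mult_1 by linarith
  qed
  ultimately show "\<bar>(\<delta>\<^sup>2 - t\<^sup>2) / (1 + \<kappa> * t) - \<delta>\<^sup>2\<bar> \<le> 4 * \<bar>t\<bar>"
  proof -
    assume a: "(\<delta>\<^sup>2 - t\<^sup>2) / (1 + \<kappa> * t) - \<delta>\<^sup>2 = (- t\<^sup>2 - \<delta>\<^sup>2 * (\<kappa> * t)) / (1 + \<kappa> * t)"
      and b: "\<bar>- t\<^sup>2 - \<delta>\<^sup>2 * (\<kappa> * t)\<bar> \<le> 2 * \<bar>t\<bar>"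
    have "2 * \<bar>t\<bar> \<le> 4 * \<bar>t\<bar> * (1 + \<kappa> * t)" using mult_left_mono[OF J, of "4 * \<bar>t\<bar>"] by simp
    then have "\<bar>- t\<^sup>2 - \<delta>\<^sup>2 * (\<kappa> * t)\<bar> / (1 + \<kappa> * t) \<le> 4 * \<bar>t\<bar>" using b pos by (simp add: divide_le_eq)
    then show ?thesis using pos unfolding a by (simp add: abs_divide)
  qed
qed

text \<open>The second term on the left is the derivative of \<open>\<eta> (- \<epsilon>\<^sup>2 v'\<^sup>2 / 2 + V v\<^sup>2 / 2 - v\<^sup>4 / 4)\<close>
  with \<open>v''\<close> eliminated by the equation; its integral vanishes because \<open>\<eta>\<close> does at the end points.\<close>
lemma pohozaev_pointwise:
  fixes \<epsilon> \<beta> \<kappa> \<kappa>' \<delta> C m t v v' p q V V1 V10 b b' :: real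
  assumes \<epsilon>: "0 < \<epsilon>" "\<epsilon> \<le> 1" and \<beta>: "1 \<le> \<beta>" and t: "\<bar>t\<bar> \<le> \<delta>" and \<delta>: "\<delta> \<le> 1"
    and C: "1 \<le> C" "\<bar>\<kappa>\<bar> \<le> C" "\<bar>\<kappa>'\<bar> \<le> C" "\<bar>\<kappa>\<bar> * \<delta> \<le> 1/2" and m: "0 < m" "m \<le> 1"
    and V: "\<bar>V\<bar> \<le> C * \<beta>\<^sup>2" "\<bar>V10\<bar> \<le> C * \<beta>\<^sup>2" "\<bar>V1 - V10\<bar> \<le> C * \<beta>\<^sup>2 * \<bar>t\<bar>"
    and f: "(v - b)\<^sup>2 \<le> C * m\<^sup>2"
  defines "\<eta> \<equiv> \<delta>\<^sup>2 - t\<^sup>2"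
  shows "\<bar>\<delta>\<^sup>2 * (\<kappa> * \<epsilon>\<^sup>2 * b'\<^sup>2 + V10 * b\<^sup>2 / 2)
     - (- 2 * t * (- \<epsilon>\<^sup>2 * v'\<^sup>2 / 2 + V * v\<^sup>2 / 2 - v ^ 4 / 4)
       + \<eta> * (\<epsilon>\<^sup>2 * (\<kappa> / (1 + \<kappa> * t) * v'\<^sup>2 + q / (1 + \<kappa> * t)\<^sup>2 * v' - t * \<kappa>' * p / (1 + \<kappa> * t) ^ 3 * v')
              + V1 * v\<^sup>2 / 2))\<bar>
   \<le> 10 * C * \<epsilon>\<^sup>2 * (\<bar>t\<bar> * b'\<^sup>2) + 12 * C * \<epsilon>\<^sup>2 * (m + \<epsilon>) * b'\<^sup>2 + 34 * C * \<epsilon>\<^sup>2 / m * (v' - b')\<^sup>2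
     + 4 * C * \<beta>\<^sup>2 * (\<bar>t\<bar> * b\<^sup>2) + C * \<beta>\<^sup>2 * m * b\<^sup>2 + 12 * C * \<beta>\<^sup>2 / m * (v - b)\<^sup>2
     + 2 * \<epsilon> * q\<^sup>2 + 4 * C * \<epsilon> * p\<^sup>2 + 4 * (\<bar>t\<bar> * b ^ 4)"
    (is "\<bar>?main - ?I\<bar> \<le> _")
proof -
  define F where "F = (v' - b')\<^sup>2"
  define f where "f = (v - b)\<^sup>2"
  define J where "J = 1 + \<kappa> * t"
  note cw = curvature_weight[OF t \<delta> order.refl C(4), folded \<eta>_def J_def]
  have \<delta>0: "0 \<le> \<delta>" using t by linarith
  have \<delta>2: "\<delta>\<^sup>2 \<le> 1" "0 \<le> \<delta>\<^sup>2" using \<delta> \<delta>0 by (simp_all add: power_le_one)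
  have nn: "0 \<le> F" "0 \<le> f" unfolding F_def f_def by simp_all
  have t1: "\<bar>t\<bar> \<le> 1" using t \<delta> by linarith
  have v': "v'\<^sup>2 \<le> 2 * b'\<^sup>2 + 2 * F" unfolding F_def by (rule sq_le_twice)
  have v: "v\<^sup>2 \<le> 2 * b\<^sup>2 + 2 * f" unfolding f_def by (rule sq_le_twice)
  have tv': "\<bar>t\<bar> * v'\<^sup>2 \<le> 2 * (\<bar>t\<bar> * b'\<^sup>2) + 2 * F"
    using mult_left_mono[OF v', of "\<bar>t\<bar>"] mult_right_mono[OF t1 nn(1)] by (simp add: algebra_simps)
  have tv: "\<bar>t\<bar> * v\<^sup>2 \<le> 2 * (\<bar>t\<bar> * b\<^sup>2) + 2 * f"
    using mult_left_mono[OF v, of "\<bar>t\<bar>"] mult_right_mono[OF t1 nn(2)] by (simp add: algebra_simps)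
  have dv': "\<bar>v'\<^sup>2 - b'\<^sup>2\<bar> \<le> m * b'\<^sup>2 + 2 / m * F" unfolding F_def by (rule sq_diff_le[OF m])
  have dv: "\<bar>v\<^sup>2 - b\<^sup>2\<bar> \<le> m * b\<^sup>2 + 2 / m * f" unfolding f_def by (rule sq_diff_le[OF m])
  have Fm: "F \<le> F / m" and fm: "f \<le> f / m" using m nn mult_left_le[OF m(2)]
    by (simp_all add: le_divide_eq)
  have \<beta>2: "1 \<le> \<beta>\<^sup>2" using \<beta> by (simp add: one_le_power)
  define T1 where "T1 = \<kappa> * (\<eta> / J * v'\<^sup>2 - \<delta>\<^sup>2 * b'\<^sup>2)"
  define T2 where "T2 = \<eta> * V1 * v\<^sup>2 - \<delta>\<^sup>2 * V10 * b\<^sup>2"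
  define T3 where "T3 = \<eta> / J\<^sup>2 * (q * v')"
  define T4 where "T4 = \<eta> / J ^ 3 * (t * \<kappa>' * (p * v'))"
  \<comment> \<open>The terms are sorted by the reason why they are small: \<open>T1\<close> and
    \<open>T2\<close> compare curvature and potential terms with their values for the soliton at t =
    0, \<open>T3\<close> and \<open>T4\<close> contain \<theta>-derivatives, and the last three come
    from the derivative of the weight and carry a factor t.\<close>
  have id: "?main - ?I = - \<epsilon>\<^sup>2 * T1 - T2 / 2 - \<epsilon>\<^sup>2 * T3 + \<epsilon>\<^sup>2 * T4
      - \<epsilon>\<^sup>2 * (t * v'\<^sup>2) + t * V * v\<^sup>2 - t * v ^ 4 / 2"
    unfolding T1_def T2_def T3_def T4_def J_def[symmetric] by (simp add: algebra_simps add_divide_distrib diff_divide_distrib)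
  have b1: "\<bar>T1\<bar> \<le> C * (8 * (\<bar>t\<bar> * b'\<^sup>2) + m * b'\<^sup>2 + 10 * F / m)"
  proof -
    have "\<eta> / J * v'\<^sup>2 - \<delta>\<^sup>2 * b'\<^sup>2 = (\<eta> / J - \<delta>\<^sup>2) * v'\<^sup>2 + \<delta>\<^sup>2 * (v'\<^sup>2 - b'\<^sup>2)" by (simp add: algebra_simps)
    then have "\<bar>\<eta> / J * v'\<^sup>2 - \<delta>\<^sup>2 * b'\<^sup>2\<bar> \<le> \<bar>\<eta> / J - \<delta>\<^sup>2\<bar> * v'\<^sup>2 + \<delta>\<^sup>2 * \<bar>v'\<^sup>2 - b'\<^sup>2\<bar>"
      using abs_triangle_ineq[of "(\<eta> / J - \<delta>\<^sup>2) * v'\<^sup>2" "\<delta>\<^sup>2 * (v'\<^sup>2 - b'\<^sup>2)"] by (simp add: abs_mult)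
    also have "\<dots> \<le> 4 * \<bar>t\<bar> * v'\<^sup>2 + 1 * \<bar>v'\<^sup>2 - b'\<^sup>2\<bar>"
      using cw(2) \<delta>2 by (intro add_mono mult_right_mono) auto
    also have "\<dots> \<le> 8 * (\<bar>t\<bar> * b'\<^sup>2) + m * b'\<^sup>2 + 10 * F / m"
      using tv' dv' Fm by simp
    finally show ?thesis unfolding T1_def abs_mult using C by (intro mult_mono) auto
  qed
  have b2: "\<bar>T2\<bar> \<le> C * \<beta>\<^sup>2 * (4 * (\<bar>t\<bar> * b\<^sup>2) + m * b\<^sup>2 + 6 * f / m)"
  proof -
    have "T2 = \<eta> * (V1 - V10) * v\<^sup>2 + (- t\<^sup>2) * V10 * v\<^sup>2 + \<delta>\<^sup>2 * V10 * (v\<^sup>2 - b\<^sup>2)"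
      unfolding T2_def \<eta>_def by (simp add: algebra_simps)
    then have "\<bar>T2\<bar> \<le> \<bar>\<eta> * (V1 - V10) * v\<^sup>2\<bar> + \<bar>(- t\<^sup>2) * V10 * v\<^sup>2\<bar> + \<bar>\<delta>\<^sup>2 * V10 * (v\<^sup>2 - b\<^sup>2)\<bar>"
      by linarith
    also have "\<dots> = \<eta> * \<bar>V1 - V10\<bar> * v\<^sup>2 + t\<^sup>2 * \<bar>V10\<bar> * v\<^sup>2 + \<delta>\<^sup>2 * \<bar>V10\<bar> * \<bar>v\<^sup>2 - b\<^sup>2\<bar>"
      using cw(7) by (simp add: abs_mult)
    also have "\<dots> \<le> 1 * (C * \<beta>\<^sup>2 * \<bar>t\<bar>) * v\<^sup>2 + \<bar>t\<bar> * (C * \<beta>\<^sup>2) * v\<^sup>2 + 1 * (C * \<beta>\<^sup>2) * \<bar>v\<^sup>2 - b\<^sup>2\<bar>"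
      using cw(7,8,9) \<delta>2 V C by (intro add_mono mult_right_mono mult_mono) auto
    also have "\<dots> = C * \<beta>\<^sup>2 * (2 * (\<bar>t\<bar> * v\<^sup>2) + \<bar>v\<^sup>2 - b\<^sup>2\<bar>)" by (simp add: algebra_simps)
    also have "\<dots> \<le> C * \<beta>\<^sup>2 * (4 * (\<bar>t\<bar> * b\<^sup>2) + m * b\<^sup>2 + 6 * f / m)"
      using tv dv fm C by (intro mult_left_mono) auto
    finally show ?thesis .
  qed
  \<comment> \<open>Weight \<epsilon> is the balanced choice: x stands for p or q, whose square
    integrates to O(\<open>\<epsilon> * \<beta>\<close>), while that of v' integrates to
    O(\<open>\<beta> ^ 3 / \<epsilon>\<close>). Both halves end up as
    O(\<open>\<epsilon>\<^sup>2 * \<beta> ^ 3\<close>), so the \<theta>-derivatives need only be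
    bounded.\<close>
  have aux: "\<epsilon>\<^sup>2 * \<bar>x * v'\<bar> \<le> (\<epsilon> * x\<^sup>2 + 2 * \<epsilon> ^ 3 * b'\<^sup>2 + 2 * \<epsilon> ^ 3 * F) / 2" for x
  proof -
    have "\<epsilon>\<^sup>2 * (2 * \<bar>v' * x\<bar>) \<le> \<epsilon>\<^sup>2 * (\<epsilon> * v'\<^sup>2 + x\<^sup>2 / \<epsilon>)"
      using abs_mult_le_weighted[OF \<epsilon>(1), of v' x] by (intro mult_left_mono) auto
    also have "\<dots> = \<epsilon> ^ 3 * v'\<^sup>2 + \<epsilon> * x\<^sup>2" using \<epsilon> by (simp add: power2_eq_square power3_eq_cube field_simps)
    also have "\<dots> \<le> \<epsilon> ^ 3 * (2 * b'\<^sup>2 + 2 * F) + \<epsilon> * x\<^sup>2" using v' \<epsilon> by simp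
    finally show ?thesis by (simp add: mult.commute algebra_simps)
  qed
  have b3: "\<epsilon>\<^sup>2 * \<bar>T3\<bar> \<le> 2 * \<epsilon> * q\<^sup>2 + 4 * \<epsilon> ^ 3 * b'\<^sup>2 + 4 * \<epsilon> ^ 3 * F"
  proof -
    have "\<bar>T3\<bar> \<le> 4 * \<bar>q * v'\<bar>" unfolding T3_def abs_mult[of "\<eta> / J\<^sup>2"]
      using cw(3,4) by (intro mult_right_mono) auto
    then have "\<epsilon>\<^sup>2 * \<bar>T3\<bar> \<le> 4 * (\<epsilon>\<^sup>2 * \<bar>q * v'\<bar>)" using mult_left_mono[of "\<bar>T3\<bar>" _ "\<epsilon>\<^sup>2"] by fastforce
    moreover have "A \<le> 2 * a + 4 * b + 4 * c" if "A \<le> 4 * X" "X \<le> (a + 2 * b + 2 * c) / 2" for A X a b c :: real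
      using that by argo
    ultimately show ?thesis using aux[of q] unfolding mult.assoc by blast
  qed
  have b4: "\<epsilon>\<^sup>2 * \<bar>T4\<bar> \<le> C * (4 * \<epsilon> * p\<^sup>2 + 8 * \<epsilon> ^ 3 * b'\<^sup>2 + 8 * \<epsilon> ^ 3 * F)"
  proof -
    have "\<bar>t * \<kappa>' * (p * v')\<bar> \<le> (1 * C) * \<bar>p * v'\<bar>" unfolding abs_mult[of "t * \<kappa>'"] abs_mult[of t]
      using t1 C by (intro mult_right_mono mult_mono) auto
    then have "\<bar>T4\<bar> \<le> 8 * ((1 * C) * \<bar>p * v'\<bar>)" unfolding T4_def abs_mult[of "\<eta> / J ^ 3"]
      using cw(5,6) by (intro mult_mono) auto
    from mult_left_mono[OF this zero_le_power2[of \<epsilon>]]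
    have "\<epsilon>\<^sup>2 * \<bar>T4\<bar> \<le> C * (8 * (\<epsilon>\<^sup>2 * \<bar>p * v'\<bar>))" by (simp add: mult_ac)
    also have "\<dots> \<le> C * (4 * \<epsilon> * p\<^sup>2 + 8 * \<epsilon> ^ 3 * b'\<^sup>2 + 8 * \<epsilon> ^ 3 * F)"
    proof (rule mult_left_mono)
      have "8 * X \<le> 4 * a + 8 * b + 8 * c" if "X \<le> (a + 2 * b + 2 * c) / 2" for X a b c :: real
        using that by argo
      then show "8 * (\<epsilon>\<^sup>2 * \<bar>p * v'\<bar>) \<le> 4 * \<epsilon> * p\<^sup>2 + 8 * \<epsilon> ^ 3 * b'\<^sup>2 + 8 * \<epsilon> ^ 3 * F"
        using aux[of p] unfolding mult.assoc by blast
    qed (use C in simp)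
    finally show ?thesis .
  qed
  have b5: "\<epsilon>\<^sup>2 * \<bar>t * v'\<^sup>2\<bar> \<le> \<epsilon>\<^sup>2 * (2 * (\<bar>t\<bar> * b'\<^sup>2) + 2 * F)"
    using tv' by (intro mult_left_mono) (auto simp: abs_mult)
  have b6: "\<bar>t * V * v\<^sup>2\<bar> \<le> C * \<beta>\<^sup>2 * (2 * (\<bar>t\<bar> * b\<^sup>2) + 2 * f)"
  proof -
    have "\<bar>t * V * v\<^sup>2\<bar> = \<bar>V\<bar> * (\<bar>t\<bar> * v\<^sup>2)" by (simp add: abs_mult mult_ac)
    also have "\<dots> \<le> C * \<beta>\<^sup>2 * (2 * (\<bar>t\<bar> * b\<^sup>2) + 2 * f)" using V(1) tv C by (intro mult_mono) auto
    finally show ?thesis .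
  qed
  have b7: "\<bar>t * v ^ 4 / 2\<bar> \<le> 4 * (\<bar>t\<bar> * b ^ 4) + 4 * C * \<beta>\<^sup>2 * f"
  proof -
    \<comment> \<open>An L2 bound does not control the fourth power; the pointwise bound on v - b
      turns one of the two factors f into a constant.\<close>
    have "(v - b) ^ 4 = f * f" unfolding f_def by (simp add: power2_eq_square power4_eq_xxxx)
    also have "\<dots> \<le> C * m\<^sup>2 * f" using f nn by (intro mult_right_mono) (auto simp: f_def)
    also have "\<dots> \<le> C * \<beta>\<^sup>2 * f"
    proof -
      have "m\<^sup>2 \<le> 1" using m by (simp add: power_le_one)
      then show ?thesis using \<beta>2 C nn by (intro mult_right_mono mult_left_mono) linarith+
    qed
    finally have f4: "(v - b) ^ 4 \<le> C * \<beta>\<^sup>2 * f" .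
    have "\<bar>t\<bar> * v ^ 4 \<le> \<bar>t\<bar> * (8 * b ^ 4 + 8 * (v - b) ^ 4)" by (intro mult_left_mono fourth_le) auto
    also have "\<dots> \<le> 8 * (\<bar>t\<bar> * b ^ 4) + 8 * (v - b) ^ 4"
      using mult_right_mono[OF t1, of "(v - b) ^ 4"] by (simp add: algebra_simps)
    finally show ?thesis using f4 by (simp add: abs_mult)
  qed
  have "\<bar>?main - ?I\<bar> \<le> \<epsilon>\<^sup>2 * \<bar>T1\<bar> + \<bar>T2\<bar> / 2 + \<epsilon>\<^sup>2 * \<bar>T3\<bar> + \<epsilon>\<^sup>2 * \<bar>T4\<bar>
      + \<epsilon>\<^sup>2 * \<bar>t * v'\<^sup>2\<bar> + \<bar>t * V * v\<^sup>2\<bar> + \<bar>t * v ^ 4 / 2\<bar>"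
  proof -
    have "\<bar>- x1 - x2 - x3 + x4 - x5 + x6 - x7\<bar> \<le> \<bar>x1\<bar> + \<bar>x2\<bar> + \<bar>x3\<bar> + \<bar>x4\<bar> + \<bar>x5\<bar> + \<bar>x6\<bar> + \<bar>x7\<bar>"
      for x1 x2 x3 x4 x5 x6 x7 :: real
    proof -
      have "\<bar>- x1 - x2 - x3 + x4\<bar> \<le> \<bar>x1\<bar> + \<bar>x2\<bar> + \<bar>x3\<bar> + \<bar>x4\<bar>" by linarith
      moreover have "\<bar>- x5 + x6 - x7\<bar> \<le> \<bar>x5\<bar> + \<bar>x6\<bar> + \<bar>x7\<bar>" by linarith
      moreover have "- x1 - x2 - x3 + x4 - x5 + x6 - x7 = (- x1 - x2 - x3 + x4) + (- x5 + x6 - x7)" by simp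
      ultimately show ?thesis
        using abs_triangle_ineq[of "- x1 - x2 - x3 + x4" "- x5 + x6 - x7"] by argo
    qed
    from this[of "\<epsilon>\<^sup>2 * T1" "T2 / 2" "\<epsilon>\<^sup>2 * T3" "\<epsilon>\<^sup>2 * T4" "\<epsilon>\<^sup>2 * (t * v'\<^sup>2)" "t * V * v\<^sup>2" "t * v ^ 4 / 2"]
    show ?thesis unfolding id abs_mult[of "\<epsilon>\<^sup>2"] by simp
  qed
  also have "\<dots> \<le> \<epsilon>\<^sup>2 * (C * (8 * (\<bar>t\<bar> * b'\<^sup>2) + m * b'\<^sup>2 + 10 * F / m))
     + C * \<beta>\<^sup>2 * (4 * (\<bar>t\<bar> * b\<^sup>2) + m * b\<^sup>2 + 6 * f / m) / 2
     + (2 * \<epsilon> * q\<^sup>2 + 4 * \<epsilon> ^ 3 * b'\<^sup>2 + 4 * \<epsilon> ^ 3 * F)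
     + C * (4 * \<epsilon> * p\<^sup>2 + 8 * \<epsilon> ^ 3 * b'\<^sup>2 + 8 * \<epsilon> ^ 3 * F)
     + \<epsilon>\<^sup>2 * (2 * (\<bar>t\<bar> * b'\<^sup>2) + 2 * F) + C * \<beta>\<^sup>2 * (2 * (\<bar>t\<bar> * b\<^sup>2) + 2 * f)
     + (4 * (\<bar>t\<bar> * b ^ 4) + 4 * C * \<beta>\<^sup>2 * f)"
    by (intro add_mono b3 b4 b5 b6 b7 mult_left_mono[OF b1 zero_le_power2] divide_right_mono[OF b2]) simp
  also have "\<dots> \<le> 10 * C * \<epsilon>\<^sup>2 * (\<bar>t\<bar> * b'\<^sup>2) + 12 * C * \<epsilon>\<^sup>2 * (m + \<epsilon>) * b'\<^sup>2 + 34 * C * \<epsilon>\<^sup>2 / m * F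
     + 4 * C * \<beta>\<^sup>2 * (\<bar>t\<bar> * b\<^sup>2) + C * \<beta>\<^sup>2 * m * b\<^sup>2 + 12 * C * \<beta>\<^sup>2 / m * f
     + 2 * \<epsilon> * q\<^sup>2 + 4 * C * \<epsilon> * p\<^sup>2 + 4 * (\<bar>t\<bar> * b ^ 4)"
  proof -
    have c1: "\<epsilon>\<^sup>2 * (\<bar>t\<bar> * b'\<^sup>2) \<le> C * (\<epsilon>\<^sup>2 * (\<bar>t\<bar> * b'\<^sup>2))" using mult_right_mono[OF C(1), of "\<epsilon>\<^sup>2 * (\<bar>t\<bar> * b'\<^sup>2)"] by simp
    have c2: "\<epsilon> ^ 3 * b'\<^sup>2 \<le> C * (\<epsilon> ^ 3 * b'\<^sup>2)" using mult_right_mono[OF C(1), of "\<epsilon> ^ 3 * b'\<^sup>2"] \<epsilon> by simp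
    have e3: "\<epsilon> ^ 3 \<le> \<epsilon>\<^sup>2" using power_decreasing[of 2 3 \<epsilon>] \<epsilon> by simp
    have c3: "C * (\<epsilon> ^ 3 * F) \<le> C * (\<epsilon>\<^sup>2 * (F / m))"
      using e3 Fm C \<epsilon> nn by (intro mult_left_mono mult_mono) auto
    have c4: "\<epsilon> ^ 3 * F \<le> C * (\<epsilon>\<^sup>2 * (F / m))"
    proof -
      have "0 \<le> \<epsilon> ^ 3 * F" using \<epsilon> nn by simp
      from mult_right_mono[OF C(1) this] show ?thesis using c3 unfolding mult_1 by (rule order.trans)
    qed
    have c5: "\<epsilon>\<^sup>2 * F \<le> C * (\<epsilon>\<^sup>2 * (F / m))"
    proof -
      have "\<epsilon>\<^sup>2 * F \<le> \<epsilon>\<^sup>2 * (F / m)" using Fm by (intro mult_left_mono) auto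
      also have "\<dots> \<le> C * (\<epsilon>\<^sup>2 * (F / m))" using mult_right_mono[OF C(1), of "\<epsilon>\<^sup>2 * (F / m)"] nn m by simp
      finally show ?thesis .
    qed
    have c6: "C * (\<beta>\<^sup>2 * f) \<le> C * (\<beta>\<^sup>2 * (f / m))" using fm C by (intro mult_left_mono) auto
    have c7: "0 \<le> C * (\<beta>\<^sup>2 * (m * b\<^sup>2))" "0 \<le> C * (\<epsilon>\<^sup>2 * (m * b'\<^sup>2))"
      "0 \<le> C * (\<epsilon>\<^sup>2 * (F / m))" "0 \<le> C * (\<beta>\<^sup>2 * (f / m))" using C m nn by simp_all
    have g: "\<epsilon>\<^sup>2 * \<epsilon> = \<epsilon> ^ 3" by (simp add: power2_eq_square power3_eq_cube)
    have L: "\<epsilon>\<^sup>2 * (C * (8 * (\<bar>t\<bar> * b'\<^sup>2) + m * b'\<^sup>2 + 10 * F / m))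
     + C * \<beta>\<^sup>2 * (4 * (\<bar>t\<bar> * b\<^sup>2) + m * b\<^sup>2 + 6 * f / m) / 2
     + (2 * \<epsilon> * q\<^sup>2 + 4 * \<epsilon> ^ 3 * b'\<^sup>2 + 4 * \<epsilon> ^ 3 * F)
     + C * (4 * \<epsilon> * p\<^sup>2 + 8 * \<epsilon> ^ 3 * b'\<^sup>2 + 8 * \<epsilon> ^ 3 * F)
     + \<epsilon>\<^sup>2 * (2 * (\<bar>t\<bar> * b'\<^sup>2) + 2 * F) + C * \<beta>\<^sup>2 * (2 * (\<bar>t\<bar> * b\<^sup>2) + 2 * f)
     + (4 * (\<bar>t\<bar> * b ^ 4) + 4 * C * \<beta>\<^sup>2 * f)
     = 8 * (C * (\<epsilon>\<^sup>2 * (\<bar>t\<bar> * b'\<^sup>2))) + C * (\<epsilon>\<^sup>2 * (m * b'\<^sup>2)) + 10 * (C * (\<epsilon>\<^sup>2 * (F / m)))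
     + 2 * (C * \<beta>\<^sup>2 * (\<bar>t\<bar> * b\<^sup>2)) + C * (\<beta>\<^sup>2 * (m * b\<^sup>2)) / 2 + 3 * (C * (\<beta>\<^sup>2 * (f / m)))
     + 2 * \<epsilon> * q\<^sup>2 + 4 * (\<epsilon> ^ 3 * b'\<^sup>2) + 4 * (\<epsilon> ^ 3 * F) + 4 * C * \<epsilon> * p\<^sup>2 + 8 * (C * (\<epsilon> ^ 3 * b'\<^sup>2))
     + 8 * (C * (\<epsilon> ^ 3 * F)) + 2 * (\<epsilon>\<^sup>2 * (\<bar>t\<bar> * b'\<^sup>2)) + 2 * (\<epsilon>\<^sup>2 * F) + 2 * (C * \<beta>\<^sup>2 * (\<bar>t\<bar> * b\<^sup>2))
     + 2 * (C * (\<beta>\<^sup>2 * f)) + 4 * (\<bar>t\<bar> * b ^ 4) + 4 * (C * (\<beta>\<^sup>2 * f))"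
      by (simp add: algebra_simps)
    have R: "10 * C * \<epsilon>\<^sup>2 * (\<bar>t\<bar> * b'\<^sup>2) + 12 * C * \<epsilon>\<^sup>2 * (m + \<epsilon>) * b'\<^sup>2 + 34 * C * \<epsilon>\<^sup>2 / m * F
     + 4 * C * \<beta>\<^sup>2 * (\<bar>t\<bar> * b\<^sup>2) + C * \<beta>\<^sup>2 * m * b\<^sup>2 + 12 * C * \<beta>\<^sup>2 / m * f
     + 2 * \<epsilon> * q\<^sup>2 + 4 * C * \<epsilon> * p\<^sup>2 + 4 * (\<bar>t\<bar> * b ^ 4)
     = 10 * (C * (\<epsilon>\<^sup>2 * (\<bar>t\<bar> * b'\<^sup>2))) + 12 * (C * (\<epsilon>\<^sup>2 * (m * b'\<^sup>2))) + 12 * (C * (\<epsilon> ^ 3 * b'\<^sup>2))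
      + 34 * (C * (\<epsilon>\<^sup>2 * (F / m))) + 4 * (C * \<beta>\<^sup>2 * (\<bar>t\<bar> * b\<^sup>2)) + C * (\<beta>\<^sup>2 * (m * b\<^sup>2))
      + 12 * (C * (\<beta>\<^sup>2 * (f / m))) + 2 * \<epsilon> * q\<^sup>2 + 4 * C * \<epsilon> * p\<^sup>2 + 4 * (\<bar>t\<bar> * b ^ 4)"
      unfolding g[symmetric] by (simp add: algebra_simps)
    \<comment> \<open>Collecting gives 10 + 4 + 8 + 2 = 24 for \<open>F / m\<close> and 3 + 2 + 4 =
      9 for \<open>f / m\<close>, below the stated 34 and 12. For
      \<open>\<epsilon> ^ 3 * b'\<^sup>2\<close> the sum 4 + 8 = 12 is attained.\<close>
    show ?thesis unfolding L R using c1 c2 c3 c4 c5 c6 c7 by argo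
  qed
  finally show ?thesis unfolding F_def f_def .
qed

text \<open>The hypotheses \<open>I\<close> record how each quantity scales for a soliton of height
  \<beta> and width \<open>\<epsilon> / \<beta>\<close> perturbed by a relative error m. Under this
  scaling every error term of the pointwise estimate integrates to at most a multiple of
  \<open>\<epsilon> * \<beta> ^ 3 * (\<epsilon> + m)\<close>, the size of the main terms times a
  small factor.\<close>

lemma pohozaev_interval:
  fixes \<epsilon> \<beta> \<kappa> \<kappa>' \<delta> C m :: real and v v' v'' p q V V' b b' :: "real \<Rightarrow> real"
  defines "S \<equiv> {-\<delta>..\<delta>}"
  assumes \<epsilon>: "0 < \<epsilon>" "\<epsilon> \<le> 1" and \<beta>: "1 \<le> \<beta>" and \<delta>: "0 < \<delta>" "\<delta> \<le> 1"
    and C: "1 \<le> C" "\<bar>\<kappa>\<bar> \<le> C" "\<bar>\<kappa>'\<bar> \<le> C" "\<bar>\<kappa>\<bar> * \<delta> \<le> 1/2" and m: "0 < m" "m \<le> 1"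
    and v: "\<And>t. (v has_real_derivative v' t) (at t)"
    and v': "\<And>t. (v' has_real_derivative v'' t) (at t)"
    and DV: "\<And>t. (V has_real_derivative V' t) (at t)"
    and cont: "continuous_on S v''" "continuous_on S V'" "continuous_on S p" "continuous_on S q"
      "continuous_on S b" "continuous_on S b'"
    and ode: "\<And>t. t \<in> S \<Longrightarrow> - \<epsilon>\<^sup>2 * (v'' t + \<kappa> / (1 + \<kappa> * t) * v' t + q t / (1 + \<kappa> * t)\<^sup>2
        - t * \<kappa>' * p t / (1 + \<kappa> * t) ^ 3) + V t * v t - v t ^ 3 = 0"
    and V: "\<And>t. t \<in> S \<Longrightarrow> \<bar>V t\<bar> \<le> C * \<beta>\<^sup>2" "\<bar>V' 0\<bar> \<le> C * \<beta>\<^sup>2" "\<And>t. t \<in> S \<Longrightarrow> \<bar>V' t - V' 0\<bar> \<le> C * \<beta>\<^sup>2 * \<bar>t\<bar>"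
    and f: "\<And>t. t \<in> S \<Longrightarrow> (v t - b t)\<^sup>2 \<le> C * m\<^sup>2"
    and I: "integral S (\<lambda>t. (b' t)\<^sup>2) \<le> C * \<beta> ^ 3 / \<epsilon>" "integral S (\<lambda>t. \<bar>t\<bar> * (b' t)\<^sup>2) \<le> C * \<beta>\<^sup>2"
      "integral S (\<lambda>t. (b t)\<^sup>2) \<le> C * \<epsilon> * \<beta>" "integral S (\<lambda>t. \<bar>t\<bar> * (b t)\<^sup>2) \<le> C * \<epsilon>\<^sup>2"
      "integral S (\<lambda>t. \<bar>t\<bar> * b t ^ 4) \<le> C * \<beta>\<^sup>2 * \<epsilon>\<^sup>2"
      "integral S (\<lambda>t. (v t - b t)\<^sup>2) \<le> C * m\<^sup>2 * \<epsilon>" "integral S (\<lambda>t. (v' t - b' t)\<^sup>2) \<le> C * m\<^sup>2 / \<epsilon>"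
      "integral S (\<lambda>t. (p t)\<^sup>2) \<le> C * \<epsilon> * \<beta>" "integral S (\<lambda>t. (q t)\<^sup>2) \<le> C * \<epsilon> * \<beta>"
  shows "\<bar>\<delta>\<^sup>2 * (\<kappa> * \<epsilon>\<^sup>2 * integral S (\<lambda>t. (b' t)\<^sup>2) + V' 0 / 2 * integral S (\<lambda>t. (b t)\<^sup>2))\<bar>
     \<le> 83 * C\<^sup>2 * (\<epsilon> * \<beta> ^ 3 * (\<epsilon> + m))"
proof -
  have cv: "continuous_on S v" "continuous_on S v'" "continuous_on S V"
    using DERIV_continuous_on_UNIV[OF v] DERIV_continuous_on_UNIV[OF v'] DERIV_continuous_on_UNIV[OF DV]
    by (auto intro: continuous_on_subset)
  note ci = continuous_intros cv cont
  let ?main = "\<lambda>t. \<delta>\<^sup>2 * (\<kappa> * \<epsilon>\<^sup>2 * (b' t)\<^sup>2 + V' 0 * (b t)\<^sup>2 / 2)"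
  let ?G = "\<lambda>t. (\<delta>\<^sup>2 - t\<^sup>2) * (- \<epsilon>\<^sup>2 * (v' t)\<^sup>2 / 2 + V t * (v t)\<^sup>2 / 2 - v t ^ 4 / 4)"
  let ?I = "\<lambda>t. - 2 * t * (- \<epsilon>\<^sup>2 * (v' t)\<^sup>2 / 2 + V t * (v t)\<^sup>2 / 2 - v t ^ 4 / 4)
       + (\<delta>\<^sup>2 - t\<^sup>2) * (\<epsilon>\<^sup>2 * (\<kappa> / (1 + \<kappa> * t) * (v' t)\<^sup>2 + q t / (1 + \<kappa> * t)\<^sup>2 * v' t - t * \<kappa>' * p t / (1 + \<kappa> * t) ^ 3 * v' t)
              + V' t * (v t)\<^sup>2 / 2)"
  let ?I' = "\<lambda>t. - 2 * t * (- \<epsilon>\<^sup>2 * (v' t)\<^sup>2 / 2 + V t * (v t)\<^sup>2 / 2 - v t ^ 4 / 4)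
       + (\<delta>\<^sup>2 - t\<^sup>2) * (- \<epsilon>\<^sup>2 * v' t * v'' t + V' t * (v t)\<^sup>2 / 2 + V t * v t * v' t - v t ^ 3 * v' t)"
  have II: "?I' t = ?I t" if "t \<in> S" for t
  proof -
    have "- \<epsilon>\<^sup>2 * v'' t + V t * v t - v t ^ 3 = \<epsilon>\<^sup>2 * (\<kappa> / (1 + \<kappa> * t) * v' t + q t / (1 + \<kappa> * t)\<^sup>2
        - t * \<kappa>' * p t / (1 + \<kappa> * t) ^ 3)"
      using ode[OF that] by (simp add: algebra_simps)
    then have "v' t * (- \<epsilon>\<^sup>2 * v'' t + V t * v t - v t ^ 3) = v' t * (\<epsilon>\<^sup>2 * (\<kappa> / (1 + \<kappa> * t) * v' t + q t / (1 + \<kappa> * t)\<^sup>2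
        - t * \<kappa>' * p t / (1 + \<kappa> * t) ^ 3))" by simp
    then have "- \<epsilon>\<^sup>2 * v' t * v'' t + V' t * (v t)\<^sup>2 / 2 + V t * v t * v' t - v t ^ 3 * v' t
      = \<epsilon>\<^sup>2 * (\<kappa> / (1 + \<kappa> * t) * (v' t)\<^sup>2 + q t / (1 + \<kappa> * t)\<^sup>2 * v' t - t * \<kappa>' * p t / (1 + \<kappa> * t) ^ 3 * v' t)
              + V' t * (v t)\<^sup>2 / 2"
      by (simp add: algebra_simps power2_eq_square)
    then show ?thesis by simp
  qed
  have Gd: "(?G has_real_derivative ?I' t) (at t)" for t
    by (rule derivative_eq_intros v v' DV refl | simp)+
  have "(?I' has_integral (?G \<delta> - ?G (-\<delta>))) S" unfolding S_def
    using Gd \<delta> by (intro fundamental_theorem_of_calculus)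
      (simp_all only: has_real_derivative_iff_has_vector_derivative[symmetric] has_field_derivative_at_within)
  then have "(?I has_integral (?G \<delta> - ?G (-\<delta>))) S" by (rule has_integral_eq[rotated]) (rule II)
  moreover have "?G \<delta> - ?G (-\<delta>) = 0" by simp
  ultimately have I0: "(?I has_integral 0) S" by (simp only:)
  define B1 where "B1 = integral S (\<lambda>t. (b' t)\<^sup>2)"
  define B0 where "B0 = integral S (\<lambda>t. (b t)\<^sup>2)"
  define A where "A = (\<lambda>t. 10 * C * \<epsilon>\<^sup>2 * (\<bar>t\<bar> * (b' t)\<^sup>2) + 12 * C * \<epsilon>\<^sup>2 * (m + \<epsilon>) * (b' t)\<^sup>2 + 34 * C * \<epsilon>\<^sup>2 / m * (v' t - b' t)\<^sup>2
     + 4 * C * \<beta>\<^sup>2 * (\<bar>t\<bar> * (b t)\<^sup>2) + C * \<beta>\<^sup>2 * m * (b t)\<^sup>2 + 12 * C * \<beta>\<^sup>2 / m * (v t - b t)\<^sup>2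
     + 2 * \<epsilon> * (q t)\<^sup>2 + 4 * C * \<epsilon> * (p t)\<^sup>2 + 4 * (\<bar>t\<bar> * b t ^ 4))"
  have i: "g integrable_on S" if "continuous_on S g" for g :: "real \<Rightarrow> real"
    using that unfolding S_def by (rule integrable_continuous_real)
  have A: "(A has_integral 
     10 * C * \<epsilon>\<^sup>2 * integral S (\<lambda>t. \<bar>t\<bar> * (b' t)\<^sup>2) + 12 * C * \<epsilon>\<^sup>2 * (m + \<epsilon>) * integral S (\<lambda>t. (b' t)\<^sup>2)
     + 34 * C * \<epsilon>\<^sup>2 / m * integral S (\<lambda>t. (v' t - b' t)\<^sup>2)
     + 4 * C * \<beta>\<^sup>2 * integral S (\<lambda>t. \<bar>t\<bar> * (b t)\<^sup>2) + C * \<beta>\<^sup>2 * m * integral S (\<lambda>t. (b t)\<^sup>2)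
     + 12 * C * \<beta>\<^sup>2 / m * integral S (\<lambda>t. (v t - b t)\<^sup>2)
     + 2 * \<epsilon> * integral S (\<lambda>t. (q t)\<^sup>2) + 4 * C * \<epsilon> * integral S (\<lambda>t. (p t)\<^sup>2) + 4 * integral S (\<lambda>t. \<bar>t\<bar> * b t ^ 4)) S"
    (is "(_ has_integral ?A) S")
    unfolding A_def
    by (intro has_integral_add has_integral_mult_right integrable_integral i ci)
  have M: "(?main has_integral (\<delta>\<^sup>2 * (\<kappa> * \<epsilon>\<^sup>2 * B1 + V' 0 / 2 * B0))) S"
  proof -
    have "((\<lambda>t. \<delta>\<^sup>2 * (\<kappa> * \<epsilon>\<^sup>2 * (b' t)\<^sup>2 + V' 0 / 2 * (b t)\<^sup>2)) has_integral (\<delta>\<^sup>2 * (\<kappa> * \<epsilon>\<^sup>2 * B1 + V' 0 / 2 * B0))) S"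
      unfolding B1_def B0_def by (intro has_integral_add has_integral_mult_right integrable_integral i ci)
    then show ?thesis by simp
  qed
  have D: "((\<lambda>t. ?main t - ?I t) has_integral (\<delta>\<^sup>2 * (\<kappa> * \<epsilon>\<^sup>2 * B1 + V' 0 / 2 * B0))) S"
    using has_integral_diff[OF M I0] by simp
  have "norm (integral S (\<lambda>t. ?main t - ?I t)) \<le> integral S A"
  proof (rule Henstock_Kurzweil_Integration.integral_norm_bound_integral)
    fix t assume t: "t \<in> S"
    then have "\<bar>t\<bar> \<le> \<delta>" unfolding S_def by auto
    then show "norm (?main t - ?I t) \<le> A t" unfolding A_def real_norm_def
      by (intro pohozaev_pointwise \<epsilon> \<beta> \<delta> C m V t f)
  qed (use D A in auto)
  then have le: "\<bar>\<delta>\<^sup>2 * (\<kappa> * \<epsilon>\<^sup>2 * B1 + V' 0 / 2 * B0)\<bar> \<le> ?A"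
    using integral_unique[OF D] integral_unique[OF A] by simp
  define Z where "Z = C\<^sup>2 * (\<epsilon> * \<beta> ^ 3 * (\<epsilon> + m))"
  have CC: "C \<le> C\<^sup>2" using C by (simp add: power2_eq_square)
  have pw: "\<beta> \<le> \<beta> ^ 3" "\<beta>\<^sup>2 \<le> \<beta> ^ 3" "1 \<le> \<beta> ^ 3"
    using \<beta> power_increasing[of 1 3 \<beta>] power_increasing[of 2 3 \<beta>] one_le_power[of \<beta> 3] by simp_all
  \<comment> \<open>A common ceiling for all nine terms: each has one factor \<epsilon>, a power of
    \<beta> that is at most the third because \<beta> \<ge> 1, and one small factor, either
    \<epsilon> or m.\<close>
  have Zb: "C' * \<epsilon> * w * x \<le> Z" if "0 \<le> C'" "C' \<le> C\<^sup>2" "0 \<le> w" "w \<le> \<beta> ^ 3" "0 \<le> x" "x \<le> \<epsilon> + m" for C' w x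
  proof -
    have "C' * \<epsilon> * w * x \<le> C\<^sup>2 * \<epsilon> * \<beta> ^ 3 * (\<epsilon> + m)"
      using that \<epsilon> \<beta> by (intro mult_mono mult_nonneg_nonneg) auto
    then show ?thesis unfolding Z_def by (simp add: mult.assoc)
  qed
  have z1: "10 * C * \<epsilon>\<^sup>2 * integral S (\<lambda>t. \<bar>t\<bar> * (b' t)\<^sup>2) \<le> 10 * Z"
  proof -
    have "10 * C * \<epsilon>\<^sup>2 * integral S (\<lambda>t. \<bar>t\<bar> * (b' t)\<^sup>2) \<le> 10 * C * \<epsilon>\<^sup>2 * (C * \<beta>\<^sup>2)"
      using I C by (intro mult_left_mono) auto
    also have "\<dots> = 10 * (C\<^sup>2 * \<epsilon> * \<beta>\<^sup>2 * \<epsilon>)" by (simp add: power2_eq_square)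
    also have "\<dots> \<le> 10 * Z" using Zb[of "C\<^sup>2" "\<beta>\<^sup>2" \<epsilon>] pw m \<epsilon> by simp
    finally show ?thesis .
  qed
  have z2: "12 * C * \<epsilon>\<^sup>2 * (m + \<epsilon>) * integral S (\<lambda>t. (b' t)\<^sup>2) \<le> 12 * Z"
  proof -
    have "12 * C * \<epsilon>\<^sup>2 * (m + \<epsilon>) * integral S (\<lambda>t. (b' t)\<^sup>2) \<le> 12 * C * \<epsilon>\<^sup>2 * (m + \<epsilon>) * (C * \<beta> ^ 3 / \<epsilon>)"
      using I C m \<epsilon> by (intro mult_left_mono) auto
    also have "\<dots> = 12 * Z" using \<epsilon> unfolding Z_def by (simp add: power2_eq_square)
    finally show ?thesis .
  qed
  have z3: "34 * C * \<epsilon>\<^sup>2 / m * integral S (\<lambda>t. (v' t - b' t)\<^sup>2) \<le> 34 * Z"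
  proof -
    have "34 * C * \<epsilon>\<^sup>2 / m * integral S (\<lambda>t. (v' t - b' t)\<^sup>2) \<le> 34 * C * \<epsilon>\<^sup>2 / m * (C * m\<^sup>2 / \<epsilon>)"
      using I C m \<epsilon> by (intro mult_left_mono) auto
    also have "\<dots> = 34 * (C\<^sup>2 * \<epsilon> * 1 * m)" using \<epsilon> m by (simp add: power2_eq_square)
    also have "\<dots> \<le> 34 * Z" using Zb[of "C\<^sup>2" 1 m] pw m \<epsilon> by simp
    finally show ?thesis .
  qed
  have z4: "4 * C * \<beta>\<^sup>2 * integral S (\<lambda>t. \<bar>t\<bar> * (b t)\<^sup>2) \<le> 4 * Z"
  proof -
    have "4 * C * \<beta>\<^sup>2 * integral S (\<lambda>t. \<bar>t\<bar> * (b t)\<^sup>2) \<le> 4 * C * \<beta>\<^sup>2 * (C * \<epsilon>\<^sup>2)"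
      using I C by (intro mult_left_mono) auto
    also have "\<dots> = 4 * (C\<^sup>2 * \<epsilon> * \<beta>\<^sup>2 * \<epsilon>)" by (simp add: power2_eq_square)
    also have "\<dots> \<le> 4 * Z" using Zb[of "C\<^sup>2" "\<beta>\<^sup>2" \<epsilon>] pw m \<epsilon> by simp
    finally show ?thesis .
  qed
  have z5: "C * \<beta>\<^sup>2 * m * integral S (\<lambda>t. (b t)\<^sup>2) \<le> Z"
  proof -
    have "C * \<beta>\<^sup>2 * m * integral S (\<lambda>t. (b t)\<^sup>2) \<le> C * \<beta>\<^sup>2 * m * (C * \<epsilon> * \<beta>)"
      using I C m by (intro mult_left_mono) auto
    also have "\<dots> = C\<^sup>2 * \<epsilon> * \<beta> ^ 3 * m" by (simp add: power2_eq_square power3_eq_cube)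
    also have "\<dots> \<le> Z" using Zb[of "C\<^sup>2" "\<beta> ^ 3" m] \<beta> m \<epsilon> by simp
    finally show ?thesis .
  qed
  have z6: "12 * C * \<beta>\<^sup>2 / m * integral S (\<lambda>t. (v t - b t)\<^sup>2) \<le> 12 * Z"
  proof -
    have "12 * C * \<beta>\<^sup>2 / m * integral S (\<lambda>t. (v t - b t)\<^sup>2) \<le> 12 * C * \<beta>\<^sup>2 / m * (C * m\<^sup>2 * \<epsilon>)"
      using I C m by (intro mult_left_mono) auto
    also have "\<dots> = 12 * (C\<^sup>2 * \<epsilon> * \<beta>\<^sup>2 * m)" using m by (simp add: power2_eq_square)
    also have "\<dots> \<le> 12 * Z" using Zb[of "C\<^sup>2" "\<beta>\<^sup>2" m] pw m \<epsilon> by simp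
    finally show ?thesis .
  qed
  have z7: "2 * \<epsilon> * integral S (\<lambda>t. (q t)\<^sup>2) \<le> 2 * Z"
  proof -
    have "2 * \<epsilon> * integral S (\<lambda>t. (q t)\<^sup>2) \<le> 2 * \<epsilon> * (C * \<epsilon> * \<beta>)"
      using I \<epsilon> by (intro mult_left_mono) auto
    also have "\<dots> = 2 * (C * \<epsilon> * \<beta> * \<epsilon>)" by simp
    also have "\<dots> \<le> 2 * Z" using Zb[of C \<beta> \<epsilon>] pw m \<epsilon> C CC \<beta> by simp
    finally show ?thesis .
  qed
  have z8: "4 * C * \<epsilon> * integral S (\<lambda>t. (p t)\<^sup>2) \<le> 4 * Z"
  proof -
    have "4 * C * \<epsilon> * integral S (\<lambda>t. (p t)\<^sup>2) \<le> 4 * C * \<epsilon> * (C * \<epsilon> * \<beta>)"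
      using I \<epsilon> C by (intro mult_left_mono) auto
    also have "\<dots> = 4 * (C\<^sup>2 * \<epsilon> * \<beta> * \<epsilon>)" by (simp add: power2_eq_square)
    also have "\<dots> \<le> 4 * Z" using Zb[of "C\<^sup>2" \<beta> \<epsilon>] pw m \<epsilon> \<beta> by simp
    finally show ?thesis .
  qed
  have z9: "4 * integral S (\<lambda>t. \<bar>t\<bar> * b t ^ 4) \<le> 4 * Z"
  proof -
    have "4 * integral S (\<lambda>t. \<bar>t\<bar> * b t ^ 4) \<le> 4 * (C * \<epsilon> * \<beta>\<^sup>2 * \<epsilon>)"
      using I(5) by (simp add: power2_eq_square mult_ac)
    then show ?thesis using Zb[of C "\<beta>\<^sup>2" \<epsilon>] pw m \<epsilon> C CC by simp
  qed
  \<comment> \<open>83 = 10 + 12 + 34 + 4 + 1 + 12 + 2 + 4 + 4, the coefficients of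
    \<open>z1\<close> to \<open>z9\<close>.\<close>
  have "?A \<le> 83 * Z" using z1 z2 z3 z4 z5 z6 z7 z8 z9 by linarith
  then show ?thesis using le unfolding Z_def B1_def B0_def by (simp add: mult.assoc)
qed

section \<open>Decay of the soliton\<close>

definition soliton :: "real \<Rightarrow> real" where "soliton s = sqrt 2 / cosh s"
definition soliton' :: "real \<Rightarrow> real" where "soliton' s = - sqrt 2 * sinh s / (cosh s)\<^sup>2"

lemma DERIV_soliton: "(soliton has_real_derivative soliton' s) (at s)"
  unfolding soliton_def soliton'_def
  by (auto intro!: derivative_eq_intros simp: power2_eq_square)

lemma DERIV_soliton': "(soliton' has_real_derivative soliton s - soliton s ^ 3) (at s)"
proof -
  have s2: "sqrt 2 ^ 3 = 2 * sqrt (2::real)" by (simp add: power3_eq_cube)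
  have sh: "sinh s * sinh s = cosh s * cosh s - 1"
    using cosh_square_eq[of s] by (simp add: power2_eq_square)
  have c: "cosh s \<noteq> 0" by simp
  have "(soliton' has_real_derivative
     ((- sqrt 2 * cosh s) * (cosh s)\<^sup>2 - (- sqrt 2 * sinh s) * (2 * cosh s * sinh s)) / ((cosh s)\<^sup>2 * (cosh s)\<^sup>2)) (at s)"
    unfolding soliton'_def by (rule derivative_eq_intros refl | simp)+
  moreover have "((- sqrt 2 * cosh s) * (cosh s)\<^sup>2 - (- sqrt 2 * sinh s) * (2 * cosh s * sinh s)) / ((cosh s)\<^sup>2 * (cosh s)\<^sup>2)
     = soliton s - soliton s ^ 3"
  proof -
    have "(- sqrt 2 * cosh s) * (cosh s)\<^sup>2 - (- sqrt 2 * sinh s) * (2 * cosh s * sinh s)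
      = sqrt 2 * cosh s * (2 * (sinh s * sinh s) - cosh s * cosh s)" by (simp add: algebra_simps power2_eq_square)
    also have "\<dots> = sqrt 2 * cosh s * (cosh s * cosh s - 2)" unfolding sh by simp
    finally have e: "(- sqrt 2 * cosh s) * (cosh s)\<^sup>2 - (- sqrt 2 * sinh s) * (2 * cosh s * sinh s)
      = sqrt 2 * cosh s * (cosh s * cosh s - 2)" .
    show ?thesis unfolding e soliton_def power_divide s2 using c
      by (simp add: field_simps power2_eq_square power3_eq_cube)
  qed
  ultimately show ?thesis by simp
qed

lemma sqrt2_le: "sqrt 2 \<le> (2::real)" by (rule real_le_lsqrt) auto

lemma soliton_bounds:
  shows "\<bar>soliton s\<bar> \<le> 2 / cosh s" "\<bar>soliton' s\<bar> \<le> 2 / cosh s"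
    and "\<bar>soliton s - soliton s ^ 3\<bar> \<le> 2 / cosh s"
    and "\<bar>soliton' s - 3 * (soliton s)\<^sup>2 * soliton' s\<bar> \<le> 10 / cosh s"
    and "(soliton s)\<^sup>2 \<le> 2"
proof -
  have c1: "1 \<le> cosh s" by (rule cosh_real_ge_1)
  have sq: "(soliton s)\<^sup>2 = 2 / (cosh s)\<^sup>2" unfolding soliton_def by (simp add: power_divide)
  have "1 \<le> (cosh s)\<^sup>2" using c1 by (simp add: one_le_power)
  then show s2: "(soliton s)\<^sup>2 \<le> 2" unfolding sq by (simp add: field_simps)
  have s0: "0 \<le> (soliton s)\<^sup>2" by simp
  show a: "\<bar>soliton s\<bar> \<le> 2 / cosh s"
    unfolding soliton_def using c1 sqrt2_le by (simp add: divide_right_mono)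
  have "\<bar>sinh s\<bar> \<le> cosh s"
  proof -
    have "(sinh s)\<^sup>2 \<le> (cosh s)\<^sup>2" by (simp add: cosh_square_eq)
    then show ?thesis using c1 by (simp add: abs_le_square_iff[symmetric])
  qed
  then have "sqrt 2 * \<bar>sinh s\<bar> \<le> 2 * cosh s" using sqrt2_le by (intro mult_mono) auto
  then have "sqrt 2 * \<bar>sinh s\<bar> / (cosh s)\<^sup>2 \<le> 2 * cosh s / (cosh s)\<^sup>2" by (rule divide_right_mono) simp
  also have "2 * cosh s / (cosh s)\<^sup>2 = 2 / cosh s" by (simp add: power2_eq_square)
  finally show b: "\<bar>soliton' s\<bar> \<le> 2 / cosh s" unfolding soliton'_def
    by (simp add: abs_mult)
  have u: "\<bar>1 - (soliton s)\<^sup>2\<bar> \<le> 1" "\<bar>1 - 3 * (soliton s)\<^sup>2\<bar> \<le> 5" using s2 s0 by linarith+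
  have "\<bar>soliton s - soliton s ^ 3\<bar> = \<bar>soliton s\<bar> * \<bar>1 - (soliton s)\<^sup>2\<bar>"
    unfolding abs_mult[symmetric] by (simp add: algebra_simps power2_eq_square power3_eq_cube)
  also have "\<dots> \<le> 2 / cosh s * 1" using a u by (intro mult_mono) auto
  finally show "\<bar>soliton s - soliton s ^ 3\<bar> \<le> 2 / cosh s" by simp
  have "\<bar>soliton' s - 3 * (soliton s)\<^sup>2 * soliton' s\<bar> = \<bar>soliton' s\<bar> * \<bar>1 - 3 * (soliton s)\<^sup>2\<bar>"
    unfolding abs_mult[symmetric] by (simp add: algebra_simps)
  also have "\<dots> \<le> 2 / cosh s * 5" using b u by (intro mult_mono) auto
  finally show "\<bar>soliton' s - 3 * (soliton s)\<^sup>2 * soliton' s\<bar> \<le> 10 / cosh s" by simp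
qed

text \<open>The exponential decay is traded for a Lorentz profile, whose integrals are elementary,
  after absorbing the cubic factor produced by the derivatives of the ansatz. 720 = 120 * 3 * 2: the
  fifth Taylor term of the exponential, e \<le> 3, and exp |s| \<le> 2 cosh s.\<close>

lemma cosh_decay: "(1 + \<bar>s\<bar>) ^ 3 / cosh s \<le> 720 / (1 + s\<^sup>2)" for s :: real
proof -
  have "(1 + \<bar>s\<bar>) ^ 5 / fact 5 \<le> exp (1 + \<bar>s\<bar>)"
  proof -
    have "(\<lambda>n. (1 + \<bar>s\<bar>) ^ n / fact n) sums exp (1 + \<bar>s\<bar>)"
      using exp_converges[of "1 + \<bar>s\<bar>"] by (simp add: scaleR_conv_of_real divide_inverse mult.commute)
    note e = sums_summable[OF this] sums_unique[OF this]
    have "(\<Sum>n\<in>{5}. (1 + \<bar>s\<bar>) ^ n / fact n) \<le> exp (1 + \<bar>s\<bar>)"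
      unfolding e(2) by (rule sum_le_suminf[OF e(1)]) simp_all
    then show ?thesis by simp
  qed
  moreover have "exp (1 + \<bar>s\<bar>) \<le> 3 * (2 * cosh s)"
  proof -
    have "exp \<bar>s\<bar> \<le> 2 * cosh s" unfolding cosh_def by (cases "s \<ge> 0") auto
    moreover have "exp 1 \<le> (3::real)" using exp_le by simp
    ultimately show ?thesis unfolding exp_add by (intro mult_mono) auto
  qed
  ultimately have A: "(1 + \<bar>s\<bar>) ^ 5 \<le> 720 * cosh s" by (simp add: fact_numeral)
  have "1 + s\<^sup>2 \<le> (1 + \<bar>s\<bar>)\<^sup>2" by (simp add: power2_sum)
  then have "(1 + \<bar>s\<bar>) ^ 3 * (1 + s\<^sup>2) \<le> (1 + \<bar>s\<bar>) ^ 3 * (1 + \<bar>s\<bar>)\<^sup>2" by (rule mult_left_mono) simp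
  also have "\<dots> = (1 + \<bar>s\<bar>) ^ 5" by (simp add: power_add[symmetric])
  finally have "(1 + \<bar>s\<bar>) ^ 3 * (1 + s\<^sup>2) \<le> 720 * cosh s" using A by simp
  moreover have "0 < 1 + s\<^sup>2" by (simp add: add_pos_nonneg)
  ultimately show ?thesis using cosh_real_pos[of s] by (simp add: field_simps)
qed

text \<open>\<open>sol1\<close>, \<open>sol2\<close>, \<open>sol3\<close> are the first three derivatives of \<open>s * soliton s\<close>; they enter because
  \<open>\<beta> * U (\<beta> * r)\<close> is \<open>1 / r\<close> times the value of that function at \<open>\<beta> * r\<close>.\<close>
definition sol1 :: "real \<Rightarrow> real" where "sol1 s = soliton s + s * soliton' s"
definition sol2 :: "real \<Rightarrow> real" where "sol2 s = 2 * soliton' s + s * (soliton s - soliton s ^ 3)"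
definition sol3 :: "real \<Rightarrow> real" where
  "sol3 s = 3 * (soliton s - soliton s ^ 3) + s * (soliton' s - 3 * (soliton s)\<^sup>2 * soliton' s)"

lemma DERIV_sol1: "(sol1 has_real_derivative sol2 s) (at s)"
  unfolding sol1_def sol2_def
  by (auto intro!: derivative_eq_intros DERIV_soliton DERIV_soliton')

lemma DERIV_sol2: "(sol2 has_real_derivative sol3 s) (at s)"
  unfolding sol2_def sol3_def
  by (auto intro!: derivative_eq_intros DERIV_soliton DERIV_soliton' simp: algebra_simps)

text \<open>Each further \<theta>-derivative of the ansatz brings down a factor
  \<open>t / \<epsilon>\<close>, which is \<open>s / \<beta>\<close>. This is why
  \<open>sol2\<close> and \<open>sol3\<close> have to be bounded together with the factors |s| and
  \<open>s\<^sup>2\<close>.\<close>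

lemma sol_decay:
  defines "N \<equiv> (\<lambda>s::real. 720 / (1 + s\<^sup>2))"
  shows "\<bar>soliton s\<bar> \<le> 2 * N s" "\<bar>soliton' s\<bar> \<le> 2 * N s" "\<bar>sol1 s\<bar> \<le> 2 * N s"
    "\<bar>sol2 s\<bar> \<le> 4 * N s" "\<bar>s\<bar> * \<bar>sol2 s\<bar> \<le> 4 * N s" "s\<^sup>2 * \<bar>sol3 s\<bar> \<le> 10 * N s"
proof -
  note b = soliton_bounds[of s]
  define c where "c = cosh s"
  define x where "x = \<bar>s\<bar>"
  have c0: "0 < c" unfolding c_def by simp
  have x0: "0 \<le> x" unfolding x_def by simp
  have k: "y \<le> k * N s" if "y \<le> k * p / c" "0 \<le> k" "p \<le> (1 + x) ^ 3" for y k p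
  proof -
    have "k * p / c \<le> k * (1 + x) ^ 3 / c" using that c0 by (intro divide_right_mono mult_left_mono) auto
    also have "\<dots> = k * ((1 + x) ^ 3 / c)" by simp
    also have "\<dots> \<le> k * N s" unfolding N_def c_def x_def using cosh_decay that by (intro mult_left_mono) auto
    finally show ?thesis using that by linarith
  qed
  have p: "1 \<le> (1 + x) ^ 3" "1 + x \<le> (1 + x) ^ 3" "x * (1 + x) \<le> (1 + x) ^ 3" "x\<^sup>2 * (1 + x) \<le> (1 + x) ^ 3"
    using x0 by (simp_all add: power2_eq_square power3_eq_cube algebra_simps)
  show "\<bar>soliton s\<bar> \<le> 2 * N s" "\<bar>soliton' s\<bar> \<le> 2 * N s"
    using k[of _ 2 1] b(1,2) p(1) by (simp_all add: c_def)
  have "\<bar>sol1 s\<bar> \<le> \<bar>soliton s\<bar> + x * \<bar>soliton' s\<bar>" unfolding sol1_def x_def abs_mult[symmetric] by (rule abs_triangle_ineq)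
  also have "\<dots> \<le> 2 / c + x * (2 / c)" using b x0 unfolding c_def by (intro add_mono mult_left_mono) auto
  also have "\<dots> = 2 * (1 + x) / c" by (simp add: add_divide_distrib algebra_simps)
  finally show "\<bar>sol1 s\<bar> \<le> 2 * N s" by (rule k) (use p in auto)
  have "\<bar>sol2 s\<bar> \<le> 2 * \<bar>soliton' s\<bar> + x * \<bar>soliton s - soliton s ^ 3\<bar>"
    unfolding sol2_def x_def abs_mult[symmetric] using abs_triangle_ineq[of "2 * soliton' s" "s * (soliton s - soliton s ^ 3)"] by (simp add: abs_mult)
  also have "\<dots> \<le> 2 * (2 / c) + x * (2 / c)" using b x0 unfolding c_def by (intro add_mono mult_left_mono) auto
  also have "\<dots> \<le> 4 * (1 + x) / c" using x0 c0 by (simp add: field_simps)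
  finally have h2: "\<bar>sol2 s\<bar> \<le> 4 * (1 + x) / c" .
  then show "\<bar>sol2 s\<bar> \<le> 4 * N s" by (rule k) (use p in auto)
  have "\<bar>s\<bar> * \<bar>sol2 s\<bar> \<le> x * (4 * (1 + x) / c)" using h2 unfolding x_def by (rule mult_left_mono) simp
  also have "\<dots> = 4 * (x * (1 + x)) / c" by simp
  finally show "\<bar>s\<bar> * \<bar>sol2 s\<bar> \<le> 4 * N s" by (rule k) (use p in auto)
  have "\<bar>sol3 s\<bar> \<le> \<bar>3 * (soliton s - soliton s ^ 3)\<bar> + \<bar>s * (soliton' s - 3 * (soliton s)\<^sup>2 * soliton' s)\<bar>"
    unfolding sol3_def by (rule abs_triangle_ineq)
  also have "\<dots> = 3 * \<bar>soliton s - soliton s ^ 3\<bar> + x * \<bar>soliton' s - 3 * (soliton s)\<^sup>2 * soliton' s\<bar>"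
    unfolding x_def abs_mult[of 3] abs_mult[of s] by simp
  also have "\<dots> \<le> 3 * (2 / c) + x * (10 / c)" using b x0 unfolding c_def by (intro add_mono mult_left_mono) auto
  also have "\<dots> \<le> 10 * (1 + x) / c" using x0 c0 by (simp add: field_simps)
  finally have "\<bar>sol3 s\<bar> \<le> 10 * (1 + x) / c" .
  then have "s\<^sup>2 * \<bar>sol3 s\<bar> \<le> x\<^sup>2 * (10 * (1 + x) / c)" unfolding x_def power2_abs
    by (rule mult_left_mono) simp
  also have "\<dots> = 10 * (x\<^sup>2 * (1 + x)) / c" by simp
  finally show "s\<^sup>2 * \<bar>sol3 s\<bar> \<le> 10 * N s" by (rule k) (use p in auto)
qed

text \<open>The antiderivatives are multiples of tanh and of its cube. As \<open>k * d\<close> grows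
  the integrals approach 4 / k and (4/3) / k; these two constants produce the coefficient 3/2 in the
  balance of potential and curvature.\<close>

lemma integral_soliton:
  assumes k: "k > 0" and d: "d > 0"
  shows "integral {-d..d} (\<lambda>t. (soliton (k * t))\<^sup>2) = 4 * tanh (k * d) / k"
    and "integral {-d..d} (\<lambda>t. (soliton' (k * t))\<^sup>2) = 4 / 3 * tanh (k * d) ^ 3 / k"
proof -
  have D: "((\<lambda>t. tanh (k * t)) has_real_derivative (k * (1 - tanh (k * t) ^ 2))) (at t)" for t
    by (rule derivative_eq_intros refl | simp)+
  have sech: "1 - tanh x ^ 2 = 1 / (cosh x)\<^sup>2" for x :: real
  proof -
    have "(sinh x)\<^sup>2 = (cosh x)\<^sup>2 - 1" using cosh_square_eq[of x] by simp
    then show ?thesis unfolding tanh_def power_divide by (simp add: diff_divide_distrib)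
  qed
  have "((\<lambda>t. (soliton (k * t))\<^sup>2) has_integral (2 / k * tanh (k * d) - 2 / k * tanh (k * (-d)))) {-d..d}"
  proof (rule fundamental_theorem_of_calculus)
    fix t
    have "((\<lambda>t. 2 / k * tanh (k * t)) has_real_derivative 2 / k * (k * (1 - tanh (k * t) ^ 2))) (at t)"
      by (rule DERIV_cmult[OF D])
    moreover have "2 / k * (k * (1 - tanh (k * t) ^ 2)) = (soliton (k * t))\<^sup>2"
      unfolding sech soliton_def using k by (simp add: power_divide)
    ultimately show "((\<lambda>t. 2 / k * tanh (k * t)) has_vector_derivative (soliton (k * t))\<^sup>2) (at t within {-d..d})"
      by (simp add: has_real_derivative_iff_has_vector_derivative[symmetric] has_field_derivative_at_within)
  qed (use d in simp)
  then show "integral {-d..d} (\<lambda>t. (soliton (k * t))\<^sup>2) = 4 * tanh (k * d) / k"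
    by (simp add: integral_unique)
  have "((\<lambda>t. (soliton' (k * t))\<^sup>2) has_integral (2 / 3 / k * tanh (k * d) ^ 3 - 2 / 3 / k * tanh (k * (-d)) ^ 3)) {-d..d}"
  proof (rule fundamental_theorem_of_calculus)
    fix t
    have "((\<lambda>t. 2 / 3 / k * tanh (k * t) ^ 3) has_real_derivative 2 / 3 / k * (3 * (k * (1 - tanh (k * t) ^ 2)) * tanh (k * t) ^ 2)) (at t)"
      by (rule derivative_eq_intros D refl | simp)+
    moreover have "2 / 3 / k * (3 * (k * (1 - tanh (k * t) ^ 2)) * tanh (k * t) ^ 2) = (soliton' (k * t))\<^sup>2"
      unfolding sech unfolding soliton'_def tanh_def power_divide power_mult_distrib using k
      by (simp add: power2_eq_square)
    ultimately show "((\<lambda>t. 2 / 3 / k * tanh (k * t) ^ 3) has_vector_derivative (soliton' (k * t))\<^sup>2) (at t within {-d..d})"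
      by (simp add: has_real_derivative_iff_has_vector_derivative[symmetric] has_field_derivative_at_within)
  qed (use d in simp)
  then show "integral {-d..d} (\<lambda>t. (soliton' (k * t))\<^sup>2) = 4 / 3 * tanh (k * d) ^ 3 / k"
    by (simp add: integral_unique)
qed

lemma one_plus_sq_pos: "0 < 1 + (x::real)\<^sup>2"
  by (simp add: add_pos_nonneg)

text \<open>Both bounds are independent of d. In the second integral this is due to the squared
  denominator: |t| over a single Lorentz factor would grow logarithmically in d.\<close>

lemma integral_lorentz:
  fixes k d :: real
  assumes k: "k > 0" and d: "d > 0"
  shows "integral {-d..d} (\<lambda>t. 1 / (1 + (k * t)\<^sup>2)) \<le> pi / k"
    and "integral {-d..d} (\<lambda>t. \<bar>t\<bar> / (1 + (k * t)\<^sup>2)\<^sup>2) \<le> 1 / k\<^sup>2"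
proof -
  have "((\<lambda>t. 1 / (1 + (k * t)\<^sup>2)) has_integral (arctan (k * d) / k - arctan (k * (-d)) / k)) {-d..d}"
  proof (rule fundamental_theorem_of_calculus)
    fix t
    have "((\<lambda>t. arctan (k * t) / k) has_real_derivative 1 / (1 + (k * t)\<^sup>2)) (at t)"
      using k by (auto intro!: derivative_eq_intros simp: divide_inverse)
    then show "((\<lambda>t. arctan (k * t) / k) has_vector_derivative 1 / (1 + (k * t)\<^sup>2)) (at t within {-d..d})"
      by (simp add: has_real_derivative_iff_has_vector_derivative[symmetric] has_field_derivative_at_within)
  qed (use d in simp)
  then have "integral {-d..d} (\<lambda>t. 1 / (1 + (k * t)\<^sup>2)) = 2 * arctan (k * d) / k"
    by (simp add: integral_unique arctan_minus)
  also have "\<dots> \<le> pi / k" using arctan_ubound[of "k * d"] k by (intro divide_right_mono) linarith+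
  finally show "integral {-d..d} (\<lambda>t. 1 / (1 + (k * t)\<^sup>2)) \<le> pi / k" .
  define G where "G t = - 1 / (2 * k\<^sup>2 * (1 + (k * t)\<^sup>2))" for t
  have G: "(G has_real_derivative t / (1 + (k * t)\<^sup>2)\<^sup>2) (at t)" for t
  proof -
    have G': "G = (\<lambda>t. - (1 / (2 * k\<^sup>2)) * inverse (1 + (k * t)\<^sup>2))" 
      by (rule ext) (simp only: G_def divide_inverse inverse_mult_distrib mult_1_left mult_minus_left mult.assoc)
    have "((\<lambda>t. 1 + (k * t)\<^sup>2) has_real_derivative 2 * k\<^sup>2 * t) (at t)"
      by (auto intro!: derivative_eq_intros simp: power2_eq_square)
    moreover have "1 + (k * t)\<^sup>2 \<noteq> 0" using one_plus_sq_pos[of "k * t"] by simp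
    ultimately have "(G has_real_derivative - (1 / (2 * k\<^sup>2)) * (- (inverse (1 + (k * t)\<^sup>2) * (2 * k\<^sup>2 * t) * inverse (1 + (k * t)\<^sup>2)))) (at t)"
      unfolding G' by (intro DERIV_cmult DERIV_inverse')
    moreover have "- (1 / c) * (- (inverse w * (c * t) * inverse w)) = t / w\<^sup>2" if "c \<noteq> 0" for c w
      using that by (simp add: divide_inverse power2_eq_square)
    moreover have "2 * k\<^sup>2 \<noteq> 0" using k by simp
    ultimately show ?thesis by metis
  qed
  have 1: "((\<lambda>t. \<bar>t\<bar> / (1 + (k * t)\<^sup>2)\<^sup>2) has_integral (G d - G 0)) {0..d}"
  proof (rule has_integral_eq)
    show "((\<lambda>t. t / (1 + (k * t)\<^sup>2)\<^sup>2) has_integral (G d - G 0)) {0..d}"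
      by (rule fundamental_theorem_of_calculus)
        (use d G in \<open>simp_all add: has_real_derivative_iff_has_vector_derivative[symmetric] has_field_derivative_at_within\<close>)
  qed auto
  have 2: "((\<lambda>t. \<bar>t\<bar> / (1 + (k * t)\<^sup>2)\<^sup>2) has_integral (- G 0 - - G (-d))) {-d..0}"
  proof (rule has_integral_eq)
    show "((\<lambda>t. - (t / (1 + (k * t)\<^sup>2)\<^sup>2)) has_integral (- G 0 - - G (-d))) {-d..0}"
      by (rule fundamental_theorem_of_calculus)
        (use d DERIV_minus[OF G] in \<open>simp_all add: has_real_derivative_iff_has_vector_derivative[symmetric] has_field_derivative_at_within\<close>)
  qed auto
  have "integral {-d..d} (\<lambda>t. \<bar>t\<bar> / (1 + (k * t)\<^sup>2)\<^sup>2) = (- G 0 - - G (-d)) + (G d - G 0)"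
    using has_integral_combine[OF _ _ 2 1] d by (simp add: integral_unique)
  also have "\<dots> = 2 * G d + 1 / k\<^sup>2" by (simp add: G_def)
  also have "\<dots> \<le> 1 / k\<^sup>2" using k one_plus_sq_pos[of "k * d"] by (simp add: G_def)
  finally show "integral {-d..d} (\<lambda>t. \<bar>t\<bar> / (1 + (k * t)\<^sup>2)\<^sup>2) \<le> 1 / k\<^sup>2" .
qed

section \<open>The approximate solution\<close>

definition ansatz :: "(real \<Rightarrow> real) \<Rightarrow> (real \<Rightarrow> real) \<Rightarrow> real \<Rightarrow> real \<Rightarrow> real \<Rightarrow> real" where
  "ansatz \<psi> \<beta> \<epsilon> t \<theta> = \<psi> t * \<beta> \<theta> * soliton (\<beta> \<theta> * t / \<epsilon>)"

lemma ansatz_derivs: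
  assumes \<psi>: "\<And>t. (\<psi> has_real_derivative \<psi>1 t) (at t)"
    and \<beta>: "\<And>\<theta>. (\<beta> has_real_derivative \<beta>1 \<theta>) (at \<theta>)" "\<And>\<theta>. (\<beta>1 has_real_derivative \<beta>2 \<theta>) (at \<theta>)"
      "\<And>\<theta>. (\<beta>2 has_real_derivative \<beta>3 \<theta>) (at \<theta>)"
    and \<epsilon>: "\<epsilon> \<noteq> 0"
  shows "pt (ansatz \<psi> \<beta> \<epsilon>) = (\<lambda>t \<theta>. \<psi>1 t * (\<beta> \<theta> * soliton (\<beta> \<theta> * t / \<epsilon>)) + \<psi> t * ((\<beta> \<theta>)\<^sup>2 / \<epsilon> * soliton' (\<beta> \<theta> * t / \<epsilon>)))"
    and "pth (ansatz \<psi> \<beta> \<epsilon>) = (\<lambda>t \<theta>. \<psi> t * (\<beta>1 \<theta> * sol1 (\<beta> \<theta> * t / \<epsilon>)))"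
    and "pth (pth (ansatz \<psi> \<beta> \<epsilon>)) = (\<lambda>t \<theta>. \<psi> t * (\<beta>2 \<theta> * sol1 (\<beta> \<theta> * t / \<epsilon>)
           + (\<beta>1 \<theta>)\<^sup>2 * (t / \<epsilon>) * sol2 (\<beta> \<theta> * t / \<epsilon>)))"
    and "pth (pth (pth (ansatz \<psi> \<beta> \<epsilon>))) = (\<lambda>t \<theta>. \<psi> t * (\<beta>3 \<theta> * sol1 (\<beta> \<theta> * t / \<epsilon>)
           + 3 * \<beta>1 \<theta> * \<beta>2 \<theta> * (t / \<epsilon>) * sol2 (\<beta> \<theta> * t / \<epsilon>)
           + \<beta>1 \<theta> ^ 3 * (t / \<epsilon>)\<^sup>2 * sol3 (\<beta> \<theta> * t / \<epsilon>)))"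
    and "pt (pth (ansatz \<psi> \<beta> \<epsilon>)) = (\<lambda>t \<theta>. \<psi>1 t * (\<beta>1 \<theta> * sol1 (\<beta> \<theta> * t / \<epsilon>))
           + \<psi> t * (\<beta>1 \<theta> * (\<beta> \<theta> / \<epsilon>) * sol2 (\<beta> \<theta> * t / \<epsilon>)))"
proof -
  have S: "((\<lambda>x. h (g x)) has_real_derivative h' (g x) * g') (at x)"
    if "\<And>y. (h has_real_derivative h' y) (at y)" "(g has_real_derivative g') (at x)"
    for h h' g :: "real \<Rightarrow> real" and g' x
    using DERIV_chain2[OF that] .
  have Th: "((\<lambda>\<theta>. \<beta> \<theta> * t / \<epsilon>) has_real_derivative \<beta>1 \<theta> * (t / \<epsilon>)) (at \<theta>)" for t \<theta>
    using DERIV_cmult_right[OF \<beta>(1), of "t / \<epsilon>"] by simp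
  have Tt: "((\<lambda>t. \<beta> \<theta> * t / \<epsilon>) has_real_derivative \<beta> \<theta> / \<epsilon>) (at t)" for t \<theta>
    using DERIV_cmult_right[OF DERIV_cmult[OF DERIV_ident], of "\<beta> \<theta>" "1 / \<epsilon>" t] by simp
  note Sh = S[OF DERIV_soliton Th] S[OF DERIV_sol1 Th] S[OF DERIV_sol2 Th]
  note St = S[OF DERIV_soliton Tt] S[OF DERIV_sol1 Tt]
  show "pt (ansatz \<psi> \<beta> \<epsilon>) = (\<lambda>t \<theta>. \<psi>1 t * (\<beta> \<theta> * soliton (\<beta> \<theta> * t / \<epsilon>)) + \<psi> t * ((\<beta> \<theta>)\<^sup>2 / \<epsilon> * soliton' (\<beta> \<theta> * t / \<epsilon>)))"
    unfolding ansatz_def mult.assoc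
    by (intro pt_eqI, rule DERIV_cong[OF DERIV_mult[OF \<psi> DERIV_cmult[OF St(1)]]])
      (simp add: power2_eq_square algebra_simps)
  show p1: "pth (ansatz \<psi> \<beta> \<epsilon>) = (\<lambda>t \<theta>. \<psi> t * (\<beta>1 \<theta> * sol1 (\<beta> \<theta> * t / \<epsilon>)))"
    unfolding ansatz_def mult.assoc
    by (intro pth_eqI, rule DERIV_cong[OF DERIV_cmult[OF DERIV_mult[OF \<beta>(1) Sh(1)]]])
      (simp add: sol1_def algebra_simps)
  show p2: "pth (pth (ansatz \<psi> \<beta> \<epsilon>)) = (\<lambda>t \<theta>. \<psi> t * (\<beta>2 \<theta> * sol1 (\<beta> \<theta> * t / \<epsilon>)
           + (\<beta>1 \<theta>)\<^sup>2 * (t / \<epsilon>) * sol2 (\<beta> \<theta> * t / \<epsilon>)))"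
    unfolding p1
    by (intro pth_eqI, rule DERIV_cong[OF DERIV_cmult[OF DERIV_mult[OF \<beta>(2) Sh(2)]]])
      (simp add: power2_eq_square algebra_simps)
  show "pth (pth (pth (ansatz \<psi> \<beta> \<epsilon>))) = (\<lambda>t \<theta>. \<psi> t * (\<beta>3 \<theta> * sol1 (\<beta> \<theta> * t / \<epsilon>)
           + 3 * \<beta>1 \<theta> * \<beta>2 \<theta> * (t / \<epsilon>) * sol2 (\<beta> \<theta> * t / \<epsilon>)
           + \<beta>1 \<theta> ^ 3 * (t / \<epsilon>)\<^sup>2 * sol3 (\<beta> \<theta> * t / \<epsilon>)))"
    unfolding p2
    by (intro pth_eqI, rule DERIV_cong[OF DERIV_cmult[OF DERIV_add[OF DERIV_mult[OF \<beta>(3) Sh(2)]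
          DERIV_mult[OF DERIV_cmult_right[OF DERIV_power[OF \<beta>(2)]] Sh(3)]]]])
      (simp add: power2_eq_square power3_eq_cube algebra_simps)
  show "pt (pth (ansatz \<psi> \<beta> \<epsilon>)) = (\<lambda>t \<theta>. \<psi>1 t * (\<beta>1 \<theta> * sol1 (\<beta> \<theta> * t / \<epsilon>))
           + \<psi> t * (\<beta>1 \<theta> * (\<beta> \<theta> / \<epsilon>) * sol2 (\<beta> \<theta> * t / \<epsilon>)))"
    unfolding p1
    by (intro pt_eqI, rule DERIV_cong[OF DERIV_mult[OF \<psi> DERIV_cmult[OF St(2)]]])
      (simp add: algebra_simps)
qed

text \<open>A \<theta>-derivative costs no power of \<epsilon>, because the derivatives of \<beta>
  are bounded by multiples of \<beta>; a t-derivative costs \<open>\<beta> / \<epsilon>\<close>.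
  17280 = 24 * 720, with 720 from the decay estimate and 24 = 2 + 12 + 10 from the three summands of
  the third \<theta>-derivative, the largest case.\<close>

lemma ansatz_pointwise:
  fixes \<epsilon> \<beta> \<beta>1 \<beta>2 \<beta>3 C X x0 x1 t :: real
  defines "s \<equiv> \<beta> * t / \<epsilon>"
  defines "K \<equiv> 17280 * X * C ^ 3 / (1 + s\<^sup>2)"
  assumes \<epsilon>: "0 < \<epsilon>" "\<epsilon> \<le> 1" and \<beta>: "1 \<le> \<beta>" "\<bar>\<beta>1\<bar> \<le> C * \<beta>" "\<bar>\<beta>2\<bar> \<le> C * \<beta>" "\<bar>\<beta>3\<bar> \<le> C * \<beta>"
    and C: "1 \<le> C" and X: "0 \<le> X" "\<bar>x0\<bar> \<le> X" "\<bar>x1\<bar> \<le> X"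
  shows "\<bar>x0 * \<beta> * soliton s\<bar> \<le> K * \<beta>"
    and "\<bar>x0 * (\<beta>1 * sol1 s)\<bar> \<le> K * \<beta>"
    and "\<bar>x0 * (\<beta>2 * sol1 s + \<beta>1\<^sup>2 * (t / \<epsilon>) * sol2 s)\<bar> \<le> K * \<beta>"
    and "\<bar>x0 * (\<beta>3 * sol1 s + 3 * \<beta>1 * \<beta>2 * (t / \<epsilon>) * sol2 s + \<beta>1 ^ 3 * (t / \<epsilon>)\<^sup>2 * sol3 s)\<bar> \<le> K * \<beta>"
    and "\<bar>x1 * (\<beta> * soliton s) + x0 * (\<beta>\<^sup>2 / \<epsilon> * soliton' s)\<bar> \<le> K * (\<beta>\<^sup>2 / \<epsilon>)"
    and "\<bar>x1 * (\<beta>1 * sol1 s) + x0 * (\<beta>1 * (\<beta> / \<epsilon>) * sol2 s)\<bar> \<le> K * (\<beta>\<^sup>2 / \<epsilon>)"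
proof -
  define N where "N = 720 / (1 + s\<^sup>2)"
  note d = sol_decay[of s, folded N_def]
  have N0: "0 \<le> N" unfolding N_def by (simp add: add_nonneg_nonneg)
  have K: "K = 24 * (X * (C ^ 3 * N))" unfolding K_def N_def by simp
  have pC: "1 \<le> C ^ 3" "C \<le> C ^ 3" "C\<^sup>2 \<le> C ^ 3"
    using C power_increasing[of 1 3 C] power_increasing[of 2 3 C] by (simp_all add: one_le_power)
  have te: "\<beta> * (t / \<epsilon>) = s" unfolding s_def by simp
  have \<beta>e: "\<beta> \<le> \<beta>\<^sup>2 / \<epsilon>"
  proof -
    have "\<beta> * \<epsilon> \<le> \<beta> * \<beta>" using \<epsilon> \<beta> by (intro mult_left_mono) auto
    then show ?thesis using \<epsilon> by (simp add: le_divide_eq power2_eq_square)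
  qed
  have b0: "0 \<le> \<beta>" "0 \<le> C * \<beta>" "0 \<le> C" using \<beta> C by simp_all
  have mm: "\<bar>x * y\<bar> \<le> X * (24 * (C ^ 3 * N * w))" if "\<bar>x\<bar> \<le> X" "\<bar>y\<bar> \<le> 24 * (C ^ 3 * N * w)" for x y w
    unfolding abs_mult using that X by (intro mult_mono) auto
  have mm': "\<bar>x * y + x' * y'\<bar> \<le> X * (24 * (C ^ 3 * N * w))"
    if "\<bar>x\<bar> \<le> X" "\<bar>y\<bar> \<le> 8 * (C ^ 3 * N * w)" "\<bar>x'\<bar> \<le> X" "\<bar>y'\<bar> \<le> 8 * (C ^ 3 * N * w)" "0 \<le> w" for x y x' y' w
  proof -
    have "\<bar>x * y\<bar> \<le> X * (8 * (C ^ 3 * N * w))" "\<bar>x' * y'\<bar> \<le> X * (8 * (C ^ 3 * N * w))"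
      unfolding abs_mult using that X by (intro mult_mono; auto)+
    moreover have "0 \<le> X * (C ^ 3 * N * w)" using X N0 b0 that by simp
    ultimately show ?thesis using abs_triangle_ineq[of "x * y" "x' * y'"] by (simp add: algebra_simps)
  qed
  have up: "c * N * w \<le> k * (C ^ 3 * N * w')" if "c \<le> k * C ^ 3" "w \<le> w'" "0 \<le> w" "0 \<le> k" for c w w' k
  proof -
    have "c * N * w \<le> k * C ^ 3 * N * w'" using that N0 C by (intro mult_mono) auto
    then show ?thesis by (simp add: mult.assoc)
  qed
  have a0: "\<bar>\<beta> * soliton s\<bar> \<le> 2 * N * \<beta>"
    unfolding abs_mult using mult_mono[OF order.refl d(1), of "\<beta>"] b0 by (simp add: mult_ac)
  have a1: "\<bar>y * sol1 s\<bar> \<le> 2 * C * N * \<beta>" if "\<bar>y\<bar> \<le> C * \<beta>" for y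
    unfolding abs_mult using mult_mono[OF that d(3)] b0 by (simp add: mult_ac)
  have a2: "\<bar>y * z * (t / \<epsilon>) * sol2 s\<bar> \<le> 4 * C\<^sup>2 * N * \<beta>" if "\<bar>y\<bar> \<le> C * \<beta>" "\<bar>z\<bar> \<le> C * \<beta>" for y z
  proof -
    have "\<bar>y * z * (t / \<epsilon>) * sol2 s\<bar> = \<bar>y\<bar> * (\<bar>z\<bar> * (\<bar>t / \<epsilon>\<bar> * \<bar>sol2 s\<bar>))" by (simp only: abs_mult mult.assoc)
    also have "\<dots> \<le> (C * \<beta>) * ((C * \<beta>) * (\<bar>t / \<epsilon>\<bar> * \<bar>sol2 s\<bar>))"
      using that b0 by (intro mult_mono mult_nonneg_nonneg) auto
    also have "\<dots> = (C * \<beta>) * (C * (\<bar>s\<bar> * \<bar>sol2 s\<bar>))"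
      unfolding te[symmetric] abs_mult using b0 by (simp add: mult_ac)
    also have "\<dots> \<le> (C * \<beta>) * (C * (4 * N))" using d(5) b0 by (intro mult_left_mono) auto
    finally show ?thesis by (simp add: power2_eq_square mult_ac)
  qed
  have a3: "\<bar>\<beta>1 ^ 3 * (t / \<epsilon>)\<^sup>2 * sol3 s\<bar> \<le> 10 * C ^ 3 * N * \<beta>"
  proof -
    have "\<bar>\<beta>1 ^ 3 * (t / \<epsilon>)\<^sup>2 * sol3 s\<bar> = \<bar>\<beta>1\<bar> ^ 3 * ((t / \<epsilon>)\<^sup>2 * \<bar>sol3 s\<bar>)" by (simp only: abs_mult power_abs power2_abs mult.assoc)
    also have "\<dots> \<le> (C * \<beta>) ^ 3 * ((t / \<epsilon>)\<^sup>2 * \<bar>sol3 s\<bar>)"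
      using \<beta>(2) by (intro mult_right_mono power_mono) auto
    also have "\<dots> = (C ^ 3 * \<beta>) * (s\<^sup>2 * \<bar>sol3 s\<bar>)"
      unfolding te[symmetric] power_mult_distrib by (simp add: power2_eq_square power3_eq_cube)
    also have "\<dots> \<le> (C ^ 3 * \<beta>) * (10 * N)" using d(6) b0 by (intro mult_left_mono) auto
    finally show ?thesis by (simp add: mult_ac)
  qed
  have n0: "0 \<le> C ^ 3 * N * \<beta>" using b0 N0 by simp
  have F: "X * (24 * (C ^ 3 * N * w)) = K * w" for w unfolding K by simp
  have u1: "2 * N * \<beta> \<le> 2 * (C ^ 3 * N * \<beta>)" using up[of 2 2 \<beta> \<beta>] pC b0 by simp
  have u2: "2 * C * N * \<beta> \<le> 2 * (C ^ 3 * N * \<beta>)" using up[of "2 * C" 2 \<beta> \<beta>] pC b0 by simp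
  have u3: "4 * C\<^sup>2 * N * \<beta> \<le> 4 * (C ^ 3 * N * \<beta>)" using up[of "4 * C\<^sup>2" 4 \<beta> \<beta>] pC b0 by simp
  show "\<bar>x0 * \<beta> * soliton s\<bar> \<le> K * \<beta>"
    unfolding mult.assoc[of x0] F[symmetric] by (rule mm[OF X(2)]) (use a0 u1 n0 in linarith)
  show "\<bar>x0 * (\<beta>1 * sol1 s)\<bar> \<le> K * \<beta>"
    unfolding F[symmetric] by (rule mm[OF X(2)]) (use a1[OF \<beta>(2)] u2 n0 in linarith)
  show "\<bar>x0 * (\<beta>2 * sol1 s + \<beta>1\<^sup>2 * (t / \<epsilon>) * sol2 s)\<bar> \<le> K * \<beta>"
    unfolding F[symmetric] power2_eq_square[of \<beta>1]
    by (rule mm[OF X(2)], rule order.trans[OF abs_triangle_ineq])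
      (use a1[OF \<beta>(3)] a2[OF \<beta>(2) \<beta>(2)] u2 u3 n0 in linarith)
  have "\<bar>3 * \<beta>1 * \<beta>2 * (t / \<epsilon>) * sol2 s\<bar> = 3 * \<bar>\<beta>1 * \<beta>2 * (t / \<epsilon>) * sol2 s\<bar>"
    by (simp add: abs_mult)
  then have "\<bar>3 * \<beta>1 * \<beta>2 * (t / \<epsilon>) * sol2 s\<bar> \<le> 12 * (C ^ 3 * N * \<beta>)"
    using order.trans[OF a2[OF \<beta>(2) \<beta>(3)] u3] by argo
  moreover have "\<bar>\<beta>1 ^ 3 * (t / \<epsilon>)\<^sup>2 * sol3 s\<bar> \<le> 10 * (C ^ 3 * N * \<beta>)" using a3 by (simp add: mult.assoc)
  ultimately show "\<bar>x0 * (\<beta>3 * sol1 s + 3 * \<beta>1 * \<beta>2 * (t / \<epsilon>) * sol2 s + \<beta>1 ^ 3 * (t / \<epsilon>)\<^sup>2 * sol3 s)\<bar> \<le> K * \<beta>"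
    unfolding F[symmetric]
    by (intro mm[OF X(2)] order.trans[OF abs_triangle_ineq])
      (use a1[OF \<beta>(4)] u2 n0 abs_triangle_ineq[of "\<beta>3 * sol1 s" "3 * \<beta>1 * \<beta>2 * (t / \<epsilon>) * sol2 s"] in argo)
  have w0: "0 \<le> \<beta>\<^sup>2 / \<epsilon>" using \<epsilon> by simp
  have v0: "\<bar>\<beta> * soliton s\<bar> \<le> 8 * (C ^ 3 * N * (\<beta>\<^sup>2 / \<epsilon>))"
    by (rule order.trans[OF a0], rule up) (use pC b0 \<beta>e in auto)
  have v1: "\<bar>\<beta>1 * sol1 s\<bar> \<le> 8 * (C ^ 3 * N * (\<beta>\<^sup>2 / \<epsilon>))"
    by (rule order.trans[OF a1[OF \<beta>(2)]], rule up) (use pC b0 \<beta>e in auto)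
  have v2: "\<bar>\<beta>\<^sup>2 / \<epsilon> * soliton' s\<bar> \<le> 8 * (C ^ 3 * N * (\<beta>\<^sup>2 / \<epsilon>))"
  proof -
    have "\<bar>\<beta>\<^sup>2 / \<epsilon> * soliton' s\<bar> = \<bar>soliton' s\<bar> * (\<beta>\<^sup>2 / \<epsilon>)" by (simp only: abs_mult abs_of_nonneg[OF w0] mult.commute)
    also have "\<dots> \<le> 2 * N * (\<beta>\<^sup>2 / \<epsilon>)" using d(2) w0 by (rule mult_right_mono)
    also have "\<dots> \<le> 8 * (C ^ 3 * N * (\<beta>\<^sup>2 / \<epsilon>))" by (rule up) (use pC w0 in auto)
    finally show ?thesis .
  qed
  have v3: "\<bar>\<beta>1 * (\<beta> / \<epsilon>) * sol2 s\<bar> \<le> 8 * (C ^ 3 * N * (\<beta>\<^sup>2 / \<epsilon>))"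
  proof -
    have "\<bar>\<beta>1 * (\<beta> / \<epsilon>) * sol2 s\<bar> = \<bar>\<beta>1\<bar> * ((\<beta> / \<epsilon>) * \<bar>sol2 s\<bar>)" 
      using b0 \<epsilon> by (simp add: abs_mult)
    also have "\<dots> \<le> (C * \<beta>) * ((\<beta> / \<epsilon>) * (4 * N))" using \<beta>(2) d(4) b0 \<epsilon> by (intro mult_mono mult_nonneg_nonneg) auto
    also have "\<dots> = 4 * C * N * (\<beta>\<^sup>2 / \<epsilon>)" by (simp add: power2_eq_square mult_ac)
    also have "\<dots> \<le> 8 * (C ^ 3 * N * (\<beta>\<^sup>2 / \<epsilon>))" by (rule up) (use pC w0 in auto)
    finally show ?thesis .
  qed
  show "\<bar>x1 * (\<beta> * soliton s) + x0 * (\<beta>\<^sup>2 / \<epsilon> * soliton' s)\<bar> \<le> K * (\<beta>\<^sup>2 / \<epsilon>)"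
    unfolding F[symmetric] by (rule mm'[OF X(3) v0 X(2) v2 w0])
  show "\<bar>x1 * (\<beta>1 * sol1 s) + x0 * (\<beta>1 * (\<beta> / \<epsilon>) * sol2 s)\<bar> \<le> K * (\<beta>\<^sup>2 / \<epsilon>)"
    unfolding F[symmetric] by (rule mm'[OF X(3) v1 X(2) v3 w0])
qed

section \<open>Estimates in the tube\<close>

text \<open>The half-open tube and the compact box differ by a null set, and on a compact box
  continuity of the integrand already gives integrability and iterated integrals.\<close>

lemma tubeL2_eq_cbox:
  "tubeL2 M l f = sqrt (integral (cbox (-M, 0) (M, l)) (\<lambda>(t, \<theta>). (f t \<theta>)\<^sup>2))"
proof -
  have neg: "negligible (cbox (-M, 0) (M, l) - box (-M, 0) (M, l))" by (rule negligible_frontier_interval)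
  have box: "box (-M, 0) (M, l) = {-M<..<M} \<times> {0<..<l}"
    by (auto simp: box_def Basis_prod_def inner_prod_def)
  have cbox: "cbox (-M, 0) (M, l) = {-M..M} \<times> {0..l}" by (auto simp: cbox_Pair_eq)
  have "integral ({-M<..<M} \<times> {0..l}) (\<lambda>(t, \<theta>). (f t \<theta>)\<^sup>2) = integral (cbox (-M, 0) (M, l)) (\<lambda>(t, \<theta>). (f t \<theta>)\<^sup>2)"
  proof (rule integral_spike_set)
    show "negligible {x \<in> {-M<..<M} \<times> {0..l} - cbox (-M, 0) (M, l). (case x of (t, \<theta>) \<Rightarrow> (f t \<theta>)\<^sup>2) \<noteq> 0}"
      by (rule negligible_subset[OF negligible_empty]) (auto simp: cbox)
    show "negligible {x \<in> cbox (-M, 0) (M, l) - {-M<..<M} \<times> {0..l}. (case x of (t, \<theta>) \<Rightarrow> (f t \<theta>)\<^sup>2) \<noteq> 0}"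
      by (rule negligible_subset[OF neg]) (auto simp: box)
  qed
  then show ?thesis unfolding tubeL2_def by simp
qed

lemma tubeL2_nonneg: "0 \<le> tubeL2 M l f"
  unfolding tubeL2_eq_cbox
  \<comment> \<open>If the square is not integrable, its integral is 0 by convention, so the sign is
    right in that case too.\<close>
  by (cases "(\<lambda>(t, \<theta>). (f t \<theta>)\<^sup>2) integrable_on cbox (-M, 0) (M, l)")
    (auto intro!: Henstock_Kurzweil_Integration.integral_nonneg simp: not_integrable_integral)

lemma tubeL2_square:
  assumes f: "continuous_on UNIV (\<lambda>(t, \<theta>). f t \<theta>)"
  shows "(tubeL2 M l f)\<^sup>2 = integral {-M..M} (\<lambda>t. integral {0..l} (\<lambda>\<theta>. (f t \<theta>)\<^sup>2))"
    and "(tubeL2 M l f)\<^sup>2 = integral {0..l} (\<lambda>\<theta>. integral {-M..M} (\<lambda>t. (f t \<theta>)\<^sup>2))"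
proof -
  have "continuous_on UNIV (\<lambda>p. (f (fst p) (snd p))\<^sup>2)"
    using f unfolding split_def by (rule continuous_on_power)
  then have c: "continuous_on (cbox (-M, 0) (M, l)) (\<lambda>(t, \<theta>). (f t \<theta>)\<^sup>2)"
    unfolding split_def using continuous_on_subset by blast
  have "0 \<le> integral (cbox (-M, 0) (M, l)) (\<lambda>(t, \<theta>). (f t \<theta>)\<^sup>2)"
    by (rule Henstock_Kurzweil_Integration.integral_nonneg[OF integrable_continuous[OF c]]) auto
  then have "(tubeL2 M l f)\<^sup>2 = integral (cbox (-M, 0) (M, l)) (\<lambda>(t, \<theta>). (f t \<theta>)\<^sup>2)"
    unfolding tubeL2_eq_cbox by simp
  then show 1: "(tubeL2 M l f)\<^sup>2 = integral {-M..M} (\<lambda>t. integral {0..l} (\<lambda>\<theta>. (f t \<theta>)\<^sup>2))"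
    using integral_prod_continuous[OF c] by simp
  show "(tubeL2 M l f)\<^sup>2 = integral {0..l} (\<lambda>\<theta>. integral {-M..M} (\<lambda>t. (f t \<theta>)\<^sup>2))"
    unfolding 1 using integral_swap_continuous[OF c] by simp
qed

lemma continuous_slices:
  fixes f :: "real \<Rightarrow> real \<Rightarrow> real"
  assumes "continuous_on UNIV (\<lambda>(t, \<theta>). f t \<theta>)"
  shows "continuous_on S (\<lambda>t. f t \<theta>)" "continuous_on S (f t)"
proof -
  have "ck 0 f" using assms by simp
  then show "continuous_on S (\<lambda>t. f t \<theta>)" "continuous_on S (f t)" by (rule ck_cont_fst, rule ck_cont_snd)
qed

lemma continuous_on_param_integral:
  fixes f :: "real \<Rightarrow> real \<Rightarrow> real"
  assumes f: "continuous_on UNIV (\<lambda>(t, \<theta>). f t \<theta>)"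
  shows "continuous_on S (\<lambda>t. integral {a..b} (\<lambda>\<theta>. (f t \<theta>)\<^sup>2 :: real))"
    and "continuous_on S (\<lambda>\<theta>. integral {a..b} (\<lambda>t. (f t \<theta>)\<^sup>2 :: real))"
proof -
  have c: "continuous_on UNIV (\<lambda>p. (f (fst p) (snd p))\<^sup>2)"
    using f unfolding split_def by (rule continuous_on_power)
  have "continuous_on UNIV (\<lambda>t. integral (cbox a b) (\<lambda>\<theta>. (f t \<theta>)\<^sup>2))"
    by (rule integral_continuous_on_param) (use c in \<open>auto simp: split_def intro: continuous_on_subset\<close>)
  then show "continuous_on S (\<lambda>t. integral {a..b} (\<lambda>\<theta>. (f t \<theta>)\<^sup>2))" using continuous_on_subset[OF _ subset_UNIV] by (simp add: cbox_interval)
  have "continuous_on UNIV (\<lambda>p. (f (snd p) (fst p))\<^sup>2)"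
    by (rule continuous_on_compose2[OF c, of UNIV "\<lambda>p. (snd p, fst p)", simplified]) (intro continuous_intros)
  then have "continuous_on UNIV (\<lambda>\<theta>. integral (cbox a b) (\<lambda>t. (f t \<theta>)\<^sup>2))"
    by (intro integral_continuous_on_param) (auto simp: split_def intro: continuous_on_subset)
  then show "continuous_on S (\<lambda>\<theta>. integral {a..b} (\<lambda>t. (f t \<theta>)\<^sup>2))" using continuous_on_subset[OF _ subset_UNIV] by (simp add: cbox_interval)
qed

text \<open>For each t apply the Sobolev inequality in \<theta> over the whole length, then
  integrate over t. One \<theta>-derivative is the price for passing from the tube to a single
  slice, and the lower bound on the length keeps the constant uniform.\<close>

lemma tube_trace:
  assumes f: "ck (Suc 0) f" and L: "0 < L0" "L0 \<le> L" and \<theta>: "\<theta> \<in> {0..L}" and \<delta>: "\<delta> \<le> M"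
  shows "integral {-\<delta>..\<delta>} (\<lambda>t. (f t \<theta>)\<^sup>2) \<le> (1 / L0 + 1) * (tubeL2 M L f)\<^sup>2 + (tubeL2 M L (pth f))\<^sup>2"
proof -
  have cf: "continuous_on UNIV (\<lambda>(t, \<theta>). f t \<theta>)" by (rule ck_cont[OF f])
  have ch: "continuous_on UNIV (\<lambda>(t, \<theta>). pth f t \<theta>)" by (rule ck_cont[OF ck_pth[OF f]])
  let ?A = "\<lambda>t. integral {0..L} (\<lambda>\<theta>. (f t \<theta>)\<^sup>2)" and ?B = "\<lambda>t. integral {0..L} (\<lambda>\<theta>. (pth f t \<theta>)\<^sup>2)"
  have pw: "(f t \<theta>)\<^sup>2 \<le> (1 / L0 + 1) * ?A t + ?B t" for t
  proof -
    have "(f t \<theta>)\<^sup>2 \<le> (1 / (L - 0) + 1) * ?A t + 1 / 1 * ?B t"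
      by (rule sobolev_interval[OF _ \<theta>])
        (use L ck_pth_deriv[OF f] continuous_slices[OF ch] in \<open>auto intro: has_field_derivative_at_within\<close>)
    also have "\<dots> \<le> (1 / L0 + 1) * ?A t + ?B t"
    proof -
      have "0 \<le> ?A t"
        by (intro Henstock_Kurzweil_Integration.integral_nonneg integrable_continuous_real continuous_intros continuous_slices[OF cf]) auto
      moreover have "1 / L \<le> 1 / L0" using L by (intro divide_left_mono) auto
      ultimately show ?thesis by (simp add: mult_right_mono)
    qed
    finally show ?thesis .
  qed
  have "integral {-\<delta>..\<delta>} (\<lambda>t. (f t \<theta>)\<^sup>2) \<le> integral {-M..M} (\<lambda>t. (f t \<theta>)\<^sup>2)"
    by (intro integral_subset_le integrable_continuous_real continuous_intros continuous_slices[OF cf]) (use \<delta> in auto)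
  also have "\<dots> \<le> integral {-M..M} (\<lambda>t. (1 / L0 + 1) * ?A t + ?B t)"
    by (intro integral_le integrable_continuous_real continuous_intros continuous_slices[OF cf]
        continuous_on_param_integral[OF cf] continuous_on_param_integral[OF ch]) (use pw in auto)
  also have "\<dots> = integral {-M..M} (\<lambda>t. (1 / L0 + 1) * ?A t) + integral {-M..M} ?B"
    by (intro Henstock_Kurzweil_Integration.integral_add integrable_continuous_real continuous_intros
        continuous_on_param_integral[OF cf] continuous_on_param_integral[OF ch])
  also have "\<dots> = (1 / L0 + 1) * (tubeL2 M L f)\<^sup>2 + (tubeL2 M L (pth f))\<^sup>2"
    unfolding tubeL2_square(1)[OF cf] tubeL2_square(1)[OF ch] by simp
  finally show ?thesis .
qed

lemma integral_lorentz_majorant: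
  fixes f :: "real \<Rightarrow> real" and d \<beta> \<epsilon> A :: real
  assumes f: "continuous_on {-d..d} f" and d: "0 < d" and \<beta>: "1 \<le> \<beta>" and \<epsilon>: "0 < \<epsilon>"
    and A: "0 \<le> A" and b: "\<And>t. t \<in> {-d..d} \<Longrightarrow> \<bar>f t\<bar> \<le> A / (1 + (\<beta> * t / \<epsilon>)\<^sup>2)"
  shows "integral {-d..d} (\<lambda>t. (f t)\<^sup>2) \<le> A\<^sup>2 * (4 * \<epsilon> / \<beta>)"
    and "integral {-d..d} (\<lambda>t. \<bar>t\<bar> * (f t)\<^sup>2) \<le> A\<^sup>2 * (\<epsilon>\<^sup>2 / \<beta>\<^sup>2)"
proof -
  define k where "k = \<beta> / \<epsilon>"
  have "0 < \<beta>" using \<beta> by simp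
  then have k: "0 < k" using \<epsilon> by (simp add: k_def)
  have kt: "\<beta> * t / \<epsilon> = k * t" for t by (simp add: k_def)
  have sq: "(f t)\<^sup>2 \<le> A\<^sup>2 * (1 / (1 + (k * t)\<^sup>2)\<^sup>2)" if "t \<in> {-d..d}" for t
  proof -
    have "(f t)\<^sup>2 = \<bar>f t\<bar>\<^sup>2" by simp
    also have "\<dots> \<le> (A / (1 + (k * t)\<^sup>2))\<^sup>2" using b[OF that] unfolding kt by (rule power_mono) simp
    finally show ?thesis by (simp add: power_divide)
  qed
  have w: "1 / (1 + (k * t)\<^sup>2)\<^sup>2 \<le> 1 / (1 + (k * t)\<^sup>2)" for t
  proof -
    have "1 + (k * t)\<^sup>2 \<le> (1 + (k * t)\<^sup>2)\<^sup>2" by (rule self_le_power) auto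
    then show ?thesis using one_plus_sq_pos[of "k * t"] by (intro divide_left_mono) auto
  qed
  have ne: "1 + (k * t)\<^sup>2 \<noteq> 0" for t using one_plus_sq_pos[of "k * t"] by simp
  have "integral {-d..d} (\<lambda>t. (f t)\<^sup>2) \<le> integral {-d..d} (\<lambda>t. A\<^sup>2 * (1 / (1 + (k * t)\<^sup>2)))"
  proof (rule integral_le)
    show "(f t)\<^sup>2 \<le> A\<^sup>2 * (1 / (1 + (k * t)\<^sup>2))" if "t \<in> {-d..d}" for t
      by (rule order.trans[OF sq[OF that] mult_left_mono[OF w zero_le_power2]])
  qed (intro integrable_continuous_real continuous_intros f; use ne in auto)+
  also have "\<dots> = A\<^sup>2 * integral {-d..d} (\<lambda>t. 1 / (1 + (k * t)\<^sup>2))"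
    by (rule Henstock_Kurzweil_Integration.integral_mult_right)
  also have "\<dots> \<le> A\<^sup>2 * (4 / k)"
  proof (rule mult_left_mono)
    have "pi / k \<le> 4 / k" using k pi_less_4 by (intro divide_right_mono) auto
    then show "integral {-d..d} (\<lambda>t. 1 / (1 + (k * t)\<^sup>2)) \<le> 4 / k" using integral_lorentz(1)[OF k d] by linarith
  qed simp
  finally show "integral {-d..d} (\<lambda>t. (f t)\<^sup>2) \<le> A\<^sup>2 * (4 * \<epsilon> / \<beta>)" by (simp add: k_def)
  have "integral {-d..d} (\<lambda>t. \<bar>t\<bar> * (f t)\<^sup>2) \<le> integral {-d..d} (\<lambda>t. A\<^sup>2 * (\<bar>t\<bar> / (1 + (k * t)\<^sup>2)\<^sup>2))"
  proof (rule integral_le)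
    show "\<bar>t\<bar> * (f t)\<^sup>2 \<le> A\<^sup>2 * (\<bar>t\<bar> / (1 + (k * t)\<^sup>2)\<^sup>2)" if "t \<in> {-d..d}" for t
      using mult_left_mono[OF sq[OF that], of "\<bar>t\<bar>"] by (simp add: mult_ac)
  qed (intro integrable_continuous_real continuous_intros f; use ne in auto)+
  also have "\<dots> = A\<^sup>2 * integral {-d..d} (\<lambda>t. \<bar>t\<bar> / (1 + (k * t)\<^sup>2)\<^sup>2)"
    by (rule Henstock_Kurzweil_Integration.integral_mult_right)
  also have "\<dots> \<le> A\<^sup>2 * (1 / k\<^sup>2)" using integral_lorentz(2)[OF k d] by (rule mult_left_mono) simp
  finally show "integral {-d..d} (\<lambda>t. \<bar>t\<bar> * (f t)\<^sup>2) \<le> A\<^sup>2 * (\<epsilon>\<^sup>2 / \<beta>\<^sup>2)" by (simp add: k_def power_divide)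
qed

text \<open>Height \<open>\<beta> ^ i\<close> and width \<open>\<epsilon> / \<beta>\<close> give
  \<epsilon> times the power 2 i - 1 of \<beta> on a slice. For i \<le> 3 this is at most the fifth
  power, the one in the normalizing integral of the concentration hypothesis.\<close>

lemma tubeL2_lorentz_majorant:
  fixes f :: "real \<Rightarrow> real \<Rightarrow> real" and \<beta> :: "real \<Rightarrow> real" and \<epsilon> M L K :: real
  assumes f: "continuous_on UNIV (\<lambda>(t, \<theta>). f t \<theta>)" and \<beta>c: "continuous_on {0..L} \<beta>"
    and \<beta>: "\<And>\<theta>. 1 \<le> \<beta> \<theta>" and \<epsilon>: "0 < \<epsilon>" and M: "0 < M" and K: "0 \<le> K" and i: "1 \<le> i" "i \<le> 3"
    and b: "\<And>t \<theta>. t \<in> {-M..M} \<Longrightarrow> \<bar>f t \<theta>\<bar> \<le> K * \<beta> \<theta> ^ i / (1 + (\<beta> \<theta> * t / \<epsilon>)\<^sup>2)"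
  shows "(tubeL2 M L f)\<^sup>2 \<le> K\<^sup>2 * 4 * \<epsilon> * integral {0..L} (\<lambda>\<theta>. \<beta> \<theta> ^ 5)"
proof -
  have "integral {-M..M} (\<lambda>t. (f t \<theta>)\<^sup>2) \<le> K\<^sup>2 * 4 * \<epsilon> * \<beta> \<theta> ^ 5" for \<theta>
  proof -
    have b1: "1 \<le> \<beta> \<theta>" by (rule \<beta>)
    have "integral {-M..M} (\<lambda>t. (f t \<theta>)\<^sup>2) \<le> (K * \<beta> \<theta> ^ i)\<^sup>2 * (4 * \<epsilon> / \<beta> \<theta>)"
      by (rule integral_lorentz_majorant(1)[OF continuous_slices(1)[OF f] M b1 \<epsilon>])
        (use K b1 b in auto)
    also have "\<dots> = K\<^sup>2 * 4 * \<epsilon> * (\<beta> \<theta> ^ (2 * i) / \<beta> \<theta>)"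
      by (simp add: power_mult_distrib power_mult[symmetric] mult.commute)
    also have "\<beta> \<theta> ^ (2 * i) / \<beta> \<theta> = \<beta> \<theta> ^ (2 * i - 1)"
      using b1 i by (subst power_diff) auto
    also have "K\<^sup>2 * 4 * \<epsilon> * \<beta> \<theta> ^ (2 * i - 1) \<le> K\<^sup>2 * 4 * \<epsilon> * \<beta> \<theta> ^ 5"
      using b1 i \<epsilon> by (intro mult_left_mono power_increasing) auto
    finally show ?thesis .
  qed
  then have "integral {0..L} (\<lambda>\<theta>. integral {-M..M} (\<lambda>t. (f t \<theta>)\<^sup>2)) \<le> integral {0..L} (\<lambda>\<theta>. K\<^sup>2 * 4 * \<epsilon> * \<beta> \<theta> ^ 5)"
    by (intro integral_le integrable_continuous_real continuous_intros continuous_on_param_integral[OF f] \<beta>c) auto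
  then show ?thesis unfolding tubeL2_square(2)[OF f] by simp
qed

section \<open>Fermi coordinates\<close>

lemma smooth_curve_deriv:
  assumes "smooth_curve g"
  shows "((vd ^^ k) g has_vector_derivative (vd ^^ Suc k) g t) (at t)"
  using assms unfolding smooth_curve_def by (simp add: vd_def vector_derivative_works[symmetric])

text \<open>The pointwise computation behind the Laplacian in Fermi coordinates: \<open>(p, q)\<close> is the unit tangent,
  \<open>(a, b)\<close> the gradient, \<open>A, B, C, D\<close> the second derivatives, \<open>k, k'\<close> the curvature and its derivative.\<close>
lemma fermi_algebra:
  fixes A B C D a b p q k k' j t :: real
  assumes pq: "p * p + q * q = 1" and j: "j \<noteq> 0"
  shows "A + B = ((A * q - C * p) * q - (D * q - B * p) * p) + k / j * (a * q - b * p)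
     + ((k' * t) * (a * p + b * q) + (((j * (A * p + C * q)) * p + (- k * q) * a)
      + ((j * (D * p + B * q)) * q + (k * p) * b)) * j) / j\<^sup>2 - t * k' * (j * (a * p + b * q)) / j ^ 3"
proof -
  define Z where "Z = k' * t * (a * p + b * q) / j\<^sup>2"
  define K where "K = k / j"
  have "((k' * t) * (a * p + b * q) + (((j * (A * p + C * q)) * p + (- k * q) * a)
      + ((j * (D * p + B * q)) * q + (k * p) * b)) * j) / j\<^sup>2
      = Z + ((A * p + C * q) * p + (D * p + B * q) * q) + K * (p * b - q * a)"
    unfolding Z_def K_def using j by (simp add: field_simps power2_eq_square)
  moreover have "t * k' * (j * (a * p + b * q)) / j ^ 3 = Z"
    unfolding Z_def using j by (simp add: power2_eq_square power3_eq_cube)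
  moreover have "A + B = A * (p * p + q * q) + B * (p * p + q * q)" unfolding pq by simp
  ultimately show ?thesis unfolding K_def[symmetric] by (simp add: algebra_simps)
qed

locale arclength_curve =
  fixes g :: "real \<Rightarrow> complex"
  assumes smooth: "smooth_curve g" and arclength: "\<And>\<theta>. norm (vd g \<theta>) = 1"
begin

abbreviation tx :: "real \<Rightarrow> real" where "tx \<theta> \<equiv> Re (vd g \<theta>)"
abbreviation ty :: "real \<Rightarrow> real" where "ty \<theta> \<equiv> Im (vd g \<theta>)"
abbreviation \<kappa> :: "real \<Rightarrow> real" where "\<kappa> \<equiv> curv g"

lemma DERIV_Re_Im:
  "((\<lambda>\<theta>. Re ((vd ^^ k) g \<theta>)) has_real_derivative Re ((vd ^^ Suc k) g \<theta>)) (at \<theta>)"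
  "((\<lambda>\<theta>. Im ((vd ^^ k) g \<theta>)) has_real_derivative Im ((vd ^^ Suc k) g \<theta>)) (at \<theta>)"
  using smooth_curve_deriv[OF smooth, of k \<theta>]
  unfolding has_real_derivative_iff_has_vector_derivative
  by (rule bounded_linear.has_vector_derivative[OF bounded_linear_Re],
      rule bounded_linear.has_vector_derivative[OF bounded_linear_Im])

lemma ck_components:
  "ck k (\<lambda>t \<theta>. Re ((vd ^^ j) g \<theta>))" "ck k (\<lambda>t \<theta>. Im ((vd ^^ j) g \<theta>))"
  using ck_compose[where h="\<lambda>j \<theta>. Re ((vd ^^ j) g \<theta>)", OF DERIV_Re_Im(1) ck_th]
    ck_compose[where h="\<lambda>j \<theta>. Im ((vd ^^ j) g \<theta>)", OF DERIV_Re_Im(2) ck_th] by blast+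

lemma tangent_unit: "tx \<theta> * tx \<theta> + ty \<theta> * ty \<theta> = 1"
  using arclength[of \<theta>] by (simp add: norm_complex_def power2_eq_square)

lemma curv_eq: "\<kappa> \<theta> = Im (vd (vd g) \<theta>) * tx \<theta> - Re (vd (vd g) \<theta>) * ty \<theta>"
  by (simp add: curv_def)

text \<open>The Frenet equations: differentiating the unit length of the tangent shows that the
  second derivative is orthogonal to it, hence a multiple of the rotated tangent, and the factor is
  the signed curvature.\<close>

lemma DERIV_tangent:
  "(tx has_real_derivative - \<kappa> \<theta> * ty \<theta>) (at \<theta>)" "(ty has_real_derivative \<kappa> \<theta> * tx \<theta>) (at \<theta>)"
proof -
  let ?p = "Re (vd (vd g) \<theta>)" and ?q = "Im (vd (vd g) \<theta>)"
  have d: "(tx has_real_derivative ?p) (at \<theta>)" "(ty has_real_derivative ?q) (at \<theta>)"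
    using DERIV_Re_Im[of 1 \<theta>] by simp_all
  have "((\<lambda>\<theta>. tx \<theta> * tx \<theta> + ty \<theta> * ty \<theta>) has_real_derivative (?p * tx \<theta> + ?p * tx \<theta>) + (?q * ty \<theta> + ?q * ty \<theta>)) (at \<theta>)"
    by (rule DERIV_cong[OF DERIV_add[OF DERIV_mult[OF d(1) d(1)] DERIV_mult[OF d(2) d(2)]]]) simp
  moreover have "((\<lambda>\<theta>. tx \<theta> * tx \<theta> + ty \<theta> * ty \<theta>) has_real_derivative 0) (at \<theta>)"
    unfolding tangent_unit by simp
  ultimately have "(?p * tx \<theta> + ?p * tx \<theta>) + (?q * ty \<theta> + ?q * ty \<theta>) = 0" by (rule DERIV_unique)
  then have o: "?p * tx \<theta> + ?q * ty \<theta> = 0" by linarith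
  have "?p = - \<kappa> \<theta> * ty \<theta>" "?q = \<kappa> \<theta> * tx \<theta>"
  proof -
    have *: "p = - (q * a - p * b) * b" "q = (q * a - p * b) * a"
      if "p * a + q * b = 0" "a * a + b * b = 1" for a b p q :: real
      using that by algebra+
    show "?p = - \<kappa> \<theta> * ty \<theta>" "?q = \<kappa> \<theta> * tx \<theta>"
      unfolding curv_eq by (rule *[OF o tangent_unit])+
  qed
  then show "(tx has_real_derivative - \<kappa> \<theta> * ty \<theta>) (at \<theta>)" "(ty has_real_derivative \<kappa> \<theta> * tx \<theta>) (at \<theta>)"
    using d by simp_all
qed

lemma DERIV_curv: "(\<kappa> has_real_derivative deriv \<kappa> \<theta>) (at \<theta>)"
proof -
  have "\<exists>d. (\<kappa> has_real_derivative d) (at \<theta>)"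
    using DERIV_diff[OF DERIV_mult[OF DERIV_Re_Im(2)[of 2 \<theta>] DERIV_Re_Im(1)[of 1 \<theta>]]
       DERIV_mult[OF DERIV_Re_Im(1)[of 2 \<theta>] DERIV_Re_Im(2)[of 1 \<theta>]]]
    unfolding curv_eq[abs_def] by (auto simp: numeral_2_eq_2)
  then show ?thesis using DERIV_deriv_iff_real_differentiable real_differentiable_def by blast
qed

lemma fermi_eq: "fermi g t \<theta> = Complex (Re (g \<theta>) + t * ty \<theta>) (Im (g \<theta>) - t * tx \<theta>)"
  by (simp add: fermi_def normal_def complex_eq_iff)

lemma ck_fermi:
  assumes "smooth2 f"
  shows "ck k (\<lambda>t \<theta>. f (fermi g t \<theta>))"
  unfolding fermi_eq
  using ck_components[of k 0] ck_components[of k 1]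
  by (intro ck_smooth2[OF assms] ck_add ck_diff ck_mult ck_t) simp_all

lemma DERIV_fermi_t:
  assumes "smooth2 f"
  shows "((\<lambda>t. f (fermi g t \<theta>)) has_real_derivative
     pdir 1 f (fermi g t \<theta>) * ty \<theta> - pdir \<i> f (fermi g t \<theta>) * tx \<theta>) (at t)"
  unfolding fermi_eq
  by (rule DERIV_cong[OF smooth2_chain[OF assms, of _ "ty \<theta>" _ _ "- tx \<theta>"]])
    (auto intro!: derivative_eq_intros)

text \<open>By the Frenet equations, moving in \<theta> at distance t from the curve follows the
  tangent direction at speed \<open>1 + \<kappa> \<theta> * t\<close>; this is the origin of the
  Jacobian in all later formulas.\<close>

lemma DERIV_fermi_theta:
  assumes "smooth2 f"
  shows "((\<lambda>\<theta>. f (fermi g t \<theta>)) has_real_derivative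
     (1 + \<kappa> \<theta> * t) * (pdir 1 f (fermi g t \<theta>) * tx \<theta> + pdir \<i> f (fermi g t \<theta>) * ty \<theta>)) (at \<theta>)"
proof -
  have "((\<lambda>\<theta>. Re (g \<theta>) + t * ty \<theta>) has_real_derivative tx \<theta> + t * (\<kappa> \<theta> * tx \<theta>)) (at \<theta>)"
    using DERIV_add[OF DERIV_Re_Im(1)[of 0 \<theta>] DERIV_cmult[OF DERIV_tangent(2)]] by simp
  moreover have "((\<lambda>\<theta>. Im (g \<theta>) - t * tx \<theta>) has_real_derivative ty \<theta> - t * (- \<kappa> \<theta> * ty \<theta>)) (at \<theta>)"
    using DERIV_diff[OF DERIV_Re_Im(2)[of 0 \<theta>] DERIV_cmult[OF DERIV_tangent(1)]] by simp
  ultimately show ?thesis unfolding fermi_eq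
    by (rule DERIV_cong[OF smooth2_chain[OF assms]]) (simp add: algebra_simps)
qed

lemma fermi_laplacian:
  assumes f: "smooth2 f" and J: "1 + \<kappa> \<theta> * t \<noteq> 0"
  defines "F \<equiv> (\<lambda>t \<theta>. f (fermi g t \<theta>))"
  shows "laplacian f (fermi g t \<theta>) = pt (pt F) t \<theta> + \<kappa> \<theta> / (1 + \<kappa> \<theta> * t) * pt F t \<theta>
     + pth (pth F) t \<theta> / (1 + \<kappa> \<theta> * t)\<^sup>2 - t * deriv \<kappa> \<theta> * pth F t \<theta> / (1 + \<kappa> \<theta> * t) ^ 3"
proof -
  have f1: "smooth2 (pdir 1 f)" and f2: "smooth2 (pdir \<i> f)" using smooth2_pdir[OF f] by auto
  define z where "z = fermi g t \<theta>"
  have p1: "pt F = (\<lambda>t \<theta>. pdir 1 f (fermi g t \<theta>) * ty \<theta> - pdir \<i> f (fermi g t \<theta>) * tx \<theta>)"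
    unfolding F_def by (intro pt_eqI DERIV_fermi_t f)
  have p2: "pth F = (\<lambda>t \<theta>. (1 + \<kappa> \<theta> * t) * (pdir 1 f (fermi g t \<theta>) * tx \<theta> + pdir \<i> f (fermi g t \<theta>) * ty \<theta>))"
    unfolding F_def by (intro pth_eqI DERIV_fermi_theta f)
  have "pt (pt F) t \<theta> = (pdir 1 (pdir 1 f) z * ty \<theta> - pdir \<i> (pdir 1 f) z * tx \<theta>) * ty \<theta>
     - (pdir 1 (pdir \<i> f) z * ty \<theta> - pdir \<i> (pdir \<i> f) z * tx \<theta>) * tx \<theta>"
    unfolding pt_def[of "pt F"] unfolding p1 z_def
    by (intro DERIV_imp_deriv DERIV_diff DERIV_cmult_right DERIV_fermi_t f1 f2)
  moreover have "pth (pth F) t \<theta> = (deriv \<kappa> \<theta> * t) * (pdir 1 f z * tx \<theta> + pdir \<i> f z * ty \<theta>)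
     + (((1 + \<kappa> \<theta> * t) * (pdir 1 (pdir 1 f) z * tx \<theta> + pdir \<i> (pdir 1 f) z * ty \<theta>)) * tx \<theta> + (- \<kappa> \<theta> * ty \<theta>) * pdir 1 f z
      + (((1 + \<kappa> \<theta> * t) * (pdir 1 (pdir \<i> f) z * tx \<theta> + pdir \<i> (pdir \<i> f) z * ty \<theta>)) * ty \<theta> + (\<kappa> \<theta> * tx \<theta>) * pdir \<i> f z)) * (1 + \<kappa> \<theta> * t)"
  proof -
    have "((\<lambda>\<theta>. 1 + \<kappa> \<theta> * t) has_real_derivative deriv \<kappa> \<theta> * t) (at \<theta>)"
      using DERIV_add[OF DERIV_const DERIV_cmult_right[OF DERIV_curv]] by simp
    then show ?thesis
    unfolding pth_def[of "pth F"] unfolding p2 z_def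
    by (intro DERIV_imp_deriv DERIV_mult DERIV_add DERIV_tangent DERIV_fermi_theta f1 f2)
  qed
  moreover have "laplacian f z = pdir 1 (pdir 1 f) z + pdir \<i> (pdir \<i> f) z"
    by (simp add: laplacian_def)
  \<comment> \<open>The two mixed second derivatives enter as separate unknowns \<open>C\<close> and
    \<open>D\<close>; each cancels between the normal and the tangential part on its own.\<close>
  moreover note fermi_algebra[OF tangent_unit J, where A="pdir 1 (pdir 1 f) z" and B="pdir \<i> (pdir \<i> f) z"
      and C="pdir \<i> (pdir 1 f) z" and D="pdir 1 (pdir \<i> f) z" and a="pdir 1 f z" and b="pdir \<i> f z"
      and k="\<kappa> \<theta>" and k'="deriv \<kappa> \<theta>" and t=t]
  ultimately show ?thesis unfolding p1 p2 z_def[symmetric] by (simp only:)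
qed

text \<open>Project the curve onto its initial tangent direction. The projection returns to its
  starting value, so its slope vanishes somewhere; but the slope starts at 1 and changes at rate at
  most C, which takes a length of at least 1 / C.\<close>

lemma closed_curve_length:
  assumes L: "0 < L" and per: "g L = g 0" and C: "\<And>\<theta>. \<bar>\<kappa> \<theta>\<bar> \<le> C"
  shows "1 \<le> C * L"
proof -
  define h where "h \<theta> = Re (g \<theta>) * tx 0 + Im (g \<theta>) * ty 0" for \<theta>
  define h1 where "h1 \<theta> = tx \<theta> * tx 0 + ty \<theta> * ty 0" for \<theta>
  have d: "(h has_real_derivative h1 \<theta>) (at \<theta>)" for \<theta>
    unfolding h_def h1_def using DERIV_Re_Im[of 0 \<theta>]
    by (intro DERIV_add DERIV_cmult_right) simp_all
  have d1: "(h1 has_real_derivative - \<kappa> \<theta> * ty \<theta> * tx 0 + \<kappa> \<theta> * tx \<theta> * ty 0) (at \<theta>)" for \<theta>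
    unfolding h1_def by (intro DERIV_add DERIV_cmult_right DERIV_tangent)
  have b: "\<bar>- \<kappa> \<theta> * ty \<theta> * tx 0 + \<kappa> \<theta> * tx \<theta> * ty 0\<bar> \<le> C" for \<theta>
  proof -
    \<comment> \<open>Lagrange's identity: for two unit vectors the squares of cross product and
      inner product add up to 1.\<close>
    have "(tx \<theta> * ty 0 - ty \<theta> * tx 0)\<^sup>2 + (tx \<theta> * tx 0 + ty \<theta> * ty 0)\<^sup>2
      = (tx \<theta> * tx \<theta> + ty \<theta> * ty \<theta>) * (tx 0 * tx 0 + ty 0 * ty 0)"
      by (simp add: power2_eq_square algebra_simps)
    then have "(tx \<theta> * ty 0 - ty \<theta> * tx 0)\<^sup>2 \<le> 1\<^sup>2"
      unfolding tangent_unit mult_1 power_one using zero_le_power2[of "tx \<theta> * tx 0 + ty \<theta> * ty 0"] by argo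
    then have "\<bar>tx \<theta> * ty 0 - ty \<theta> * tx 0\<bar> \<le> 1" by (simp only: abs_le_square_iff[symmetric] abs_one)
    then have "\<bar>\<kappa> \<theta>\<bar> * \<bar>tx \<theta> * ty 0 - ty \<theta> * tx 0\<bar> \<le> C * 1" using C by (intro mult_mono) (auto intro: order.trans[OF abs_ge_zero])
    then show ?thesis unfolding abs_mult[symmetric] by (simp add: algebra_simps)
  qed
  obtain \<xi> where \<xi>: "0 < \<xi>" "\<xi> < L" "h L - h 0 = (L - 0) * h1 \<xi>" using MVT2[OF L, of h h1] d by blast
  then have z: "h1 \<xi> = 0" using L per by (simp add: h_def)
  have "h1 0 = 1" unfolding h1_def by (rule tangent_unit)
  moreover obtain \<eta> where "h1 \<xi> - h1 0 = (\<xi> - 0) * (- \<kappa> \<eta> * ty \<eta> * tx 0 + \<kappa> \<eta> * tx \<eta> * ty 0)"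
    using MVT2[OF \<xi>(1), of h1 "\<lambda>\<eta>. - \<kappa> \<eta> * ty \<eta> * tx 0 + \<kappa> \<eta> * tx \<eta> * ty 0"] d1 by blast
  ultimately have "1 = \<bar>\<xi> * (- \<kappa> \<eta> * ty \<eta> * tx 0 + \<kappa> \<eta> * tx \<eta> * ty 0)\<bar>" using z by simp
  also have "\<dots> \<le> \<xi> * C" unfolding abs_mult using \<xi> b by (intro mult_mono) auto
  also have "\<dots> \<le> L * C" using \<xi> order.trans[OF abs_ge_zero C] by (intro mult_right_mono) auto
  finally show ?thesis by (simp add: mult.commute)
qed

end

section \<open>The mass in the tube\<close>

text \<open>The solution lives on the complex plane and the tube on pairs of reals, while the change
  of variables with a determinant is carried out on \<open>real^2\<close>. A linear map that carries
  one standard basis to the other sends boxes to boxes with the same side lengths and so preserves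
  Lebesgue measure.\<close>

lemma lborel_basis_change:
  fixes T :: "'a::euclidean_space \<Rightarrow> 'b::euclidean_space"
  assumes T: "linear T" and bij: "bij_betw T Basis Basis"
  shows "distr lborel borel T = lborel"
proof (rule lborel_eqI[symmetric])
  have Tm[measurable]: "T \<in> borel \<rightarrow>\<^sub>M borel"
    using T by (intro borel_measurable_continuous_onI linear_continuous_on linear_conv_bounded_linear[THEN iffD1])
  have TB: "T b \<in> Basis" if "b \<in> Basis" for b using bij that by (auto simp: bij_betw_def)
  have iso: "T v \<bullet> T a = v \<bullet> a" if a: "a \<in> Basis" for v a
  proof -
    have "T v = T (\<Sum>b\<in>Basis. (v \<bullet> b) *\<^sub>R b)" by (simp add: euclidean_representation)
    also have "\<dots> = (\<Sum>b\<in>Basis. (v \<bullet> b) *\<^sub>R T b)"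
      by (simp add: linear_sum[OF T] linear_scale[OF T])
    finally have "T v \<bullet> T a = (\<Sum>b\<in>Basis. (v \<bullet> b) * (T b \<bullet> T a))" by (simp add: inner_sum_left)
    also have "\<dots> = (\<Sum>b\<in>Basis. if b = a then v \<bullet> b else 0)"
    proof (rule sum.cong[OF refl])
      fix b :: 'a assume b: "b \<in> Basis"
      have "T b = T a \<longleftrightarrow> b = a" using bij a b by (auto simp: bij_betw_def inj_on_def)
      then show "(v \<bullet> b) * (T b \<bullet> T a) = (if b = a then v \<bullet> b else 0)"
        using inner_Basis[OF TB[OF b] TB[OF a]] by simp
    qed
    finally show ?thesis using a by simp
  qed
  fix l u :: 'b assume le: "\<And>b. b \<in> Basis \<Longrightarrow> l \<bullet> b \<le> u \<bullet> b"
  \<comment> \<open>\<open>A\<close> carries the corners of a box back, coordinate by coordinate;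
    the preimage of a box under \<open>T\<close> is then again a box.\<close>
  define A where "A y = (\<Sum>a\<in>Basis. (y \<bullet> T a) *\<^sub>R a)" for y
  have A: "A y \<bullet> a = y \<bullet> T a" if "a \<in> Basis" for y a
    unfolding A_def using that by (simp add: inner_sum_left inner_Basis if_distrib cong: if_cong)
  have all: "(\<forall>b\<in>Basis. P b) \<longleftrightarrow> (\<forall>a\<in>Basis. P (T a))" for P :: "'b \<Rightarrow> bool"
    using bij unfolding bij_betw_def by (metis imageE imageI)
  have "T -` box l u = box (A l) (A u)"
    by (auto simp: box_def all iso A)
  then have "emeasure (distr lborel borel T) (box l u) = emeasure lborel (box (A l) (A u))"
    by (simp add: emeasure_distr)
  also have "\<dots> = (\<Prod>a\<in>Basis. (A u - A l) \<bullet> a)"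
    by (rule emeasure_lborel_box) (simp add: A le TB)
  also have "(\<Prod>a\<in>Basis. (A u - A l) \<bullet> a) = (\<Prod>a\<in>Basis. (u - l) \<bullet> T a)"
    by (rule prod.cong) (auto simp: A inner_diff_left)
  also have "\<dots> = (\<Prod>b\<in>Basis. (u - l) \<bullet> b)" by (rule prod.reindex_bij_betw[OF bij])
  finally show "emeasure (distr lborel borel T) (box l u) = (\<Prod>b\<in>Basis. (u - l) \<bullet> b)" .
qed simp

lemma lborel_basis_change_integral:
  fixes T :: "'a::euclidean_space \<Rightarrow> 'b::euclidean_space" and f :: "'b \<Rightarrow> real"
  assumes T: "linear T" and bij: "bij_betw T Basis Basis" and f: "integrable lborel f"
  shows "integrable lborel (\<lambda>x. f (T x))" "(\<integral>x. f (T x) \<partial>lborel) = (\<integral>y. f y \<partial>lborel)"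
proof -
  have Tm: "T \<in> measurable lborel borel"
    using T by (auto intro!: borel_measurable_continuous_onI linear_continuous_on linear_conv_bounded_linear[THEN iffD1])
  have fm: "f \<in> borel_measurable borel" using f by auto
  note d = lborel_basis_change[OF T bij]
  show "integrable lborel (\<lambda>x. f (T x))" using f integrable_distr_eq[OF Tm fm] unfolding d by simp
  show "(\<integral>x. f (T x) \<partial>lborel) = (\<integral>y. f y \<partial>lborel)" using integral_distr[OF Tm fm] unfolding d by simp
qed

lemma Basis_vec2: "(Basis :: (real^2) set) = {axis 1 1, axis 2 1}"
  unfolding Basis_vec_def by (auto simp: UNIV_2)

abbreviation plane_of_vec :: "real^2 \<Rightarrow> complex" where "plane_of_vec v \<equiv> Complex (v $ 1) (v $ 2)"
abbreviation pair_of_vec :: "real^2 \<Rightarrow> real \<times> real" where "pair_of_vec v \<equiv> (v $ 1, v $ 2)"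

lemma plane_of_vec: "linear plane_of_vec" "bij_betw plane_of_vec Basis Basis"
proof -
  show "linear plane_of_vec" by (rule linearI) (auto simp: complex_eq_iff)
  show "bij_betw plane_of_vec Basis Basis"
    unfolding bij_betw_def inj_on_def Basis_vec2 Basis_complex_def
    by (auto simp: axis_def complex_eq_iff)
qed

lemma pair_of_vec: "linear pair_of_vec" "bij_betw pair_of_vec Basis Basis"
proof -
  show "linear pair_of_vec" by (rule linearI) auto
  show "bij_betw pair_of_vec Basis Basis"
    unfolding bij_betw_def inj_on_def Basis_vec2 Basis_prod_def
    by (auto simp: axis_def)
qed

context arclength_curve
begin

text \<open>The Fermi map moved to \<open>real^2\<close>, with t as first and \<theta> as second
  coordinate. The form as a sum of scaled axis vectors lets the differentiation rules apply to each
  component.\<close>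

definition fermi_vec :: "real^2 \<Rightarrow> real^2" where
  "fermi_vec v = (Re (g (v $ 2)) + v $ 1 * ty (v $ 2)) *\<^sub>R axis 1 1 + (Im (g (v $ 2)) - v $ 1 * tx (v $ 2)) *\<^sub>R axis 2 1"

definition fermi_vec' :: "real^2 \<Rightarrow> real^2 \<Rightarrow> real^2" where
  "fermi_vec' v h = (h $ 2 * tx (v $ 2) + (v $ 1 * (h $ 2 * (\<kappa> (v $ 2) * tx (v $ 2))) + h $ 1 * ty (v $ 2))) *\<^sub>R axis 1 1
     + (h $ 2 * ty (v $ 2) - (v $ 1 * (h $ 2 * (- \<kappa> (v $ 2) * ty (v $ 2))) + h $ 1 * tx (v $ 2))) *\<^sub>R axis 2 1"

lemma plane_of_fermi_vec: "plane_of_vec (fermi_vec v) = fermi g (v $ 1) (v $ 2)"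
  unfolding fermi_vec_def fermi_eq by (simp add: axis_def)

lemma fermi_vec_has_derivative: "(fermi_vec has_derivative fermi_vec' v) (at v within S)"
proof -
  have n: "((\<lambda>v::real^2. v $ i) has_derivative (\<lambda>h. h $ i)) (at v within S)" for i
    by (rule bounded_linear_imp_has_derivative[OF bounded_linear_vec_nth])
  have d: "((\<lambda>v. f (v $ 2)) has_derivative (\<lambda>h. h $ 2 * f')) (at v within S)"
    if "(f has_real_derivative f') (at (v $ 2))" for f and f' :: real
    by (rule DERIV_compose_FDERIV[OF that n])
  have r: "((\<lambda>\<theta>. Re (g \<theta>)) has_real_derivative tx \<theta>) (at \<theta>)" "((\<lambda>\<theta>. Im (g \<theta>)) has_real_derivative ty \<theta>) (at \<theta>)" for \<theta>
    using DERIV_Re_Im[of 0 \<theta>] by simp_all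
  show ?thesis unfolding fermi_vec_def[abs_def] fermi_vec'_def[abs_def]
    by (intro has_derivative_add has_derivative_scaleR_left has_derivative_diff has_derivative_mult n d r DERIV_tangent)
qed

lemma det_fermi_vec': "det (matrix (fermi_vec' v)) = 1 + \<kappa> (v $ 2) * v $ 1"
proof -
  have "det (matrix (fermi_vec' v)) = (1 + \<kappa> (v $ 2) * v $ 1) * (tx (v $ 2) * tx (v $ 2) + ty (v $ 2) * ty (v $ 2))"
    unfolding det_2 matrix_def fermi_vec'_def by (simp add: axis_def algebra_simps)
  then show ?thesis unfolding tangent_unit by simp
qed

text \<open>The Fermi map is injective on the tube, so its image carries at most the total mass, and
  its Jacobian there is at least 1/2, hence the factor 2.\<close>

lemma tube_mass_le:
  assumes f: "continuous_on UNIV f" and int: "integrable lborel (\<lambda>y. (f y)\<^sup>2)"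
    and \<delta>: "\<delta> \<le> 1" and C: "\<And>\<theta>. \<bar>\<kappa> \<theta>\<bar> \<le> C" "C * \<delta> \<le> 1/2"
    and inj: "inj_on (\<lambda>(t, \<theta>). fermi g t \<theta>) ({-\<delta><..<\<delta>} \<times> {0..<L})"
  shows "(tubeL2 \<delta> L (\<lambda>t \<theta>. f (fermi g t \<theta>)))\<^sup>2 \<le> 2 * (\<integral>y. (f y)\<^sup>2 \<partial>lborel)"
proof -
  \<comment> \<open>The open box lies inside the half-open strip on which injectivity is assumed,
    and it misses only a null set of the tube.\<close>
  define S where "S = {v::real^2. pair_of_vec v \<in> box (-\<delta>, 0) (\<delta>, L)}"
  define h where "h v = (f (plane_of_vec v))\<^sup>2" for v
  have box: "box (-\<delta>, 0) (\<delta>, L) = {-\<delta><..<\<delta>} \<times> {0<..<L}"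
    by (auto simp: box_def Basis_prod_def inner_prod_def)
  have S: "open S" unfolding S_def box by (auto intro!: open_Collect_conj open_Collect_less continuous_intros)
  then have Sl: "S \<in> sets lebesgue" and Sb: "S \<in> sets borel" by auto
  have injS: "inj_on fermi_vec S"
  proof (rule inj_onI)
    fix v w assume vw: "v \<in> S" "w \<in> S" "fermi_vec v = fermi_vec w"
    then have "fermi g (v $ 1) (v $ 2) = fermi g (w $ 1) (w $ 2)" unfolding plane_of_fermi_vec[symmetric] by simp
    then have "pair_of_vec v = pair_of_vec w"
      using vw inj_onD[OF inj, of "pair_of_vec v" "pair_of_vec w"] unfolding S_def box by auto
    then show "v = w" by (simp add: vec_eq_iff forall_2)
  qed
  have hL: "integrable lborel h" "(\<integral>v. h v \<partial>lborel) = (\<integral>y. (f y)\<^sup>2 \<partial>lborel)"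
    unfolding h_def using lborel_basis_change_integral[OF plane_of_vec int] by auto
  have hU: "h absolutely_integrable_on UNIV"
    using hL(1) by (simp add: set_integrable_def integrable_completion)
  have diff: "fermi_vec differentiable_on S"
    using fermi_vec_has_derivative by (auto simp: differentiable_on_def differentiable_def)
  have gS: "fermi_vec ` S \<in> sets lebesgue"
    by (rule differentiable_image_in_sets_lebesgue[OF Sl _ diff]) simp
  have hS: "h absolutely_integrable_on (fermi_vec ` S)"
    by (rule set_integrable_subset[OF hU gS]) auto
  let ?J = "\<lambda>v. \<bar>det (matrix (fermi_vec' v))\<bar>"
  have cov: "(\<lambda>v. ?J v * h (fermi_vec v)) absolutely_integrable_on S"
    "integral S (\<lambda>v. ?J v * h (fermi_vec v)) = integral (fermi_vec ` S) h"
  proof -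
    \<comment> \<open>The change of variables is stated for vector-valued integrands, so the real
      integrand is viewed as a vector of length 1.\<close>
    have "(\<lambda>v. ?J v *\<^sub>R (vec (h (fermi_vec v)) :: real^1)) absolutely_integrable_on S \<and>
       integral S (\<lambda>v. ?J v *\<^sub>R (vec (h (fermi_vec v)) :: real^1)) = vec (integral (fermi_vec ` S) h)
      \<longleftrightarrow> (\<lambda>v. vec (h v) :: real^1) absolutely_integrable_on (fermi_vec ` S) \<and>
       integral (fermi_vec ` S) (\<lambda>v. vec (h v) :: real^1) = vec (integral (fermi_vec ` S) h)"
      by (rule has_absolute_integral_change_of_variables[OF Sl fermi_vec_has_derivative injS])
    then show "(\<lambda>v. ?J v * h (fermi_vec v)) absolutely_integrable_on S"
      "integral S (\<lambda>v. ?J v * h (fermi_vec v)) = integral (fermi_vec ` S) h"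
      using hS by (simp_all add: absolutely_integrable_on_1_iff integral_on_1_eq)
  qed
  have up: "integral (fermi_vec ` S) h \<le> (\<integral>y. (f y)\<^sup>2 \<partial>lborel)"
  proof -
    have "integral (fermi_vec ` S) h \<le> integral UNIV h"
      by (rule integral_subset_le) (use hS hU in \<open>auto simp: h_def absolutely_integrable_on_def\<close>)
    also have "\<dots> = (\<integral>y. (f y)\<^sup>2 \<partial>lborel)" unfolding integral_lborel[OF hL(1)] by (rule hL(2))
    finally show ?thesis .
  qed
  define F where "F = (\<lambda>(t, \<theta>). (f (fermi g t \<theta>))\<^sup>2)"
  have Fc: "continuous_on UNIV F"
  proof -
    have "continuous_on UNIV (\<lambda>p. fermi g (fst p) (snd p))" unfolding fermi_eq Complex_eq
      using ck_cont[OF ck_components(1)[of 0 0]] ck_cont[OF ck_components(2)[of 0 0]]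
        ck_cont[OF ck_components(1)[of 0 1]] ck_cont[OF ck_components(2)[of 0 1]]
      by (auto simp: split_def intro!: continuous_intros)
    from continuous_on_compose_UNIV[OF f this] show ?thesis unfolding F_def split_def by (rule continuous_on_power)
  qed
  let ?Q = "box (-\<delta>, 0) (\<delta>, L)"
  have FQ: "set_integrable lborel ?Q F"
  proof (rule set_integrable_subset)
    show "set_integrable lborel (cbox (-\<delta>, 0) (\<delta>, L)) F" unfolding set_integrable_def
      using borel_integrable_compact[OF compact_cbox continuous_on_subset[OF Fc subset_UNIV]]
      by (simp add: indicator_def[abs_def] if_distrib scaleR_conv_of_real cong: if_cong)
  qed (auto simp: box_subset_cbox)
  note FR = lborel_basis_change_integral[OF pair_of_vec FQ[unfolded set_integrable_def]]
  have ind: "indicator ?Q (pair_of_vec v) = (indicator S v :: real)" for v by (simp add: S_def indicator_def)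
  have FS: "set_integrable lborel S (\<lambda>v. F (pair_of_vec v))"
    using FR(1) unfolding set_integrable_def ind .
  have FI: "integral S (\<lambda>v. F (pair_of_vec v)) = integral ?Q F"
    using FR(2) set_borel_integral_eq_integral(2)[OF FS] set_borel_integral_eq_integral(2)[OF FQ]
    unfolding set_lebesgue_integral_def ind by simp
  have "integral S (\<lambda>v. 1 / 2 * F (pair_of_vec v)) \<le> integral S (\<lambda>v. ?J v * h (fermi_vec v))"
  proof (rule integral_le)
    show "(\<lambda>v. 1 / 2 * F (pair_of_vec v)) integrable_on S"
      using set_borel_integral_eq_integral(1)[OF FS] by (rule integrable_on_mult_right)
    show "(\<lambda>v. ?J v * h (fermi_vec v)) integrable_on S" using cov(1) by (simp add: absolutely_integrable_on_def)
    fix v assume "v \<in> S"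
    then have "\<bar>v $ 1\<bar> \<le> \<delta>" unfolding S_def box by auto
    from curvature_weight(1)[OF this \<delta> C(1) C(2), of "v $ 2"]
    have "1 / 2 \<le> ?J v" unfolding det_fermi_vec' by linarith
    then show "1 / 2 * F (pair_of_vec v) \<le> ?J v * h (fermi_vec v)"
      unfolding F_def h_def plane_of_fermi_vec prod.case
      by (rule mult_right_mono) simp
  qed
  then have "1 / 2 * integral ?Q F \<le> (\<integral>y. (f y)\<^sup>2 \<partial>lborel)" using cov(2) up FI by simp
  moreover have "(tubeL2 \<delta> L (\<lambda>t \<theta>. f (fermi g t \<theta>)))\<^sup>2 = integral ?Q F"
  proof -
    have "0 \<le> integral (cbox (-\<delta>, 0) (\<delta>, L)) F"
      by (rule Henstock_Kurzweil_Integration.integral_nonneg[OF integrable_continuous[OF continuous_on_subset[OF Fc subset_UNIV]]])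
        (auto simp: F_def)
    then show ?thesis unfolding tubeL2_eq_cbox F_def[symmetric] integral_open_interval by simp
  qed
  ultimately show ?thesis by simp
qed

end

section \<open>Concentrating solutions\<close>

text \<open>Differentiate the relation \<open>\<beta>\<^sup>2 = B\<close> three times and solve for
  the newest derivative of \<beta> each time. Every solution is a quotient by
  \<open>2 * \<beta>\<close>, which turns bounds relative to \<open>B\<close> into bounds relative
  to its root; the resulting powers C, \<open>C\<^sup>2\<close>, \<open>C ^ 3\<close> are covered by
  \<open>2 * C ^ 3\<close>.\<close>

lemma sqrt_deriv_bounds:
  fixes B B1 B2 B3 :: "real \<Rightarrow> real"
  assumes B: "\<And>x. 1 \<le> B x" and C: "1 \<le> C"
    and d: "\<And>x. (B has_real_derivative B1 x) (at x)" "\<And>x. (B1 has_real_derivative B2 x) (at x)"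
      "\<And>x. (B2 has_real_derivative B3 x) (at x)"
    and b: "\<And>x. \<bar>B1 x\<bar> \<le> C * B x" "\<And>x. \<bar>B2 x\<bar> \<le> C * B x" "\<And>x. \<bar>B3 x\<bar> \<le> C * B x"
  obtains \<beta>1 \<beta>2 \<beta>3 where
    "\<And>x. ((\<lambda>x. sqrt (B x)) has_real_derivative \<beta>1 x) (at x)"
    "\<And>x. (\<beta>1 has_real_derivative \<beta>2 x) (at x)" "\<And>x. (\<beta>2 has_real_derivative \<beta>3 x) (at x)"
    "\<And>x. \<bar>\<beta>1 x\<bar> \<le> 2 * C ^ 3 * sqrt (B x)" "\<And>x. \<bar>\<beta>2 x\<bar> \<le> 2 * C ^ 3 * sqrt (B x)"
    "\<And>x. \<bar>\<beta>3 x\<bar> \<le> 2 * C ^ 3 * sqrt (B x)"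
proof -
  define \<beta> where "\<beta> x = sqrt (B x)" for x
  define \<beta>1 where "\<beta>1 x = B1 x / (2 * \<beta> x)" for x
  define \<beta>2 where "\<beta>2 x = (B2 x - 2 * (\<beta>1 x)\<^sup>2) / (2 * \<beta> x)" for x
  define \<beta>3 where "\<beta>3 x = (B3 x - 6 * (\<beta>1 x * \<beta>2 x)) / (2 * \<beta> x)" for x
  have \<beta>0: "1 \<le> \<beta> x" for x unfolding \<beta>_def using B by simp
  have pos: "0 < \<beta> x" for x using \<beta>0[of x] by linarith
  have ne: "2 * \<beta> x \<noteq> 0" for x using pos[of x] by simp
  have sq: "B x = \<beta> x * \<beta> x" for x unfolding \<beta>_def using B[of x] by simp
  have e1: "B1 x = 2 * \<beta> x * \<beta>1 x" and e2: "B2 x = 2 * (\<beta>1 x)\<^sup>2 + 2 * \<beta> x * \<beta>2 x" for x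
    unfolding \<beta>1_def \<beta>2_def using ne[of x] by simp_all
  have "0 < B x" for x using B[of x] by linarith
  moreover have "inverse s / 2 * b = b / (2 * s)" for s b :: real by (cases "s = 0") (simp_all add: field_simps)
  ultimately have D0: "(\<beta> has_real_derivative \<beta>1 x) (at x)" for x
    unfolding \<beta>_def[abs_def] \<beta>1_def
    using DERIV_cong[OF DERIV_chain2[OF DERIV_real_sqrt d(1)]] by blast
  \<comment> \<open>Here n is the value of the quotient itself; expressing the numerator through it
    cancels one factor \<open>2 * \<beta> x\<close> in the quotient rule.\<close>
  have q: "((\<lambda>x. N x / (2 * \<beta> x)) has_real_derivative (N' - 2 * \<beta>1 x * n) / (2 * \<beta> x)) (at x)"
    if "(N has_real_derivative N') (at x)" "N x = 2 * \<beta> x * n" for N N' n x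
  proof -
    have "((\<lambda>x. N x / (2 * \<beta> x)) has_real_derivative (N' * (2 * \<beta> x) - N x * (2 * \<beta>1 x)) / ((2 * \<beta> x) * (2 * \<beta> x))) (at x)"
      by (rule DERIV_divide[OF that(1) DERIV_cmult[OF D0] ne])
    moreover have "(N' * (2 * \<beta> x) - N x * (2 * \<beta>1 x)) / ((2 * \<beta> x) * (2 * \<beta> x)) = (N' - 2 * \<beta>1 x * n) / (2 * \<beta> x)"
    proof -
      have "N' * (2 * \<beta> x) - N x * (2 * \<beta>1 x) = (N' - 2 * \<beta>1 x * n) * (2 * \<beta> x)"
        unfolding that(2) by (simp add: algebra_simps)
      then show ?thesis by (simp only: nonzero_mult_divide_mult_cancel_right[OF ne])
    qed
    ultimately show ?thesis by simp
  qed
  have f1: "(\<lambda>x. B1 x / (2 * \<beta> x)) = \<beta>1" and f2: "(\<lambda>x. (B2 x - 2 * (\<beta>1 x)\<^sup>2) / (2 * \<beta> x)) = \<beta>2"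
    by (rule ext, rule \<beta>1_def[symmetric], rule ext, rule \<beta>2_def[symmetric])
  have D1: "(\<beta>1 has_real_derivative \<beta>2 x) (at x)" for x
  proof -
    have "(B2 x - 2 * \<beta>1 x * \<beta>1 x) / (2 * \<beta> x) = \<beta>2 x"
      unfolding \<beta>2_def power2_eq_square mult.assoc ..
    then show ?thesis using q[OF d(2) e1, of x] unfolding f1 by (simp only:)
  qed
  have D2: "(\<beta>2 has_real_derivative \<beta>3 x) (at x)" for x
  proof -
    have "((\<lambda>x. B2 x - 2 * (\<beta>1 x)\<^sup>2) has_real_derivative B3 x - 4 * (\<beta>1 x * \<beta>2 x)) (at x)"
      by (rule DERIV_cong[OF DERIV_diff[OF d(3) DERIV_cmult[OF DERIV_power[OF D1]]]]) simp
    moreover have "B2 x - 2 * (\<beta>1 x)\<^sup>2 = 2 * \<beta> x * \<beta>2 x" using e2[of x] by simp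
    ultimately have "(\<beta>2 has_real_derivative (B3 x - 4 * (\<beta>1 x * \<beta>2 x) - 2 * \<beta>1 x * \<beta>2 x) / (2 * \<beta> x)) (at x)"
      unfolding f2[symmetric] by (rule q[unfolded f2])
    then show ?thesis unfolding \<beta>3_def by (rule DERIV_cong) simp
  qed
  have C0: "0 \<le> C" "C \<le> C ^ 3" "C\<^sup>2 \<le> C ^ 3" "0 \<le> C ^ 3" "C \<le> C\<^sup>2"
    using C power_increasing[of 1 3 C] power_increasing[of 2 3 C] power_increasing[of 1 2 C] by simp_all
  have div: "\<bar>y / (2 * \<beta> x)\<bar> \<le> c * \<beta> x" if "\<bar>y\<bar> \<le> 2 * c * B x" for y c x
    using that pos[of x] unfolding sq by (simp add: abs_divide divide_le_eq mult_ac)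
  have b1: "\<bar>\<beta>1 x\<bar> \<le> C / 2 * \<beta> x" for x unfolding \<beta>1_def by (rule div) (use b in simp)
  have b1s: "(\<beta>1 x)\<^sup>2 \<le> C\<^sup>2 / 4 * B x" for x
  proof -
    have "(\<beta>1 x)\<^sup>2 = \<bar>\<beta>1 x\<bar>\<^sup>2" by simp
    also have "\<dots> \<le> (C / 2 * \<beta> x)\<^sup>2" by (rule power_mono[OF b1]) simp
    finally show ?thesis unfolding sq by (simp add: power2_eq_square mult_ac)
  qed
  have b2: "\<bar>\<beta>2 x\<bar> \<le> C\<^sup>2 * \<beta> x" for x unfolding \<beta>2_def
  proof (rule div)
    have "\<bar>B2 x - 2 * (\<beta>1 x)\<^sup>2\<bar> \<le> \<bar>B2 x\<bar> + \<bar>2 * (\<beta>1 x)\<^sup>2\<bar>" by (rule abs_triangle_ineq4)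
    also have "\<dots> = \<bar>B2 x\<bar> + 2 * (\<beta>1 x)\<^sup>2" by simp
    also have "\<dots> \<le> C\<^sup>2 * B x + 2 * (C\<^sup>2 / 4 * B x)"
      using b(2)[of x] b1s[of x] C0(5) B[of x] mult_right_mono[of C "C\<^sup>2" "B x"] by (intro add_mono mult_left_mono) linarith+
    also have "\<dots> \<le> 2 * C\<^sup>2 * B x" using B[of x] C0 by simp
    finally show "\<bar>B2 x - 2 * (\<beta>1 x)\<^sup>2\<bar> \<le> 2 * C\<^sup>2 * B x" .
  qed
  have b3: "\<bar>\<beta>3 x\<bar> \<le> 2 * C ^ 3 * \<beta> x" for x unfolding \<beta>3_def
  proof (rule div)
    have "\<bar>\<beta>1 x * \<beta>2 x\<bar> \<le> (C / 2 * \<beta> x) * (C\<^sup>2 * \<beta> x)"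
      unfolding abs_mult using b1[of x] b2[of x] C0 pos[of x] by (intro mult_mono) auto
    also have "\<dots> = C ^ 3 / 2 * B x" unfolding sq by (simp add: power2_eq_square power3_eq_cube)
    finally have p: "\<bar>\<beta>1 x * \<beta>2 x\<bar> \<le> C ^ 3 / 2 * B x" .
    have "\<bar>B3 x - 6 * (\<beta>1 x * \<beta>2 x)\<bar> \<le> \<bar>B3 x\<bar> + \<bar>6 * (\<beta>1 x * \<beta>2 x)\<bar>" by (rule abs_triangle_ineq4)
    also have "\<dots> = \<bar>B3 x\<bar> + 6 * \<bar>\<beta>1 x * \<beta>2 x\<bar>" by (simp add: abs_mult)
    also have "\<dots> \<le> C ^ 3 * B x + 6 * (C ^ 3 / 2 * B x)"
    proof (intro add_mono mult_left_mono p)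
      show "\<bar>B3 x\<bar> \<le> C ^ 3 * B x" using b(3)[of x] C0(2) B[of x] mult_right_mono[of C "C ^ 3" "B x"] by linarith
    qed simp
    also have "\<dots> = 2 * (2 * C ^ 3) * B x" by simp
    finally show "\<bar>B3 x - 6 * (\<beta>1 x * \<beta>2 x)\<bar> \<le> 2 * (2 * C ^ 3) * B x" .
  qed
  have up: "c * \<beta> x \<le> 2 * C ^ 3 * \<beta> x" if "c \<le> 2 * C ^ 3" for c x
    using that pos[of x] by (intro mult_right_mono) auto
  show ?thesis
  proof (rule that[of \<beta>1 \<beta>2 \<beta>3])
    show "((\<lambda>x. sqrt (B x)) has_real_derivative \<beta>1 x) (at x)" for x using D0 unfolding \<beta>_def[abs_def] .
    show "\<bar>\<beta>1 x\<bar> \<le> 2 * C ^ 3 * sqrt (B x)" for x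
      using order.trans[OF b1 up] C0 unfolding \<beta>_def by simp
    show "\<bar>\<beta>2 x\<bar> \<le> 2 * C ^ 3 * sqrt (B x)" for x
      using order.trans[OF b2 up] C0 unfolding \<beta>_def by simp
    show "\<bar>\<beta>3 x\<bar> \<le> 2 * C ^ 3 * sqrt (B x)" for x using b3 unfolding \<beta>_def .
  qed (rule D1 D2)+
qed

text \<open>The defect decays exponentially, but 1 / x is enough: the argument will be at least
  \<open>\<delta> / \<epsilon>\<close>, which makes it at most
  \<open>\<epsilon> / \<delta>\<close>.\<close>

lemma tanh_defect:
  fixes x :: real
  assumes "0 < x"
  shows "0 \<le> 1 - tanh x" "1 - tanh x \<le> 1 / x" "0 \<le> tanh x" "\<bar>1 - tanh x ^ 3\<bar> \<le> 3 * (1 - tanh x)"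
proof -
  define e where "e = exp (- 2 * x)"
  have e0: "0 < e" unfolding e_def by simp
  have t: "tanh x = (1 - e) / (1 + e)" unfolding e_def using tanh_real_altdef[of x] by simp
  have "1 - tanh x = 2 * e / (1 + e)" unfolding t using e0 by (simp add: field_simps)
  moreover have "2 * e / (1 + e) \<le> 2 * e / 1" using e0 by (intro divide_left_mono) auto
  moreover have "2 * e \<le> 1 / x"
  proof -
    have "2 * x \<le> exp (2 * x)" using exp_ge_add_one_self[of "2 * x"] by linarith
    then have "e \<le> 1 / (2 * x)" unfolding e_def using assms by (simp add: exp_minus field_simps)
    then show ?thesis using assms by (simp add: field_simps)
  qed
  ultimately show "1 - tanh x \<le> 1 / x" by simp
  show l: "0 \<le> 1 - tanh x" using tanh_real_lt_1[of x] by simp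
  show t0: "0 \<le> tanh x" using assms by simp
  have "1 - tanh x ^ 3 = (1 - tanh x) * (1 + tanh x + (tanh x)\<^sup>2)"
    by (simp add: algebra_simps power2_eq_square power3_eq_cube)
  moreover have "0 \<le> 1 + tanh x + (tanh x)\<^sup>2" "1 + tanh x + (tanh x)\<^sup>2 \<le> 3"
    using t0 l power_le_one[of "tanh x" 2] by simp_all
  ultimately show "\<bar>1 - tanh x ^ 3\<bar> \<le> 3 * (1 - tanh x)"
    using l mult_left_mono[of "1 + tanh x + (tanh x)\<^sup>2" 3 "1 - tanh x"] by (simp add: abs_mult mult.commute)
qed

text \<open>The parameter \<open>m\<close> stands for \<open>\<epsilon>\<^sup>\<rho>\<close>.\<close>
locale concentrating = arclength_curve +
  fixes W u :: "complex \<Rightarrow> real" and \<psi> :: "real \<Rightarrow> real" and \<epsilon> L M1 C0 C X K L0 m :: real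
  assumes W: "smooth2 W" "\<And>y. 0 < W y" and u: "smooth2 u"
    and eq: "\<And>y. - \<epsilon>\<^sup>2 * laplacian u y + (1 + \<epsilon>\<^sup>2 * W y) * u y - u y ^ 3 = 0"
    and \<epsilon>: "0 < \<epsilon>" "\<epsilon> \<le> 1" and m: "0 < m" "m \<le> 1" and L: "0 < L0" "L0 \<le> L"
    and C0: "1 \<le> C0" "\<And>\<theta>. \<bar>\<kappa> \<theta>\<bar> \<le> C0" "\<And>\<theta>. \<bar>deriv \<kappa> \<theta>\<bar> \<le> C0"
    and C: "1 \<le> C" and M1: "0 < M1"
    and Wt: "\<And>t \<theta>. \<bar>t\<bar> < 2 * M1 \<Longrightarrow> \<epsilon>\<^sup>2 * \<bar>pt (\<lambda>t \<theta>. W (fermi g t \<theta>)) t \<theta>\<bar> \<le> C * (1 + \<epsilon>\<^sup>2 * W (fermi g 0 \<theta>))"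
      "\<And>t \<theta>. \<bar>t\<bar> < 2 * M1 \<Longrightarrow> \<epsilon>\<^sup>2 * \<bar>pt (pt (\<lambda>t \<theta>. W (fermi g t \<theta>))) t \<theta>\<bar> \<le> C * (1 + \<epsilon>\<^sup>2 * W (fermi g 0 \<theta>))"
    and Wth: "\<And>\<theta>. \<epsilon>\<^sup>2 * \<bar>pth (\<lambda>t \<theta>. W (fermi g t \<theta>)) 0 \<theta>\<bar> \<le> C * (1 + \<epsilon>\<^sup>2 * W (fermi g 0 \<theta>))"
      "\<And>\<theta>. \<epsilon>\<^sup>2 * \<bar>pth (pth (\<lambda>t \<theta>. W (fermi g t \<theta>))) 0 \<theta>\<bar> \<le> C * (1 + \<epsilon>\<^sup>2 * W (fermi g 0 \<theta>))"
      "\<And>\<theta>. \<epsilon>\<^sup>2 * \<bar>pth (pth (pth (\<lambda>t \<theta>. W (fermi g t \<theta>)))) 0 \<theta>\<bar> \<le> C * (1 + \<epsilon>\<^sup>2 * W (fermi g 0 \<theta>))"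
    and \<psi>: "smooth1 \<psi>" "\<And>t. \<bar>t\<bar> < M1 \<Longrightarrow> \<psi> t = 1" and X: "1 \<le> X"
      "\<And>t. \<bar>t\<bar> \<le> 2 * M1 \<Longrightarrow> \<bar>\<psi> t\<bar> \<le> X" "\<And>t. \<bar>t\<bar> \<le> 2 * M1 \<Longrightarrow> \<bar>deriv \<psi> t\<bar> \<le> X"
    and K: "0 \<le> K"
    and conc: "\<And>D. D \<in> {id, pt, pth, pt \<circ> pth, pth \<circ> pth, pth \<circ> pth \<circ> pth} \<Longrightarrow>
      tubeL2 (2 * M1) L (D (\<lambda>t \<theta>. u (fermi g t \<theta>) - ansatz \<psi> (\<lambda>\<theta>. sqrt (1 + \<epsilon>\<^sup>2 * W (fermi g 0 \<theta>))) \<epsilon> t \<theta>))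
       \<le> K * m / integral {0..L} (\<lambda>\<theta>. sqrt (1 + \<epsilon>\<^sup>2 * W (fermi g 0 \<theta>)) ^ 5)
         * tubeL2 (2 * M1) L (D (ansatz \<psi> (\<lambda>\<theta>. sqrt (1 + \<epsilon>\<^sup>2 * W (fermi g 0 \<theta>))) \<epsilon>))"
begin

definition Wf :: "real \<Rightarrow> real \<Rightarrow> real" where "Wf t \<theta> = W (fermi g t \<theta>)"
definition uf :: "real \<Rightarrow> real \<Rightarrow> real" where "uf t \<theta> = u (fermi g t \<theta>)"
definition \<beta> :: "real \<Rightarrow> real" where "\<beta> \<theta> = sqrt (1 + \<epsilon>\<^sup>2 * Wf 0 \<theta>)"
definition ub :: "real \<Rightarrow> real \<Rightarrow> real" where "ub = ansatz \<psi> \<beta> \<epsilon>"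
definition \<phi> :: "real \<Rightarrow> real \<Rightarrow> real" where "\<phi> t \<theta> = uf t \<theta> - ub t \<theta>"
definition I5 :: real where "I5 = integral {0..L} (\<lambda>\<theta>. \<beta> \<theta> ^ 5)"
text \<open>\<open>KA\<close> bounds the derivatives of \<open>ub\<close> pointwise, \<open>E0\<close> and \<open>E1\<close> bound \<open>\<phi>\<close> in the tube and on
  the slices \<open>\<theta> = const\<close>. They do not depend on \<open>\<epsilon>\<close>, \<open>L\<close> or \<open>m\<close>, which makes the final bounds uniform.\<close>
definition KA :: real where "KA = 17280 * X * (2 * C ^ 3) ^ 3"
definition E0 :: real where "E0 = 4 * K\<^sup>2 * KA\<^sup>2 / L0"
definition E1 :: real where "E1 = (1 / L0 + 2) * E0"

lemma conc': "D \<in> {id, pt, pth, pt \<circ> pth, pth \<circ> pth, pth \<circ> pth \<circ> pth} \<Longrightarrow>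
      tubeL2 (2 * M1) L (D \<phi>) \<le> K * m / I5 * tubeL2 (2 * M1) L (D ub)"
  using conc unfolding \<phi>_def[abs_def] I5_def ub_def uf_def \<beta>_def[abs_def] Wf_def .

lemma ck_Wf: "ck k Wf" and ck_uf: "ck k uf"
  unfolding Wf_def[abs_def] uf_def[abs_def] by (rule ck_fermi[OF W(1)], rule ck_fermi[OF u])

lemma ck_\<beta>: "ck k (\<lambda>t. \<beta>)"
proof -
  have "ck k (\<lambda>t \<theta>. Wf 0 \<theta>)"
    unfolding Wf_def fermi_eq using ck_components[of k 0] ck_components[of k 1]
    by (intro ck_smooth2[OF W(1)] ck_add ck_diff ck_mult ck_const) simp_all
  then show ?thesis unfolding \<beta>_def[abs_def]
    by (intro ck_sqrt ck_add ck_mult ck_const) (use W(2) in \<open>simp_all add: Wf_def add_pos_nonneg less_imp_le\<close>)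
qed

lemma \<beta>_ge: "1 \<le> \<beta> \<theta>" and \<beta>_sq: "(\<beta> \<theta>)\<^sup>2 = 1 + \<epsilon>\<^sup>2 * Wf 0 \<theta>"
proof -
  have "0 \<le> \<epsilon>\<^sup>2 * Wf 0 \<theta>" using W(2)[THEN less_imp_le] by (simp add: Wf_def)
  then show "1 \<le> \<beta> \<theta>" "(\<beta> \<theta>)\<^sup>2 = 1 + \<epsilon>\<^sup>2 * Wf 0 \<theta>" unfolding \<beta>_def by simp_all
qed

lemma \<beta>_cont: "continuous_on S \<beta>"
  using ck_cont_snd[where f="\<lambda>t. \<beta>", OF ck_\<beta>] .

lemma \<psi>_deriv: "((deriv ^^ j) \<psi> has_real_derivative (deriv ^^ Suc j) \<psi> t) (at t)"
  using \<psi>(1) unfolding smooth1_def by (simp add: DERIV_deriv_iff_real_differentiable)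

lemma ck_ub: "ck k ub"
proof -
  have "ck k (\<lambda>t \<theta>. (deriv ^^ 0) \<psi> t)" 
    by (rule ck_compose[where h="\<lambda>j. (deriv ^^ j) \<psi>" and j=0, OF \<psi>_deriv ck_t])
  moreover have "ck k (\<lambda>t \<theta>. \<beta> \<theta> * t * (1 / \<epsilon>))" by (intro ck_mult ck_\<beta> ck_t ck_const)
  then have "ck k (\<lambda>t \<theta>. soliton (\<beta> \<theta> * t * (1 / \<epsilon>)))"
    using ck_compose_ode[OF DERIV_soliton DERIV_soliton'] by blast
  ultimately have "ck k (\<lambda>t \<theta>. (deriv ^^ 0) \<psi> t * \<beta> \<theta> * soliton (\<beta> \<theta> * t * (1 / \<epsilon>)))"
    by (intro ck_mult ck_\<beta>)
  then show ?thesis by (simp add: ub_def ansatz_def[abs_def])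
qed

lemma ck_\<phi>: "ck k \<phi>" unfolding \<phi>_def[abs_def] by (intro ck_diff ck_uf ck_ub)

text \<open>\<beta> is at least 1 and the length at least \<open>L0\<close>. This makes the factor
  \<open>1 / I5\<close> left over from the relative error uniform.\<close>

lemma I5_ge: "L0 \<le> I5"
proof -
  have "integral {0..L} (\<lambda>\<theta>. 1) \<le> I5" unfolding I5_def
    using \<beta>_cont \<beta>_ge
    by (intro integral_le integrable_continuous_real continuous_intros) (auto simp: one_le_power)
  then show ?thesis using L by simp
qed

lemma KA_ge: "1 \<le> KA" "0 \<le> E0" "0 \<le> E1"
proof -
  have "1 \<le> C ^ 3" using C by (simp add: one_le_power)
  then have "1 \<le> (2 * C ^ 3) ^ 3" by (intro one_le_power) simp
  then have "1 * 1 \<le> 17280 * X * (2 * C ^ 3) ^ 3" using X(1) by (intro mult_mono) auto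
  then show "1 \<le> KA" unfolding KA_def by simp
  show "0 \<le> E0" unfolding E0_def using L by simp
  then show "0 \<le> E1" unfolding E1_def using L by simp
qed

lemma ub_pointwise:
  fixes t \<theta> :: real
  assumes t: "\<bar>t\<bar> \<le> 2 * M1"
  defines "N \<equiv> 1 / (1 + (\<beta> \<theta> * t / \<epsilon>)\<^sup>2)"
  shows "\<bar>ub t \<theta>\<bar> \<le> KA * \<beta> \<theta> * N" "\<bar>pth ub t \<theta>\<bar> \<le> KA * \<beta> \<theta> * N"
    "\<bar>pth (pth ub) t \<theta>\<bar> \<le> KA * \<beta> \<theta> * N" "\<bar>pth (pth (pth ub)) t \<theta>\<bar> \<le> KA * \<beta> \<theta> * N"
    "\<bar>pt ub t \<theta>\<bar> \<le> KA * ((\<beta> \<theta>)\<^sup>2 / \<epsilon>) * N" "\<bar>pt (pth ub) t \<theta>\<bar> \<le> KA * ((\<beta> \<theta>)\<^sup>2 / \<epsilon>) * N"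
proof -
  define B where "B \<theta> = 1 + \<epsilon>\<^sup>2 * Wf 0 \<theta>" for \<theta>
  have B1: "1 \<le> B \<theta>" for \<theta> using \<beta>_ge[of \<theta>] \<beta>_sq[of \<theta>] one_le_power[of "\<beta> \<theta>" 2] by (simp add: B_def)
  have dB: "(B has_real_derivative \<epsilon>\<^sup>2 * pth Wf 0 \<theta>) (at \<theta>)" for \<theta>
    unfolding B_def[abs_def] using DERIV_add[OF DERIV_const DERIV_cmult[OF ck_pth_deriv[OF ck_Wf]]] by simp
  have dB1: "((\<lambda>\<theta>. \<epsilon>\<^sup>2 * pth Wf 0 \<theta>) has_real_derivative \<epsilon>\<^sup>2 * pth (pth Wf) 0 \<theta>) (at \<theta>)" for \<theta>
    by (intro DERIV_cmult ck_pth_deriv ck_pth ck_Wf)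
  have dB2: "((\<lambda>\<theta>. \<epsilon>\<^sup>2 * pth (pth Wf) 0 \<theta>) has_real_derivative \<epsilon>\<^sup>2 * pth (pth (pth Wf)) 0 \<theta>) (at \<theta>)" for \<theta>
    by (intro DERIV_cmult ck_pth_deriv ck_pth ck_Wf)
  have bB: "\<bar>\<epsilon>\<^sup>2 * pth Wf 0 \<theta>\<bar> \<le> C * B \<theta>" "\<bar>\<epsilon>\<^sup>2 * pth (pth Wf) 0 \<theta>\<bar> \<le> C * B \<theta>"
    "\<bar>\<epsilon>\<^sup>2 * pth (pth (pth Wf)) 0 \<theta>\<bar> \<le> C * B \<theta>" for \<theta>
    using Wth[of \<theta>] unfolding B_def Wf_def[abs_def] by (simp_all add: abs_mult)
  from sqrt_deriv_bounds[OF B1 C dB dB1 dB2 bB] obtain \<beta>1 \<beta>2 \<beta>3 where d: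
    "\<And>x. ((\<lambda>x. sqrt (B x)) has_real_derivative \<beta>1 x) (at x)"
    "\<And>x. (\<beta>1 has_real_derivative \<beta>2 x) (at x)" "\<And>x. (\<beta>2 has_real_derivative \<beta>3 x) (at x)"
    and b: "\<And>x. \<bar>\<beta>1 x\<bar> \<le> 2 * C ^ 3 * sqrt (B x)" "\<And>x. \<bar>\<beta>2 x\<bar> \<le> 2 * C ^ 3 * sqrt (B x)"
    "\<And>x. \<bar>\<beta>3 x\<bar> \<le> 2 * C ^ 3 * sqrt (B x)" by metis
  have \<beta>B: "(\<lambda>x. sqrt (B x)) = \<beta>" "\<And>x. sqrt (B x) = \<beta> x" by (simp_all add: fun_eq_iff \<beta>_def B_def)
  note d = d[unfolded \<beta>B] and b = b[unfolded \<beta>B]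
  have \<psi>d: "(\<psi> has_real_derivative deriv \<psi> t) (at t)" for t using \<psi>_deriv[of 0 t] by simp
  have "\<epsilon> \<noteq> 0" using \<epsilon> by simp
  note D = ansatz_derivs[OF \<psi>d d this, folded ub_def]
  have C3: "1 \<le> 2 * C ^ 3" using one_le_power[OF C, of 3] by simp
  have KN: "17280 * X * (2 * C ^ 3) ^ 3 / (1 + (\<beta> \<theta> * t / \<epsilon>)\<^sup>2) * w = KA * w * N" for w
    unfolding KA_def N_def by simp
  have X0: "0 \<le> X" using X(1) by simp
  note P = ansatz_pointwise[where t=t and \<beta>="\<beta> \<theta>", OF \<epsilon> \<beta>_ge b C3 X0 X(2)[OF t] X(3)[OF t], unfolded KN]
  show "\<bar>ub t \<theta>\<bar> \<le> KA * \<beta> \<theta> * N" using P(1) unfolding ub_def ansatz_def .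
  show "\<bar>pth ub t \<theta>\<bar> \<le> KA * \<beta> \<theta> * N" using P(2) unfolding D(2) .
  show "\<bar>pth (pth ub) t \<theta>\<bar> \<le> KA * \<beta> \<theta> * N" using P(3) unfolding D(3) .
  show "\<bar>pth (pth (pth ub)) t \<theta>\<bar> \<le> KA * \<beta> \<theta> * N" using P(4) unfolding D(4) .
  show "\<bar>pt ub t \<theta>\<bar> \<le> KA * ((\<beta> \<theta>)\<^sup>2 / \<epsilon>) * N" using P(5) unfolding D(1) .
  show "\<bar>pt (pth ub) t \<theta>\<bar> \<le> KA * ((\<beta> \<theta>)\<^sup>2 / \<epsilon>) * N" using P(6) unfolding D(5) .
qed

text \<open>Squaring the relative bound gives \<open>(K * m / I5)\<^sup>2\<close> times the squared
  norm of the ansatz, which contains one factor \<open>I5\<close>. The remaining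
  \<open>1 / I5\<close> is at most \<open>1 / L0\<close>, so no trace of \<beta> is left. The weight
  is \<epsilon> without a t-derivative and \<open>1 / \<epsilon>\<close> with one.\<close>

lemma tube_error:
  shows "D \<in> {id, pth, pth \<circ> pth, pth \<circ> pth \<circ> pth} \<Longrightarrow> (tubeL2 (2 * M1) L (D \<phi>))\<^sup>2 \<le> E0 * \<epsilon> * m\<^sup>2"
    and "D \<in> {pt, pt \<circ> pth} \<Longrightarrow> (tubeL2 (2 * M1) L (D \<phi>))\<^sup>2 \<le> E0 * m\<^sup>2 / \<epsilon>"
proof -
  have I0: "0 < I5" using I5_ge L by linarith
  have main: "(tubeL2 (2 * M1) L (D \<phi>))\<^sup>2 \<le> E0 * w * m\<^sup>2"
    if D: "D \<in> {id, pt, pth, pt \<circ> pth, pth \<circ> pth, pth \<circ> pth \<circ> pth}"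
      and le: "(tubeL2 (2 * M1) L (D ub))\<^sup>2 \<le> KA\<^sup>2 * 4 * w * I5" and w: "0 \<le> w" for D w
  proof -
    have "(tubeL2 (2 * M1) L (D \<phi>))\<^sup>2 \<le> (K * m / I5 * tubeL2 (2 * M1) L (D ub))\<^sup>2"
      by (rule power_mono[OF conc'[OF D] tubeL2_nonneg])
    also have "\<dots> = (K * m / I5)\<^sup>2 * (tubeL2 (2 * M1) L (D ub))\<^sup>2" by (rule power_mult_distrib)
    also have "\<dots> \<le> (K * m / I5)\<^sup>2 * (KA\<^sup>2 * 4 * w * I5)" using le by (rule mult_left_mono) simp
    also have "\<dots> = 4 * K\<^sup>2 * KA\<^sup>2 * w * m\<^sup>2 / I5" using I0 by (simp add: power2_eq_square)
    also have "\<dots> \<le> 4 * K\<^sup>2 * KA\<^sup>2 * w * m\<^sup>2 / L0" using I5_ge L w by (intro divide_left_mono) auto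
    finally show ?thesis by (simp add: E0_def)
  qed
  note \<beta>c = \<beta>_cont[of "{0..L}"]
  have M: "0 < 2 * M1" using M1 by simp
  have KA0: "0 \<le> KA" "0 \<le> KA / \<epsilon>" using KA_ge(1) \<epsilon> by simp_all
  have th: "(tubeL2 (2 * M1) L f)\<^sup>2 \<le> KA\<^sup>2 * 4 * \<epsilon> * I5"
    if "ck 0 f" "\<And>t \<theta>. \<bar>t\<bar> \<le> 2 * M1 \<Longrightarrow> \<bar>f t \<theta>\<bar> \<le> KA * \<beta> \<theta> * (1 / (1 + (\<beta> \<theta> * t / \<epsilon>)\<^sup>2))" for f
    unfolding I5_def
    by (rule tubeL2_lorentz_majorant[where i=1, OF ck_cont[OF that(1)] \<beta>c \<beta>_ge \<epsilon>(1) M KA0(1)]) (use that in auto)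
  have tt: "(tubeL2 (2 * M1) L f)\<^sup>2 \<le> KA\<^sup>2 * 4 * (1 / \<epsilon>) * I5"
    if "ck 0 f" "\<And>t \<theta>. \<bar>t\<bar> \<le> 2 * M1 \<Longrightarrow> \<bar>f t \<theta>\<bar> \<le> KA * ((\<beta> \<theta>)\<^sup>2 / \<epsilon>) * (1 / (1 + (\<beta> \<theta> * t / \<epsilon>)\<^sup>2))" for f
  proof -
    have "(tubeL2 (2 * M1) L f)\<^sup>2 \<le> (KA / \<epsilon>)\<^sup>2 * 4 * \<epsilon> * I5" unfolding I5_def
      by (rule tubeL2_lorentz_majorant[where i=2, OF ck_cont[OF that(1)] \<beta>c \<beta>_ge \<epsilon>(1) M KA0(2)]) (use that in auto)
    also have "\<dots> = KA\<^sup>2 * 4 * (1 / \<epsilon>) * I5" using \<epsilon> by (simp add: power2_eq_square)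
    finally show ?thesis .
  qed
  note ck = ck_ub ck_pth[OF ck_ub] ck_pth[OF ck_pth[OF ck_ub]] ck_pth[OF ck_pth[OF ck_pth[OF ck_ub]]]
    ck_pt[OF ck_ub] ck_pt[OF ck_pth[OF ck_ub]]
  show "(tubeL2 (2 * M1) L (D \<phi>))\<^sup>2 \<le> E0 * \<epsilon> * m\<^sup>2" if D: "D \<in> {id, pth, pth \<circ> pth, pth \<circ> pth \<circ> pth}" for D
  proof (rule main)
    show "(tubeL2 (2 * M1) L (D ub))\<^sup>2 \<le> KA\<^sup>2 * 4 * \<epsilon> * I5"
      using D th[OF ck(1) ub_pointwise(1)] th[OF ck(2) ub_pointwise(2)] th[OF ck(3) ub_pointwise(3)]
        th[OF ck(4) ub_pointwise(4)] by auto
  qed (use D \<epsilon> in auto)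
  show "(tubeL2 (2 * M1) L (D \<phi>))\<^sup>2 \<le> E0 * m\<^sup>2 / \<epsilon>" if D: "D \<in> {pt, pt \<circ> pth}" for D
  proof -
    have "(tubeL2 (2 * M1) L (D \<phi>))\<^sup>2 \<le> E0 * (1 / \<epsilon>) * m\<^sup>2"
    proof (rule main)
      show "(tubeL2 (2 * M1) L (D ub))\<^sup>2 \<le> KA\<^sup>2 * 4 * (1 / \<epsilon>) * I5"
        using D tt[OF ck(5) ub_pointwise(5)] tt[OF ck(6) ub_pointwise(6)] by auto
    qed (use D \<epsilon> in auto)
    then show ?thesis by simp
  qed
qed

text \<open>Each bound combines the tube bounds of the function and of its \<theta>-derivative, so
  the second \<theta>-derivative uses the third, and \<open>pt \<phi>\<close> uses the mixed
  derivative after exchanging the order. The coefficient \<open>1 / L0 + 2\<close> adds up the two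
  coefficients of the trace inequality.\<close>

lemma slice_error:
  assumes \<theta>: "\<theta> \<in> {0..L}" and \<delta>: "\<delta> \<le> 2 * M1"
  shows "integral {-\<delta>..\<delta>} (\<lambda>t. (\<phi> t \<theta>)\<^sup>2) \<le> E1 * m\<^sup>2 * \<epsilon>"
    "integral {-\<delta>..\<delta>} (\<lambda>t. (pth \<phi> t \<theta>)\<^sup>2) \<le> E1 * m\<^sup>2 * \<epsilon>"
    "integral {-\<delta>..\<delta>} (\<lambda>t. (pth (pth \<phi>) t \<theta>)\<^sup>2) \<le> E1 * m\<^sup>2 * \<epsilon>"
    "integral {-\<delta>..\<delta>} (\<lambda>t. (pt \<phi> t \<theta>)\<^sup>2) \<le> E1 * m\<^sup>2 / \<epsilon>"
proof -
  have tr: "integral {-\<delta>..\<delta>} (\<lambda>t. (f t \<theta>)\<^sup>2) \<le> (1 / L0 + 2) * z"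
    if "ck (Suc 0) f" "(tubeL2 (2 * M1) L f)\<^sup>2 \<le> z" "(tubeL2 (2 * M1) L (pth f))\<^sup>2 \<le> z" for f z
  proof -
    have "(1 / L0 + 1) * (tubeL2 (2 * M1) L f)\<^sup>2 \<le> (1 / L0 + 1) * z" using that(2) L by (intro mult_left_mono) auto
    then show ?thesis using tube_trace[OF that(1) L \<theta> \<delta>] that(3) by (simp add: algebra_simps)
  qed
  note te = tube_error(1)[of id, simplified] tube_error(1)[of pth, simplified]
    tube_error(1)[of "pth \<circ> pth", simplified] tube_error(1)[of "pth \<circ> pth \<circ> pth", simplified]
  have te2: "(tubeL2 (2 * M1) L (pt \<phi>))\<^sup>2 \<le> E0 * m\<^sup>2 / \<epsilon>" "(tubeL2 (2 * M1) L (pth (pt \<phi>)))\<^sup>2 \<le> E0 * m\<^sup>2 / \<epsilon>"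
    using tube_error(2)[of pt] tube_error(2)[of "pt \<circ> pth"] ck_clairaut[OF ck_\<phi>] by simp_all
  have E: "(1 / L0 + 2) * (E0 * \<epsilon> * m\<^sup>2) = E1 * m\<^sup>2 * \<epsilon>" "(1 / L0 + 2) * (E0 * m\<^sup>2 / \<epsilon>) = E1 * m\<^sup>2 / \<epsilon>"
    by (simp_all add: E1_def)
  show "integral {-\<delta>..\<delta>} (\<lambda>t. (\<phi> t \<theta>)\<^sup>2) \<le> E1 * m\<^sup>2 * \<epsilon>"
    unfolding E[symmetric] by (rule tr[OF ck_\<phi> te(1) te(2)])
  show "integral {-\<delta>..\<delta>} (\<lambda>t. (pth \<phi> t \<theta>)\<^sup>2) \<le> E1 * m\<^sup>2 * \<epsilon>"
    unfolding E[symmetric] by (rule tr[OF ck_pth[OF ck_\<phi>] te(2) te(3)])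
  show "integral {-\<delta>..\<delta>} (\<lambda>t. (pth (pth \<phi>) t \<theta>)\<^sup>2) \<le> E1 * m\<^sup>2 * \<epsilon>"
    unfolding E[symmetric] by (rule tr[OF ck_pth[OF ck_pth[OF ck_\<phi>]] te(3) te(4)])
  show "integral {-\<delta>..\<delta>} (\<lambda>t. (pt \<phi> t \<theta>)\<^sup>2) \<le> E1 * m\<^sup>2 / \<epsilon>"
    unfolding E[symmetric] by (rule tr[OF ck_pt[OF ck_\<phi>] te2])
qed

end

section \<open>The balance law and the mass bound at fixed \<epsilon>\<close>

context concentrating
begin

text \<open>A single constant above all those required in the integrated identity. The last summand
  is the sup bound on \<phi>; \<delta> will be chosen once for all \<epsilon>.\<close>

definition CP :: "real \<Rightarrow> real" where
  "CP \<delta> = 1 + C + C0 + 8 * KA\<^sup>2 + 2 * E1 + E1 * (1 / (2 * \<delta>) + 2)"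

text \<open>The cut-off equals 1 on an open interval around 0, so there the t-derivative also agrees
  with that of the pure soliton.\<close>

lemma ub_core:
  assumes t: "\<bar>t\<bar> < M1"
  shows "ub t \<theta> = \<beta> \<theta> * soliton (\<beta> \<theta> / \<epsilon> * t)" "pt ub t \<theta> = (\<beta> \<theta>)\<^sup>2 / \<epsilon> * soliton' (\<beta> \<theta> / \<epsilon> * t)"
proof -
  have e: "ub s \<theta> = \<beta> \<theta> * soliton (\<beta> \<theta> / \<epsilon> * s)" if "\<bar>s\<bar> < M1" for s
    unfolding ub_def ansatz_def using \<psi>(2)[OF that] by simp
  show "ub t \<theta> = \<beta> \<theta> * soliton (\<beta> \<theta> / \<epsilon> * t)" by (rule e[OF t])
  have "((\<lambda>s. \<beta> \<theta> * soliton (\<beta> \<theta> / \<epsilon> * s)) has_real_derivative \<beta> \<theta> * (soliton' (\<beta> \<theta> / \<epsilon> * t) * (\<beta> \<theta> / \<epsilon>))) (at t)"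
    using DERIV_cmult[OF DERIV_ident, of "\<beta> \<theta> / \<epsilon>" t]
    by (intro DERIV_cmult DERIV_chain2[OF DERIV_soliton]) (simp only: mult_1_right)
  then have "((\<lambda>s. ub s \<theta>) has_real_derivative \<beta> \<theta> * (soliton' (\<beta> \<theta> / \<epsilon> * t) * (\<beta> \<theta> / \<epsilon>))) (at t)"
    by (rule has_field_derivative_transform_within_open[of _ _ _ "{-M1<..<M1}"]) (use t e in auto)
  from DERIV_unique[OF ck_pt_deriv[OF ck_ub] this]
  show "pt ub t \<theta> = (\<beta> \<theta>)\<^sup>2 / \<epsilon> * soliton' (\<beta> \<theta> / \<epsilon> * t)" by (simp add: power2_eq_square)
qed

lemma ub_slices:
  assumes \<delta>: "0 < \<delta>" "\<delta> < M1"
  shows "integral {-\<delta>..\<delta>} (\<lambda>t. (ub t \<theta>)\<^sup>2) = 4 * \<epsilon> * \<beta> \<theta> * tanh (\<beta> \<theta> / \<epsilon> * \<delta>)"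
    and "integral {-\<delta>..\<delta>} (\<lambda>t. (pt ub t \<theta>)\<^sup>2) = 4 / 3 * \<beta> \<theta> ^ 3 / \<epsilon> * tanh (\<beta> \<theta> / \<epsilon> * \<delta>) ^ 3"
proof -
  have b0: "0 < \<beta> \<theta>" using \<beta>_ge[of \<theta>] by linarith
  then have k: "0 < \<beta> \<theta> / \<epsilon>" using \<epsilon> by simp
  have "integral {-\<delta>..\<delta>} (\<lambda>t. (ub t \<theta>)\<^sup>2) = integral {-\<delta>..\<delta>} (\<lambda>t. (\<beta> \<theta>)\<^sup>2 * (soliton (\<beta> \<theta> / \<epsilon> * t))\<^sup>2)"
    using \<delta> by (intro integral_cong) (auto simp: ub_core(1) power_mult_distrib)
  also have "\<dots> = (\<beta> \<theta>)\<^sup>2 * (4 * tanh (\<beta> \<theta> / \<epsilon> * \<delta>) / (\<beta> \<theta> / \<epsilon>))"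
    unfolding integral_soliton(1)[OF k \<delta>(1), symmetric] by (rule Henstock_Kurzweil_Integration.integral_mult_right)
  also have "\<dots> = 4 * \<epsilon> * \<beta> \<theta> * tanh (\<beta> \<theta> / \<epsilon> * \<delta>)" using b0 by (simp add: power2_eq_square)
  finally show "integral {-\<delta>..\<delta>} (\<lambda>t. (ub t \<theta>)\<^sup>2) = 4 * \<epsilon> * \<beta> \<theta> * tanh (\<beta> \<theta> / \<epsilon> * \<delta>)" .
  have "integral {-\<delta>..\<delta>} (\<lambda>t. (pt ub t \<theta>)\<^sup>2) = integral {-\<delta>..\<delta>} (\<lambda>t. ((\<beta> \<theta>)\<^sup>2 / \<epsilon>)\<^sup>2 * (soliton' (\<beta> \<theta> / \<epsilon> * t))\<^sup>2)"
    by (intro integral_cong, subst ub_core(2)) (simp_all only: power_mult_distrib, use \<delta> in auto)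
  also have "\<dots> = ((\<beta> \<theta>)\<^sup>2 / \<epsilon>)\<^sup>2 * (4 / 3 * tanh (\<beta> \<theta> / \<epsilon> * \<delta>) ^ 3 / (\<beta> \<theta> / \<epsilon>))"
    unfolding integral_soliton(2)[OF k \<delta>(1), symmetric] by (rule Henstock_Kurzweil_Integration.integral_mult_right)
  also have "\<dots> = 4 / 3 * \<beta> \<theta> ^ 3 / \<epsilon> * tanh (\<beta> \<theta> / \<epsilon> * \<delta>) ^ 3"
    using b0 \<epsilon> by (simp add: power2_eq_square power3_eq_cube)
  finally show "integral {-\<delta>..\<delta>} (\<lambda>t. (pt ub t \<theta>)\<^sup>2) = 4 / 3 * \<beta> \<theta> ^ 3 / \<epsilon> * tanh (\<beta> \<theta> / \<epsilon> * \<delta>) ^ 3" .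
qed

lemma tanh_core:
  assumes \<delta>: "0 < \<delta>"
  shows "0 \<le> tanh (\<beta> \<theta> / \<epsilon> * \<delta>)" "0 \<le> 1 - tanh (\<beta> \<theta> / \<epsilon> * \<delta>)" "1 - tanh (\<beta> \<theta> / \<epsilon> * \<delta>) \<le> \<epsilon> / \<delta>"
    "\<bar>1 - tanh (\<beta> \<theta> / \<epsilon> * \<delta>) ^ 3\<bar> \<le> 3 * (\<epsilon> / \<delta>)"
proof -
  have b0: "0 < \<beta> \<theta>" using \<beta>_ge[of \<theta>] by linarith
  have x: "0 < \<beta> \<theta> / \<epsilon> * \<delta>" using b0 \<epsilon> \<delta> by simp
  have "\<delta> / \<epsilon> \<le> \<beta> \<theta> / \<epsilon> * \<delta>" using \<beta>_ge[of \<theta>] \<epsilon> \<delta> mult_right_mono[of 1 "\<beta> \<theta>" "\<delta> / \<epsilon>"] by simp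
  moreover have "0 < \<delta> / \<epsilon>" using \<epsilon> \<delta> by simp
  ultimately have "1 / (\<beta> \<theta> / \<epsilon> * \<delta>) \<le> 1 / (\<delta> / \<epsilon>)"
    by (intro divide_left_mono[OF _ _ mult_pos_pos[OF x]]) simp_all
  then have le: "1 / (\<beta> \<theta> / \<epsilon> * \<delta>) \<le> \<epsilon> / \<delta>" by simp
  show "0 \<le> tanh (\<beta> \<theta> / \<epsilon> * \<delta>)" "0 \<le> 1 - tanh (\<beta> \<theta> / \<epsilon> * \<delta>)" by (rule tanh_defect[OF x])+
  show l: "1 - tanh (\<beta> \<theta> / \<epsilon> * \<delta>) \<le> \<epsilon> / \<delta>" by (rule order.trans[OF tanh_defect(2)[OF x] le])
  show "\<bar>1 - tanh (\<beta> \<theta> / \<epsilon> * \<delta>) ^ 3\<bar> \<le> 3 * (\<epsilon> / \<delta>)"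
    using tanh_defect(4)[OF x] l by argo
qed

lemma uf_eq:
  assumes J: "1 + \<kappa> \<theta> * t \<noteq> 0"
  shows "- \<epsilon>\<^sup>2 * (pt (pt uf) t \<theta> + \<kappa> \<theta> / (1 + \<kappa> \<theta> * t) * pt uf t \<theta> + pth (pth uf) t \<theta> / (1 + \<kappa> \<theta> * t)\<^sup>2
        - t * deriv \<kappa> \<theta> * pth uf t \<theta> / (1 + \<kappa> \<theta> * t) ^ 3) + (1 + \<epsilon>\<^sup>2 * Wf t \<theta>) * uf t \<theta> - uf t \<theta> ^ 3 = 0"
  using eq[of "fermi g t \<theta>"] fermi_laplacian[OF u J] unfolding uf_def[abs_def] Wf_def by simp

text \<open>The hypotheses bound the first two t-derivatives of the potential by its value at t = 0
  on the same normal line. The mean value inequality from 0 to t therefore keeps that value as the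
  reference.\<close>

lemma potential_bounds:
  assumes t: "\<bar>t\<bar> < 2 * M1" "\<bar>t\<bar> \<le> 1"
  shows "\<bar>\<epsilon>\<^sup>2 * pt Wf t \<theta>\<bar> \<le> C * (\<beta> \<theta>)\<^sup>2"
    "\<bar>\<epsilon>\<^sup>2 * pt Wf t \<theta> - \<epsilon>\<^sup>2 * pt Wf 0 \<theta>\<bar> \<le> C * (\<beta> \<theta>)\<^sup>2 * \<bar>t\<bar>"
    "\<bar>1 + \<epsilon>\<^sup>2 * Wf t \<theta>\<bar> \<le> (1 + C) * (\<beta> \<theta>)\<^sup>2"
proof -
  let ?S = "{-2 * M1<..<2 * M1}"
  have 1: "\<bar>\<epsilon>\<^sup>2 * pt Wf s \<theta>\<bar> \<le> C * (\<beta> \<theta>)\<^sup>2" "\<bar>\<epsilon>\<^sup>2 * pt (pt Wf) s \<theta>\<bar> \<le> C * (\<beta> \<theta>)\<^sup>2" if "s \<in> ?S" for s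
    using Wt[of s \<theta>] that unfolding \<beta>_sq Wf_def[abs_def] by (auto simp: abs_mult)
  have m: "t \<in> ?S" "0 \<in> ?S" using t M1 by auto
  show "\<bar>\<epsilon>\<^sup>2 * pt Wf t \<theta>\<bar> \<le> C * (\<beta> \<theta>)\<^sup>2" by (rule 1[OF m(1)])
  have "norm (\<epsilon>\<^sup>2 * pt Wf t \<theta> - \<epsilon>\<^sup>2 * pt Wf 0 \<theta>) \<le> C * (\<beta> \<theta>)\<^sup>2 * norm (t - 0)"
    by (rule field_differentiable_bound[OF _ _ _ m, of "\<lambda>s. \<epsilon>\<^sup>2 * pt Wf s \<theta>" "\<lambda>s. \<epsilon>\<^sup>2 * pt (pt Wf) s \<theta>"])
      (use 1 in \<open>auto intro!: has_field_derivative_at_within[OF DERIV_cmult[OF ck_pt_deriv[OF ck_pt[OF ck_Wf]]]]\<close>)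
  then show "\<bar>\<epsilon>\<^sup>2 * pt Wf t \<theta> - \<epsilon>\<^sup>2 * pt Wf 0 \<theta>\<bar> \<le> C * (\<beta> \<theta>)\<^sup>2 * \<bar>t\<bar>" by simp
  have "norm (\<epsilon>\<^sup>2 * Wf t \<theta> - \<epsilon>\<^sup>2 * Wf 0 \<theta>) \<le> C * (\<beta> \<theta>)\<^sup>2 * norm (t - 0)"
    by (rule field_differentiable_bound[OF _ _ _ m, of "\<lambda>s. \<epsilon>\<^sup>2 * Wf s \<theta>" "\<lambda>s. \<epsilon>\<^sup>2 * pt Wf s \<theta>"])
      (use 1 in \<open>auto intro!: has_field_derivative_at_within[OF DERIV_cmult[OF ck_pt_deriv[OF ck_Wf]]]\<close>)
  also have "\<dots> \<le> C * (\<beta> \<theta>)\<^sup>2 * 1" using t C by (intro mult_left_mono) auto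
  finally have "\<bar>\<epsilon>\<^sup>2 * Wf t \<theta> - \<epsilon>\<^sup>2 * Wf 0 \<theta>\<bar> \<le> C * (\<beta> \<theta>)\<^sup>2" by simp
  moreover have "1 + \<epsilon>\<^sup>2 * Wf t \<theta> = (\<beta> \<theta>)\<^sup>2 + (\<epsilon>\<^sup>2 * Wf t \<theta> - \<epsilon>\<^sup>2 * Wf 0 \<theta>)" unfolding \<beta>_sq by simp
  ultimately have "\<bar>1 + \<epsilon>\<^sup>2 * Wf t \<theta>\<bar> \<le> (\<beta> \<theta>)\<^sup>2 + C * (\<beta> \<theta>)\<^sup>2"
    using abs_triangle_ineq[of "(\<beta> \<theta>)\<^sup>2" "\<epsilon>\<^sup>2 * Wf t \<theta> - \<epsilon>\<^sup>2 * Wf 0 \<theta>"] by simp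
  then show "\<bar>1 + \<epsilon>\<^sup>2 * Wf t \<theta>\<bar> \<le> (1 + C) * (\<beta> \<theta>)\<^sup>2" by (simp add: algebra_simps)
qed

text \<open>With Sobolev weight \<open>1 / \<epsilon>\<close> the slice norms of \<phi> and
  \<open>pt \<phi>\<close>, of squared size \<open>m\<^sup>2 * \<epsilon>\<close> and
  \<open>m\<^sup>2 / \<epsilon>\<close>, both contribute O(\<open>m\<^sup>2\<close>), and no
  negative power of \<epsilon> remains.\<close>

lemma sup_error:
  assumes \<theta>: "\<theta> \<in> {0..L}" and \<delta>: "0 < \<delta>" "\<delta> \<le> 2 * M1" and t: "t \<in> {-\<delta>..\<delta>}"
  shows "(\<phi> t \<theta>)\<^sup>2 \<le> E1 * (1 / (2 * \<delta>) + 2) * m\<^sup>2"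
proof -
  have "(\<phi> t \<theta>)\<^sup>2 \<le> (1 / (\<delta> - (-\<delta>)) + 1 / \<epsilon>) * integral {-\<delta>..\<delta>} (\<lambda>t. (\<phi> t \<theta>)\<^sup>2)
      + 1 / (1 / \<epsilon>) * integral {-\<delta>..\<delta>} (\<lambda>t. (pt \<phi> t \<theta>)\<^sup>2)"
    by (rule sobolev_interval[OF _ t])
      (use \<delta> \<epsilon> ck_cont_fst[OF ck_pt[OF ck_\<phi>]] in \<open>auto intro: has_field_derivative_at_within[OF ck_pt_deriv[OF ck_\<phi>]]\<close>)
  also have "\<dots> \<le> (1 / (\<delta> - (-\<delta>)) + 1 / \<epsilon>) * (E1 * m\<^sup>2 * \<epsilon>) + 1 / (1 / \<epsilon>) * (E1 * m\<^sup>2 / \<epsilon>)"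
    using slice_error(1,4)[OF \<theta> \<delta>(2)] \<delta> \<epsilon> by (intro add_mono mult_left_mono) auto
  also have "\<dots> = E1 * m\<^sup>2 * (\<epsilon> / (2 * \<delta>) + 2)"
    using \<epsilon> \<delta> by (simp add: algebra_simps)
  also have "\<dots> \<le> E1 * m\<^sup>2 * (1 / (2 * \<delta>) + 2)"
    using KA_ge(3) \<epsilon> \<delta> by (intro mult_left_mono add_right_mono divide_right_mono) auto
  finally show ?thesis by (simp add: mult_ac)
qed

text \<open>Applied to the \<theta>-derivatives of the solution, with f from the ansatz and h from
  \<phi>. The bound is of the size of the ansatz alone, since m \<le> 1 \<le> \<beta>.\<close>

lemma square_sum_slice:
  assumes f: "ck 0 f" and h: "ck 0 h" and \<delta>: "0 < \<delta>" "\<delta> \<le> 2 * M1"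
    and b: "\<And>t. \<bar>t\<bar> \<le> 2 * M1 \<Longrightarrow> \<bar>f t \<theta>\<bar> \<le> KA * \<beta> \<theta> * (1 / (1 + (\<beta> \<theta> * t / \<epsilon>)\<^sup>2))"
    and hi: "integral {-\<delta>..\<delta>} (\<lambda>t. (h t \<theta>)\<^sup>2) \<le> E1 * m\<^sup>2 * \<epsilon>"
  shows "integral {-\<delta>..\<delta>} (\<lambda>t. (f t \<theta> + h t \<theta>)\<^sup>2) \<le> (8 * KA\<^sup>2 + 2 * E1) * \<epsilon> * \<beta> \<theta>"
proof -
  note cf = ck_cont_fst[OF f] and ch = ck_cont_fst[OF h]
  have b0: "0 < \<beta> \<theta>" using \<beta>_ge[of \<theta>] by linarith
  have fi: "integral {-\<delta>..\<delta>} (\<lambda>t. (f t \<theta>)\<^sup>2) \<le> (KA * \<beta> \<theta>)\<^sup>2 * (4 * \<epsilon> / \<beta> \<theta>)"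
    by (rule integral_lorentz_majorant(1)[OF cf \<delta>(1) \<beta>_ge \<epsilon>(1)]) (use b b0 KA_ge(1) \<delta> in auto)
  have sq: "(x + y)\<^sup>2 \<le> 2 * x\<^sup>2 + 2 * y\<^sup>2" for x y :: real using sq_le_twice[of "x + y" x] by simp
  have "integral {-\<delta>..\<delta>} (\<lambda>t. (f t \<theta> + h t \<theta>)\<^sup>2) \<le> integral {-\<delta>..\<delta>} (\<lambda>t. 2 * (f t \<theta>)\<^sup>2 + 2 * (h t \<theta>)\<^sup>2)"
    by (intro integral_le integrable_continuous_real continuous_intros cf ch sq)
  also have "\<dots> = integral {-\<delta>..\<delta>} (\<lambda>t. 2 * (f t \<theta>)\<^sup>2) + integral {-\<delta>..\<delta>} (\<lambda>t. 2 * (h t \<theta>)\<^sup>2)"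
    by (intro Henstock_Kurzweil_Integration.integral_add integrable_continuous_real continuous_intros cf ch)
  also have "\<dots> \<le> 2 * ((KA * \<beta> \<theta>)\<^sup>2 * (4 * \<epsilon> / \<beta> \<theta>)) + 2 * (E1 * m\<^sup>2 * \<epsilon>)"
    using fi hi by simp
  also have "\<dots> = 8 * KA\<^sup>2 * \<epsilon> * \<beta> \<theta> + 2 * E1 * \<epsilon> * m\<^sup>2" using b0 by (simp add: power2_eq_square)
  also have "\<dots> \<le> 8 * KA\<^sup>2 * \<epsilon> * \<beta> \<theta> + 2 * E1 * \<epsilon> * \<beta> \<theta>"
  proof -
    have "m\<^sup>2 \<le> \<beta> \<theta>" using m \<beta>_ge[of \<theta>] power_le_one[of m 2] by simp
    then have "2 * E1 * \<epsilon> * m\<^sup>2 \<le> 2 * E1 * \<epsilon> * \<beta> \<theta>" using KA_ge(3) \<epsilon> by (intro mult_left_mono) auto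
    then show ?thesis by simp
  qed
  finally show ?thesis by (simp add: algebra_simps)
qed

text \<open>With the exact slice integrals of the soliton inserted, the main terms and the error
  bound of the identity share the factor \<open>\<epsilon> * \<beta> ^ 3\<close>. Dividing by it
  leaves an estimate that is uniform in \<theta> however large \<beta> is.\<close>

lemma curvature_balance:
  assumes \<theta>: "\<theta> \<in> {0..L}" and \<delta>: "0 < \<delta>" "\<delta> \<le> 1" "\<delta> < M1" "C0 * \<delta> \<le> 1/2"
  shows "\<bar>3 / 2 * (\<epsilon>\<^sup>2 * pt Wf 0 \<theta> / (\<beta> \<theta>)\<^sup>2) + \<kappa> \<theta>\<bar> \<le> 63 * (CP \<delta>)\<^sup>2 / \<delta>\<^sup>2 * (\<epsilon> + m) + 5 * CP \<delta> * (\<epsilon> / \<delta>)"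
proof -
  let ?C = "CP \<delta>"
  have q0: "0 \<le> 1 / (2 * \<delta>) + 2" using \<delta> by simp
  have e0: "0 \<le> E1 * (1 / (2 * \<delta>) + 2)" using KA_ge(3) q0 by (rule mult_nonneg_nonneg)
  have e1: "E1 \<le> E1 * (1 / (2 * \<delta>) + 2)" using mult_left_mono[OF _ KA_ge(3), of 1 "1 / (2 * \<delta>) + 2"] \<delta> by simp
  have k0: "0 \<le> KA\<^sup>2" by simp
  note cp = CP_def[of \<delta>]
  have Cs: "1 \<le> ?C" "C0 \<le> ?C" "C \<le> ?C" "1 + C \<le> ?C" "8 * KA\<^sup>2 + 2 * E1 \<le> ?C" "8 * KA\<^sup>2 \<le> ?C" "E1 \<le> ?C"
    "E1 * (1 / (2 * \<delta>) + 2) \<le> ?C"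
    unfolding cp using C C0(1) k0 e0 e1 KA_ge(3) by linarith+
  have Cs': "4 * KA\<^sup>2 \<le> ?C" "KA\<^sup>2 \<le> ?C" "2 * KA\<^sup>2 \<le> ?C" using Cs(6) k0 by linarith+
  have b1: "1 \<le> \<beta> \<theta>" by (rule \<beta>_ge)
  have b0: "0 < \<beta> \<theta>" using b1 by linarith
  define S where "S = {-\<delta>..\<delta>}"
  have dM: "\<delta> \<le> 2 * M1" using \<delta> by linarith
  have tS: "\<bar>t\<bar> \<le> \<delta>" "\<bar>t\<bar> < M1" "\<bar>t\<bar> < 2 * M1" "\<bar>t\<bar> \<le> 2 * M1" "\<bar>t\<bar> \<le> 1" if "t \<in> S" for t
    using that \<delta> unfolding S_def by auto
  have \<kappa>\<delta>: "\<bar>\<kappa> \<theta>\<bar> * \<delta> \<le> 1/2" using mult_right_mono[OF C0(2), of \<delta> \<theta>] \<delta> by linarith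
  have f1: "(uf t \<theta> - ub t \<theta>) = \<phi> t \<theta>" for t by (simp add: \<phi>_def)
  have f2: "(pt uf t \<theta> - pt ub t \<theta>) = pt \<phi> t \<theta>" for t
    using pt_diff[OF ck_uf ck_ub] by (simp add: \<phi>_def[abs_def])
  have uth: "pth uf = (\<lambda>t \<theta>. pth ub t \<theta> + pth \<phi> t \<theta>)"
    using pth_diff[OF ck_uf ck_ub] by (simp add: \<phi>_def[abs_def])
  have uthth: "pth (pth uf) = (\<lambda>t \<theta>. pth (pth ub) t \<theta> + pth (pth \<phi>) t \<theta>)"
  proof -
    have "pth \<phi> = (\<lambda>t \<theta>. pth uf t \<theta> - pth ub t \<theta>)" using pth_diff[OF ck_uf ck_ub] by (simp add: \<phi>_def[abs_def])
    then show ?thesis using pth_diff[OF ck_pth[OF ck_uf] ck_pth[OF ck_ub]] by simp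
  qed
  have m2: "0 \<le> m\<^sup>2" by simp
  have bt: "\<bar>ub t \<theta>\<bar> \<le> KA * \<beta> \<theta> / (1 + (\<beta> \<theta> * t / \<epsilon>)\<^sup>2)"
    "\<bar>pt ub t \<theta>\<bar> \<le> KA * ((\<beta> \<theta>)\<^sup>2 / \<epsilon>) / (1 + (\<beta> \<theta> * t / \<epsilon>)\<^sup>2)" if "t \<in> S" for t
    using ub_pointwise(1,5)[OF tS(4)[OF that], of \<theta>] by simp_all
  have KAb: "0 \<le> KA * \<beta> \<theta>" "0 \<le> KA * ((\<beta> \<theta>)\<^sup>2 / \<epsilon>)" using KA_ge(1) b0 \<epsilon> by simp_all
  note maj0 = integral_lorentz_majorant[OF ck_cont_fst[OF ck_ub] \<delta>(1) b1 \<epsilon>(1) KAb(1) bt(1)[unfolded S_def], folded S_def]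
  note maj1 = integral_lorentz_majorant[OF ck_cont_fst[OF ck_pt[OF ck_ub]] \<delta>(1) b1 \<epsilon>(1) KAb(2) bt(2)[unfolded S_def], folded S_def]
  have I: "integral S (\<lambda>t. (pt ub t \<theta>)\<^sup>2) \<le> ?C * \<beta> \<theta> ^ 3 / \<epsilon>" "integral S (\<lambda>t. \<bar>t\<bar> * (pt ub t \<theta>)\<^sup>2) \<le> ?C * (\<beta> \<theta>)\<^sup>2"
    "integral S (\<lambda>t. (ub t \<theta>)\<^sup>2) \<le> ?C * \<epsilon> * \<beta> \<theta>" "integral S (\<lambda>t. \<bar>t\<bar> * (ub t \<theta>)\<^sup>2) \<le> ?C * \<epsilon>\<^sup>2"
  proof -
    have "(KA * ((\<beta> \<theta>)\<^sup>2 / \<epsilon>))\<^sup>2 * (4 * \<epsilon> / \<beta> \<theta>) = 4 * KA\<^sup>2 * (\<beta> \<theta> ^ 3 / \<epsilon>)"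
      using b0 \<epsilon> by (simp add: power2_eq_square power3_eq_cube)
    also have "\<dots> \<le> ?C * (\<beta> \<theta> ^ 3 / \<epsilon>)" using Cs' b0 \<epsilon> by (intro mult_right_mono) auto
    finally show "integral S (\<lambda>t. (pt ub t \<theta>)\<^sup>2) \<le> ?C * \<beta> \<theta> ^ 3 / \<epsilon>" using maj1(1) by simp
    have "(KA * ((\<beta> \<theta>)\<^sup>2 / \<epsilon>))\<^sup>2 * (\<epsilon>\<^sup>2 / (\<beta> \<theta>)\<^sup>2) = KA\<^sup>2 * (\<beta> \<theta>)\<^sup>2"
      using b0 \<epsilon> by (simp add: power2_eq_square)
    also have "\<dots> \<le> ?C * (\<beta> \<theta>)\<^sup>2" using Cs' by (intro mult_right_mono) auto
    finally show "integral S (\<lambda>t. \<bar>t\<bar> * (pt ub t \<theta>)\<^sup>2) \<le> ?C * (\<beta> \<theta>)\<^sup>2" using maj1(2) by simp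
    have "(KA * \<beta> \<theta>)\<^sup>2 * (4 * \<epsilon> / \<beta> \<theta>) = 4 * KA\<^sup>2 * (\<epsilon> * \<beta> \<theta>)"
      using b0 by (simp add: power2_eq_square)
    also have "\<dots> \<le> ?C * (\<epsilon> * \<beta> \<theta>)" using Cs' b0 \<epsilon> by (intro mult_right_mono) auto
    finally show "integral S (\<lambda>t. (ub t \<theta>)\<^sup>2) \<le> ?C * \<epsilon> * \<beta> \<theta>" using maj0(1) by simp
    have "(KA * \<beta> \<theta>)\<^sup>2 * (\<epsilon>\<^sup>2 / (\<beta> \<theta>)\<^sup>2) = KA\<^sup>2 * \<epsilon>\<^sup>2" using b0 by (simp add: power2_eq_square)
    also have "\<dots> \<le> ?C * \<epsilon>\<^sup>2" using Cs' by (intro mult_right_mono) auto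
    finally show "integral S (\<lambda>t. \<bar>t\<bar> * (ub t \<theta>)\<^sup>2) \<le> ?C * \<epsilon>\<^sup>2" using maj0(2) by simp
  qed
  have I4: "integral S (\<lambda>t. \<bar>t\<bar> * ub t \<theta> ^ 4) \<le> ?C * (\<beta> \<theta>)\<^sup>2 * \<epsilon>\<^sup>2"
  proof -
    have "integral S (\<lambda>t. \<bar>t\<bar> * ub t \<theta> ^ 4) \<le> integral S (\<lambda>t. 2 * (\<beta> \<theta>)\<^sup>2 * (\<bar>t\<bar> * (ub t \<theta>)\<^sup>2))"
    proof (rule integral_le)
      fix t assume t: "t \<in> S"
      \<comment> \<open>The squared profile is at most 2, so the quartic integral reduces to the
        quadratic one at the cost of \<open>2 * \<beta>\<^sup>2\<close>.\<close>
      have "(ub t \<theta>)\<^sup>2 \<le> (\<beta> \<theta>)\<^sup>2 * 2"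
        unfolding ub_core(1)[OF tS(2)[OF t]] power_mult_distrib
        by (rule mult_left_mono[OF soliton_bounds(5) zero_le_power2])
      from mult_right_mono[OF this, of "\<bar>t\<bar> * (ub t \<theta>)\<^sup>2"]
      show "\<bar>t\<bar> * ub t \<theta> ^ 4 \<le> 2 * (\<beta> \<theta>)\<^sup>2 * (\<bar>t\<bar> * (ub t \<theta>)\<^sup>2)"
        by (simp add: power2_eq_square power4_eq_xxxx mult_ac)
    qed (unfold S_def, (intro integrable_continuous_real continuous_intros ck_cont_fst[OF ck_ub])+)
    also have "\<dots> = 2 * (\<beta> \<theta>)\<^sup>2 * integral S (\<lambda>t. \<bar>t\<bar> * (ub t \<theta>)\<^sup>2)"
      by (rule Henstock_Kurzweil_Integration.integral_mult_right)
    also have "\<dots> \<le> 2 * (\<beta> \<theta>)\<^sup>2 * (KA\<^sup>2 * \<epsilon>\<^sup>2)"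
      using maj0(2) b0 by (intro mult_left_mono) (simp_all add: power2_eq_square)
    also have "\<dots> = 2 * KA\<^sup>2 * ((\<beta> \<theta>)\<^sup>2 * \<epsilon>\<^sup>2)" by simp
    also have "\<dots> \<le> ?C * ((\<beta> \<theta>)\<^sup>2 * \<epsilon>\<^sup>2)" using Cs' by (intro mult_right_mono) auto
    finally show ?thesis by simp
  qed
  have If: "integral S (\<lambda>t. (uf t \<theta> - ub t \<theta>)\<^sup>2) \<le> ?C * m\<^sup>2 * \<epsilon>"
    "integral S (\<lambda>t. (pt uf t \<theta> - pt ub t \<theta>)\<^sup>2) \<le> ?C * m\<^sup>2 / \<epsilon>"
  proof -
    have "E1 * m\<^sup>2 * \<epsilon> \<le> ?C * m\<^sup>2 * \<epsilon>" "E1 * m\<^sup>2 / \<epsilon> \<le> ?C * m\<^sup>2 / \<epsilon>"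
      using Cs(7) \<epsilon> by (simp_all add: mult_right_mono divide_right_mono)
    then show "integral S (\<lambda>t. (uf t \<theta> - ub t \<theta>)\<^sup>2) \<le> ?C * m\<^sup>2 * \<epsilon>"
      "integral S (\<lambda>t. (pt uf t \<theta> - pt ub t \<theta>)\<^sup>2) \<le> ?C * m\<^sup>2 / \<epsilon>"
      using slice_error(1,4)[OF \<theta> dM] unfolding f1 f2 S_def by linarith+
  qed
  have Ipq: "integral S (\<lambda>t. (pth uf t \<theta>)\<^sup>2) \<le> ?C * \<epsilon> * \<beta> \<theta>" "integral S (\<lambda>t. (pth (pth uf) t \<theta>)\<^sup>2) \<le> ?C * \<epsilon> * \<beta> \<theta>"
  proof -
    have up: "(8 * KA\<^sup>2 + 2 * E1) * \<epsilon> * \<beta> \<theta> \<le> ?C * \<epsilon> * \<beta> \<theta>"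
      using Cs(5) \<epsilon> b0 by (intro mult_right_mono) auto
    show "integral S (\<lambda>t. (pth uf t \<theta>)\<^sup>2) \<le> ?C * \<epsilon> * \<beta> \<theta>"
      using square_sum_slice[OF ck_pth[OF ck_ub] ck_pth[OF ck_\<phi>] \<delta>(1) dM ub_pointwise(2) slice_error(2)[OF \<theta> dM]] up
      unfolding uth S_def by linarith
    show "integral S (\<lambda>t. (pth (pth uf) t \<theta>)\<^sup>2) \<le> ?C * \<epsilon> * \<beta> \<theta>"
      using square_sum_slice[OF ck_pth[OF ck_pth[OF ck_ub]] ck_pth[OF ck_pth[OF ck_\<phi>]] \<delta>(1) dM ub_pointwise(3) slice_error(3)[OF \<theta> dM]] up
      unfolding uthth S_def by linarith
  qed
  have bd: "c * (\<beta> \<theta>)\<^sup>2 * y \<le> ?C * (\<beta> \<theta>)\<^sup>2 * y" if "c \<le> ?C" "0 \<le> y" for c y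
    using that by (intro mult_right_mono) auto
  have P: "\<bar>\<delta>\<^sup>2 * (\<kappa> \<theta> * \<epsilon>\<^sup>2 * integral S (\<lambda>t. (pt ub t \<theta>)\<^sup>2) + \<epsilon>\<^sup>2 * pt Wf 0 \<theta> / 2 * integral S (\<lambda>t. (ub t \<theta>)\<^sup>2))\<bar>
     \<le> 83 * ?C\<^sup>2 * (\<epsilon> * \<beta> \<theta> ^ 3 * (\<epsilon> + m))"
  proof (rule pohozaev_interval[where v="\<lambda>t. uf t \<theta>" and v'="\<lambda>t. pt uf t \<theta>" and v''="\<lambda>t. pt (pt uf) t \<theta>"
        and p="\<lambda>t. pth uf t \<theta>" and q="\<lambda>t. pth (pth uf) t \<theta>" and V="\<lambda>t. 1 + \<epsilon>\<^sup>2 * Wf t \<theta>" and V'="\<lambda>t. \<epsilon>\<^sup>2 * pt Wf t \<theta>"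
        and b="\<lambda>t. ub t \<theta>" and b'="\<lambda>t. pt ub t \<theta>" and \<kappa>'="deriv \<kappa> \<theta>" and \<delta>=\<delta>, folded S_def])
    show "0 < \<epsilon>" "\<epsilon> \<le> 1" "1 \<le> \<beta> \<theta>" "0 < \<delta>" "\<delta> \<le> 1" "1 \<le> ?C" "0 < m" "m \<le> 1" "\<bar>\<kappa> \<theta>\<bar> * \<delta> \<le> 1/2"
      by (fact \<epsilon> b1 \<delta> Cs m \<kappa>\<delta>)+
    show "\<bar>\<kappa> \<theta>\<bar> \<le> ?C" "\<bar>deriv \<kappa> \<theta>\<bar> \<le> ?C" by (rule order.trans[OF _ Cs(2)], rule C0)+
    show "((\<lambda>t. uf t \<theta>) has_real_derivative pt uf t \<theta>) (at t)" for t by (rule ck_pt_deriv[OF ck_uf])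
    show "((\<lambda>t. pt uf t \<theta>) has_real_derivative pt (pt uf) t \<theta>) (at t)" for t by (rule ck_pt_deriv[OF ck_pt[OF ck_uf]])
    show "((\<lambda>t. 1 + \<epsilon>\<^sup>2 * Wf t \<theta>) has_real_derivative \<epsilon>\<^sup>2 * pt Wf t \<theta>) (at t)" for t
      using DERIV_add[OF DERIV_const DERIV_cmult[OF ck_pt_deriv[OF ck_Wf]]] by simp
    show "continuous_on S (\<lambda>t. pt (pt uf) t \<theta>)" "continuous_on S (\<lambda>t. \<epsilon>\<^sup>2 * pt Wf t \<theta>)"
      "continuous_on S (\<lambda>t. pth uf t \<theta>)" "continuous_on S (\<lambda>t. pth (pth uf) t \<theta>)"
      "continuous_on S (\<lambda>t. ub t \<theta>)" "continuous_on S (\<lambda>t. pt ub t \<theta>)"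
      by (intro continuous_intros ck_cont_fst[where k=0] ck_pt ck_pth ck_uf ck_Wf ck_ub)+
    show "- \<epsilon>\<^sup>2 * (pt (pt uf) t \<theta> + \<kappa> \<theta> / (1 + \<kappa> \<theta> * t) * pt uf t \<theta> + pth (pth uf) t \<theta> / (1 + \<kappa> \<theta> * t)\<^sup>2
        - t * deriv \<kappa> \<theta> * pth uf t \<theta> / (1 + \<kappa> \<theta> * t) ^ 3) + (1 + \<epsilon>\<^sup>2 * Wf t \<theta>) * uf t \<theta> - uf t \<theta> ^ 3 = 0"
      if "t \<in> S" for t
      using curvature_weight(1)[OF tS(1)[OF that] \<delta>(2) C0(2) \<delta>(4), of \<theta>] by (intro uf_eq) linarith
    show "\<bar>1 + \<epsilon>\<^sup>2 * Wf t \<theta>\<bar> \<le> ?C * (\<beta> \<theta>)\<^sup>2" if "t \<in> S" for t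
      using potential_bounds(3)[OF tS(3,5)[OF that], of \<theta>] bd[OF Cs(4), of 1] by simp
    show "\<bar>\<epsilon>\<^sup>2 * pt Wf 0 \<theta>\<bar> \<le> ?C * (\<beta> \<theta>)\<^sup>2"
      using potential_bounds(1)[of 0 \<theta>] M1 bd[OF Cs(3), of 1] by simp
    show "\<bar>\<epsilon>\<^sup>2 * pt Wf t \<theta> - \<epsilon>\<^sup>2 * pt Wf 0 \<theta>\<bar> \<le> ?C * (\<beta> \<theta>)\<^sup>2 * \<bar>t\<bar>" if "t \<in> S" for t
      by (rule order.trans[OF potential_bounds(2)[OF tS(3,5)[OF that]] bd[OF Cs(3)]]) simp
    show "(uf t \<theta> - ub t \<theta>)\<^sup>2 \<le> ?C * m\<^sup>2" if "t \<in> S" for t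
      unfolding f1
      by (rule order.trans[OF sup_error[OF \<theta> \<delta>(1) dM that[unfolded S_def]] mult_right_mono[OF Cs(8) m2]])
  qed (fact I I4 If Ipq)+
  define T where "T = tanh (\<beta> \<theta> / \<epsilon> * \<delta>)"
  define G where "G = \<epsilon>\<^sup>2 * pt Wf 0 \<theta> / (\<beta> \<theta>)\<^sup>2"
  have G: "\<bar>G\<bar> \<le> ?C"
  proof -
    have "\<bar>\<epsilon>\<^sup>2 * pt Wf 0 \<theta>\<bar> \<le> ?C * (\<beta> \<theta>)\<^sup>2"
      using potential_bounds(1)[of 0 \<theta>] M1 bd[OF Cs(3), of 1] by simp
    then show ?thesis unfolding G_def using b0 by (simp add: abs_divide divide_le_eq)
  qed
  have Geq: "\<epsilon>\<^sup>2 * pt Wf 0 \<theta> = G * (\<beta> \<theta>)\<^sup>2" unfolding G_def using b0 by simp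
  \<comment> \<open>Pulling out 4/3 leaves the coefficient (4 / 2) / (4 / 3) = 3/2 in front of
    \<open>G\<close>, the constant of the claim.\<close>
  have M: "\<delta>\<^sup>2 * (\<kappa> \<theta> * \<epsilon>\<^sup>2 * (4 / 3 * \<beta> \<theta> ^ 3 / \<epsilon> * T ^ 3) + \<epsilon>\<^sup>2 * pt Wf 0 \<theta> / 2 * (4 * \<epsilon> * \<beta> \<theta> * T))
     = (\<kappa> \<theta> * T ^ 3 + 3 / 2 * G * T) * (4 / 3 * \<delta>\<^sup>2 * (\<epsilon> * \<beta> \<theta> ^ 3))"
    unfolding Geq using \<epsilon> by (simp add: power2_eq_square power3_eq_cube algebra_simps)
  have Y: "0 \<le> 4 / 3 * \<delta>\<^sup>2 * (\<epsilon> * \<beta> \<theta> ^ 3)" using \<epsilon> b0 by simp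
  have "\<bar>\<kappa> \<theta> * T ^ 3 + 3 / 2 * G * T\<bar> * (4 / 3 * \<delta>\<^sup>2 * (\<epsilon> * \<beta> \<theta> ^ 3)) \<le> 83 * ?C\<^sup>2 * (\<epsilon> * \<beta> \<theta> ^ 3 * (\<epsilon> + m))"
    using P unfolding S_def ub_slices[OF \<delta>(1,3)] T_def[symmetric] M
      abs_mult[of "\<kappa> \<theta> * T ^ 3 + 3 / 2 * G * T"] abs_of_nonneg[OF Y] .
  then have "\<bar>\<kappa> \<theta> * T ^ 3 + 3 / 2 * G * T\<bar> * (4 / 3 * \<delta>\<^sup>2) * (\<epsilon> * \<beta> \<theta> ^ 3) \<le> (83 * ?C\<^sup>2 * (\<epsilon> + m)) * (\<epsilon> * \<beta> \<theta> ^ 3)"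
    by (simp add: mult_ac)
  then have "\<bar>\<kappa> \<theta> * T ^ 3 + 3 / 2 * G * T\<bar> * (4 / 3 * \<delta>\<^sup>2) \<le> 83 * ?C\<^sup>2 * (\<epsilon> + m)"
    using \<epsilon> b0 by (simp only: mult_le_cancel_right_pos mult_pos_pos zero_less_power)
  then have "\<bar>\<kappa> \<theta> * T ^ 3 + 3 / 2 * G * T\<bar> \<le> 83 * ?C\<^sup>2 * (\<epsilon> + m) / (4 / 3 * \<delta>\<^sup>2)"
    using \<delta>(1) by (subst pos_le_divide_eq) auto
  also have "\<dots> \<le> 63 * ?C\<^sup>2 / \<delta>\<^sup>2 * (\<epsilon> + m)"
  proof -
    \<comment> \<open>Division by 4/3 turns 83 into 62.25, rounded up to 63.\<close>
    have "83 * ?C\<^sup>2 * (\<epsilon> + m) / (4 / 3 * \<delta>\<^sup>2) = 249 / 4 * (?C\<^sup>2 / \<delta>\<^sup>2 * (\<epsilon> + m))" by simp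
    also have "\<dots> \<le> 63 * (?C\<^sup>2 / \<delta>\<^sup>2 * (\<epsilon> + m))" using \<epsilon> m by (intro mult_right_mono) auto
    finally show ?thesis by simp
  qed
  finally have A: "\<bar>\<kappa> \<theta> * T ^ 3 + 3 / 2 * G * T\<bar> \<le> 63 * ?C\<^sup>2 / \<delta>\<^sup>2 * (\<epsilon> + m)" .
  note Tb = tanh_core[OF \<delta>(1), of \<theta>, folded T_def]
  have B1: "\<bar>\<kappa> \<theta> * (1 - T ^ 3)\<bar> \<le> ?C * (3 * (\<epsilon> / \<delta>))"
    unfolding abs_mult using Tb(4) Cs(1) order.trans[OF C0(2)[of \<theta>] Cs(2)] by (intro mult_mono) auto
  have B2: "\<bar>G * (1 - T)\<bar> \<le> ?C * (\<epsilon> / \<delta>)"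
    unfolding abs_mult using Tb(2,3) Cs(1) G by (intro mult_mono) auto
  have tri: "\<bar>x + y + 3 / 2 * z\<bar> \<le> \<bar>x\<bar> + \<bar>y\<bar> + 3 / 2 * \<bar>z\<bar>" for x y z :: real by linarith
  \<comment> \<open>Replacing the tanh factors by 1 costs 3 from the cubed one and 3/2 from the
    other, in multiples of \<open>?C * (\<epsilon> / \<delta>)\<close>; 5 covers the sum.\<close>
  have dec: "3 / 2 * G + \<kappa> \<theta> = (\<kappa> \<theta> * T ^ 3 + 3 / 2 * G * T) + \<kappa> \<theta> * (1 - T ^ 3) + 3 / 2 * (G * (1 - T))"
    by (simp add: field_simps)
  note fin = tri[of "\<kappa> \<theta> * T ^ 3 + 3 / 2 * G * T" "\<kappa> \<theta> * (1 - T ^ 3)" "G * (1 - T)", folded dec]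
  have "0 \<le> ?C * (\<epsilon> / \<delta>)" using Cs(1) \<epsilon> \<delta> by simp
  then have "\<bar>3 / 2 * G + \<kappa> \<theta>\<bar> \<le> 63 * ?C\<^sup>2 / \<delta>\<^sup>2 * (\<epsilon> + m) + 5 * (?C * (\<epsilon> / \<delta>))"
    using fin A B1 B2 by argo
  then show ?thesis unfolding G_def by simp
qed

text \<open>On each slice the soliton has mass at least \<open>2 * \<epsilon>\<close>, because
  \<beta> \<ge> 1 and tanh is at least 1/2 there. The error is too small to remove more than half of
  this after squaring, so the solution keeps \<open>\<epsilon> / 2\<close>. Integrating over the
  length and halving for the Jacobian gives \<open>L0 * \<epsilon> / 4\<close>.\<close>

lemma mass_ge:
  assumes \<delta>: "0 < \<delta>" "\<delta> \<le> 1" "\<delta> < M1" "C0 * \<delta> \<le> 1/2" "2 * \<epsilon> \<le> \<delta>" and small: "E1 * m\<^sup>2 \<le> 1/2"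
    and int: "integrable lborel (\<lambda>y. (u y)\<^sup>2)"
    and inj: "inj_on (\<lambda>(t, \<theta>). fermi g t \<theta>) ({-\<delta><..<\<delta>} \<times> {0..<L})"
  shows "L0 * \<epsilon> / 4 \<le> (\<integral>y. (u y)\<^sup>2 \<partial>lborel)"
proof -
  have dM: "\<delta> \<le> 2 * M1" using \<delta> by linarith
  have slice: "\<epsilon> / 2 \<le> integral {-\<delta>..\<delta>} (\<lambda>t. (uf t \<theta>)\<^sup>2)" if \<theta>: "\<theta> \<in> {0..L}" for \<theta>
  proof -
    have T: "1/2 \<le> tanh (\<beta> \<theta> / \<epsilon> * \<delta>)"
    proof -
      have "\<epsilon> / \<delta> \<le> 1/2" using \<delta> by (simp add: divide_le_eq)
      then show ?thesis using tanh_core(3)[OF \<delta>(1), of \<theta>] by linarith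
    qed
    have "2 * \<epsilon> = 4 * \<epsilon> * 1 * (1/2)" by simp
    also have "\<dots> \<le> 4 * \<epsilon> * \<beta> \<theta> * tanh (\<beta> \<theta> / \<epsilon> * \<delta>)"
      using T \<beta>_ge[of \<theta>] \<epsilon> by (intro mult_mono) auto
    also have "\<dots> = integral {-\<delta>..\<delta>} (\<lambda>t. (ub t \<theta>)\<^sup>2)" using ub_slices(1)[OF \<delta>(1,3)] by simp
    also have "\<dots> \<le> integral {-\<delta>..\<delta>} (\<lambda>t. 2 * (uf t \<theta>)\<^sup>2 + 2 * (\<phi> t \<theta>)\<^sup>2)"
    proof (rule integral_le)
      show "(ub t \<theta>)\<^sup>2 \<le> 2 * (uf t \<theta>)\<^sup>2 + 2 * (\<phi> t \<theta>)\<^sup>2" for t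
        using sq_le_twice[of "ub t \<theta>" "uf t \<theta>"] power2_commute[of "ub t \<theta>" "uf t \<theta>"] by (simp add: \<phi>_def)
    qed (intro integrable_continuous_real continuous_intros ck_cont_fst[where k=0] ck_uf ck_ub ck_\<phi>)+
    also have "\<dots> = integral {-\<delta>..\<delta>} (\<lambda>t. 2 * (uf t \<theta>)\<^sup>2) + integral {-\<delta>..\<delta>} (\<lambda>t. 2 * (\<phi> t \<theta>)\<^sup>2)"
      by (intro Henstock_Kurzweil_Integration.integral_add integrable_continuous_real continuous_intros
          ck_cont_fst[where k=0] ck_uf ck_\<phi>)
    also have "\<dots> = 2 * integral {-\<delta>..\<delta>} (\<lambda>t. (uf t \<theta>)\<^sup>2) + 2 * integral {-\<delta>..\<delta>} (\<lambda>t. (\<phi> t \<theta>)\<^sup>2)" by simp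
    finally have "2 * \<epsilon> \<le> 2 * integral {-\<delta>..\<delta>} (\<lambda>t. (uf t \<theta>)\<^sup>2) + 2 * (E1 * m\<^sup>2 * \<epsilon>)"
      using slice_error(1)[OF \<theta> dM] by linarith
    moreover have "E1 * m\<^sup>2 * \<epsilon> \<le> 1/2 * \<epsilon>" using small \<epsilon> by (intro mult_right_mono) auto
    ultimately show ?thesis by argo
  qed
  have uc: "continuous_on UNIV (\<lambda>(t, \<theta>). uf t \<theta>)" by (rule ck_cont[OF ck_uf])
  have "L0 * \<epsilon> / 2 \<le> L * (\<epsilon> / 2)" using L \<epsilon> by (simp add: mult_right_mono)
  also have "\<dots> = integral {0..L} (\<lambda>\<theta>. \<epsilon> / 2)" using L by simp
  also have "\<dots> \<le> integral {0..L} (\<lambda>\<theta>. integral {-\<delta>..\<delta>} (\<lambda>t. (uf t \<theta>)\<^sup>2))"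
    by (intro integral_le integrable_continuous_real continuous_intros continuous_on_param_integral[OF uc] slice)
  also have "\<dots> = (tubeL2 \<delta> L uf)\<^sup>2" by (rule tubeL2_square(2)[OF uc, symmetric])
  also have "\<dots> \<le> 2 * (\<integral>y. (u y)\<^sup>2 \<partial>lborel)"
    unfolding uf_def[abs_def] by (rule tube_mass_le[OF smooth2_cont[OF u] int \<delta>(2) C0(2) \<delta>(4) inj])
  finally show ?thesis by simp
qed

end

section \<open>Uniform constants and passage to the limit\<close>

theorem theorem2p2:
  fixes W :: "complex \<Rightarrow> real"
    and U :: "real \<Rightarrow> real"
    and \<epsilon> a L :: "nat \<Rightarrow> real"
    and \<gamma> :: "nat \<Rightarrow> real \<Rightarrow> complex"
    and u :: "nat \<Rightarrow> complex \<Rightarrow> real"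
    and cut :: "real \<Rightarrow> real"
    and M0 M1 \<rho> :: real
  assumes W_smooth: "smooth2 W" and W_pos: "\<And>y. W y > 0"
    \<comment> \<open>the profile U\<close>
    and U_diff: "\<And>x. U differentiable (at x)" "\<And>x. deriv U differentiable (at x)"
    and U_ode: "\<And>x. deriv (deriv U) x - U x + U x ^ 3 = 0"
    and U_pos: "\<And>x. U x > 0" and U_d0: "deriv U 0 = 0"
    and U_top: "(U \<longlongrightarrow> 0) at_top" and U_bot: "(U \<longlongrightarrow> 0) at_bot"
    \<comment> \<open>the parameters\<close>
    and eps_pos: "\<And>n. \<epsilon> n > 0" and eps_lim: "\<epsilon> \<longlonglongrightarrow> 0"
    and a_pos: "\<And>n. a n > 0"
    \<comment> \<open>the curves\<close>
    and l_pos: "\<And>n. L n > 0"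
    and gam_smooth: "\<And>n. smooth_curve (\<gamma> n)"
    and gam_periodic: "\<And>n \<theta>. \<gamma> n (\<theta> + L n) = \<gamma> n \<theta>"
    and gam_simple: "\<And>n. inj_on (\<gamma> n) {0..<L n}"
    and gam_arclength: "\<And>n \<theta>. norm (vd (\<gamma> n) \<theta>) = 1"
    and gam_positive: "\<And>n. \<exists>z. z \<notin> \<gamma> n ` {0..L n} \<and>
                           winding_number (\<lambda>s. \<gamma> n (L n * s)) z = 1"
    \<comment> \<open>the solutions\<close>
    and u_smooth: "\<And>n. smooth2 (u n)"
    and u_eq: "\<And>n y. - (\<epsilon> n)\<^sup>2 * laplacian (u n) y + (1 + (\<epsilon> n)\<^sup>2 * W y) * u n y
                      - \<bar>u n y\<bar>\<^sup>2 * u n y = 0"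
    and u_L2: "\<And>n. integrable lborel (\<lambda>y. (u n y)\<^sup>2)"
    and u_mass: "\<And>n. integral\<^sup>L lborel (\<lambda>y. (u n y)\<^sup>2) = a n * (\<epsilon> n)\<^sup>2"
    \<comment> \<open>(A1)\<close>
    and A1_curv: "\<exists>C0. \<forall>n \<theta>. \<bar>curv (\<gamma> n) \<theta>\<bar> \<le> C0 \<and> \<bar>deriv (curv (\<gamma> n)) \<theta>\<bar> \<le> C0"
    and M0_pos: "M0 > 0"
    and A1_fermi: "\<And>n. inj_on (\<lambda>(t, \<theta>). fermi (\<gamma> n) t \<theta>) ({-M0<..<M0} \<times> {0..<L n})"
    \<comment> \<open>(A2)\<close>
    and A2: "\<exists>C>0. 
       (\<forall>n. integral {0..L n} (\<lambda>\<theta>. 1 + (\<epsilon> n)\<^sup>2 * W (fermi (\<gamma> n) 0 \<theta>)) \<le> C * \<epsilon> n powr (\<rho> - 1))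
     \<and> (\<forall>n \<theta> t. \<bar>t\<bar> < M0 \<longrightarrow>
          (let Wf = (\<lambda>t \<theta>. W (fermi (\<gamma> n) t \<theta>)); B = 1 + (\<epsilon> n)\<^sup>2 * Wf 0 \<theta> in
             (\<epsilon> n)\<^sup>2 * \<bar>pt Wf t \<theta>\<bar> \<le> C * B \<and> (\<epsilon> n)\<^sup>2 * \<bar>pt (pt Wf) t \<theta>\<bar> \<le> C * B))
     \<and> (\<forall>n \<theta>.
          (let Wf = (\<lambda>t \<theta>. W (fermi (\<gamma> n) t \<theta>)); B = 1 + (\<epsilon> n)\<^sup>2 * Wf 0 \<theta> in
             (\<forall>D \<in> {pth, pth \<circ> pth, pth \<circ> pth \<circ> pth, pth \<circ> pt, pth \<circ> pt \<circ> pt, pth \<circ> pth \<circ> pt}.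
                (\<epsilon> n)\<^sup>2 * \<bar>D Wf 0 \<theta>\<bar> \<le> C * B)))"
    and rho: "0 < \<rho>" "\<rho> < 1"
    \<comment> \<open>(C)\<close>
    and C_cutoff: "smooth1 cut" "0 < M1" "2 * M1 < M0"
      "\<And>t. \<bar>t\<bar> < M1 \<Longrightarrow> cut t = 1" "\<And>t. \<bar>t\<bar> > 2 * M1 \<Longrightarrow> cut t = 0"
    and C_conc: "\<exists>K. \<forall>\<^sub>F n in sequentially.
       (let \<beta> = (\<lambda>\<theta>. sqrt (1 + (\<epsilon> n)\<^sup>2 * W (fermi (\<gamma> n) 0 \<theta>)));
            ub = (\<lambda>t \<theta>. cut t * \<beta> \<theta> * U (\<beta> \<theta> * t / \<epsilon> n));
            \<phi> = (\<lambda>t \<theta>. u n (fermi (\<gamma> n) t \<theta>) - ub t \<theta>);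
            I5 = integral {0..L n} (\<lambda>\<theta>. \<beta> \<theta> ^ 5) in
        \<forall>D \<in> {id, pt, pth, pt \<circ> pth, pth \<circ> pth, pth \<circ> pth \<circ> pth}.
          tubeL2 (2 * M1) (L n) (D \<phi>) \<le> K * \<epsilon> n powr \<rho> / I5 * tubeL2 (2 * M1) (L n) (D ub))"
  shows "(\<exists>L0>0. \<forall>n. L n \<ge> L0)
       \<and> filterlim a at_top sequentially
       \<and> (\<forall>e>0. \<forall>\<^sub>F n in sequentially. \<forall>\<theta>\<in>{0..<L n}.
            \<bar>3 * (\<epsilon> n)\<^sup>2 * pt (\<lambda>t \<theta>. W (fermi (\<gamma> n) t \<theta>)) 0 \<theta>
               / (2 * (1 + (\<epsilon> n)\<^sup>2 * W (fermi (\<gamma> n) 0 \<theta>))) + curv (\<gamma> n) \<theta>\<bar> < e)"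
proof -
  have U_sol: "U = soliton"
    using soliton_explicit[OF U_diff U_ode U_pos U_d0 U_top] by (auto simp: soliton_def)
  obtain C0' where C0': "\<And>n \<theta>. \<bar>curv (\<gamma> n) \<theta>\<bar> \<le> C0'" "\<And>n \<theta>. \<bar>deriv (curv (\<gamma> n)) \<theta>\<bar> \<le> C0'"
    using A1_curv by blast
  \<comment> \<open>Raising the bound to at least 1 makes \<open>1 / C0\<close> a positive lower
    bound for all lengths.\<close>
  define C0 where "C0 = max 1 C0'"
  have C0: "1 \<le> C0" "\<And>n \<theta>. \<bar>curv (\<gamma> n) \<theta>\<bar> \<le> C0" "\<And>n \<theta>. \<bar>deriv (curv (\<gamma> n)) \<theta>\<bar> \<le> C0"
    unfolding C0_def using C0' by (auto simp: le_max_iff_disj)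
  have arc: "arclength_curve (\<gamma> n)" for n
    by (unfold_locales) (rule gam_smooth gam_arclength)+
  define L0 where "L0 = 1 / C0"
  have L0: "0 < L0" "L0 \<le> L n" for n
  proof -
    have "1 \<le> C0 * L n"
      by (rule arclength_curve.closed_curve_length[OF arc l_pos])
        (use gam_periodic[of n 0] C0(2) in simp_all)
    then show "0 < L0" "L0 \<le> L n" unfolding L0_def using C0(1) by (simp_all add: divide_le_eq mult.commute)
  qed
  have part1: "\<exists>L0>0. \<forall>n. L n \<ge> L0" using L0 by blast

  let ?Wf = "\<lambda>n t \<theta>. W (fermi (\<gamma> n) t \<theta>)"
  obtain C' where C': "\<And>n \<theta> t. \<bar>t\<bar> < M0 \<Longrightarrow> (\<epsilon> n)\<^sup>2 * \<bar>pt (?Wf n) t \<theta>\<bar> \<le> C' * (1 + (\<epsilon> n)\<^sup>2 * ?Wf n 0 \<theta>)"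
      "\<And>n \<theta> t. \<bar>t\<bar> < M0 \<Longrightarrow> (\<epsilon> n)\<^sup>2 * \<bar>pt (pt (?Wf n)) t \<theta>\<bar> \<le> C' * (1 + (\<epsilon> n)\<^sup>2 * ?Wf n 0 \<theta>)"
      "\<And>n \<theta>. (\<epsilon> n)\<^sup>2 * \<bar>pth (?Wf n) 0 \<theta>\<bar> \<le> C' * (1 + (\<epsilon> n)\<^sup>2 * ?Wf n 0 \<theta>)"
      "\<And>n \<theta>. (\<epsilon> n)\<^sup>2 * \<bar>pth (pth (?Wf n)) 0 \<theta>\<bar> \<le> C' * (1 + (\<epsilon> n)\<^sup>2 * ?Wf n 0 \<theta>)"
      "\<And>n \<theta>. (\<epsilon> n)\<^sup>2 * \<bar>pth (pth (pth (?Wf n))) 0 \<theta>\<bar> \<le> C' * (1 + (\<epsilon> n)\<^sup>2 * ?Wf n 0 \<theta>)"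
    using A2 unfolding Let_def ball_simps comp_apply by blast
  define C where "C = max 1 C'"
  have C1: "1 \<le> C" unfolding C_def by simp
  have Bpos: "0 \<le> 1 + (\<epsilon> n)\<^sup>2 * ?Wf n 0 \<theta>" for n \<theta>
    using W_pos[THEN less_imp_le] by (simp add: add_nonneg_nonneg)
  have up: "y \<le> C * (1 + (\<epsilon> n)\<^sup>2 * ?Wf n 0 \<theta>)" if "y \<le> C' * (1 + (\<epsilon> n)\<^sup>2 * ?Wf n 0 \<theta>)" for y n \<theta>
    using that mult_right_mono[OF _ Bpos, of C' C n \<theta>] unfolding C_def by simp

  obtain X where X: "1 \<le> X" "\<And>t. \<bar>t\<bar> \<le> 2 * M1 \<Longrightarrow> \<bar>cut t\<bar> \<le> X" "\<And>t. \<bar>t\<bar> \<le> 2 * M1 \<Longrightarrow> \<bar>deriv cut t\<bar> \<le> X"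
  proof -
    have "continuous_on {-2 * M1..2 * M1} ((deriv ^^ k) cut)" for k
      using C_cutoff(1) unfolding smooth1_def
      by (meson continuous_at_imp_continuous_on differentiable_imp_continuous_within)
    from compact_imp_bounded[OF compact_continuous_image[OF this compact_Icc]]
    have "\<exists>B. \<forall>t\<in>{-2 * M1..2 * M1}. \<bar>(deriv ^^ k) cut t\<bar> \<le> B" for k
      by (fastforce simp: bounded_iff)
    then obtain B where B: "\<And>k t. t \<in> {-2 * M1..2 * M1} \<Longrightarrow> \<bar>(deriv ^^ k) cut t\<bar> \<le> B k" by metis
    have "\<bar>cut t\<bar> \<le> B 0" "\<bar>deriv cut t\<bar> \<le> B 1" if "\<bar>t\<bar> \<le> 2 * M1" for t
      using B[of t 0] B[of t 1] that by (auto simp: abs_le_iff)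
    then show ?thesis by (intro that[of "max 1 (max (B 0) (B 1))"]) (auto simp: le_max_iff_disj)
  qed

  let ?ub = "\<lambda>n. ansatz cut (\<lambda>\<theta>. sqrt (1 + (\<epsilon> n)\<^sup>2 * W (fermi (\<gamma> n) 0 \<theta>))) (\<epsilon> n)"
  let ?\<phi> = "\<lambda>n t \<theta>. u n (fermi (\<gamma> n) t \<theta>) - ?ub n t \<theta>"
  let ?I5 = "\<lambda>n. integral {0..L n} (\<lambda>\<theta>. sqrt (1 + (\<epsilon> n)\<^sup>2 * W (fermi (\<gamma> n) 0 \<theta>)) ^ 5)"
  let ?DD = "{id, pt, pth, pt \<circ> pth, pth \<circ> pth, pth \<circ> pth \<circ> pth}"
  obtain K' where K': "\<forall>\<^sub>F n in sequentially. \<forall>D \<in> ?DD.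
      tubeL2 (2 * M1) (L n) (D (?\<phi> n))
       \<le> K' * \<epsilon> n powr \<rho> / ?I5 n * tubeL2 (2 * M1) (L n) (D (?ub n))"
    using C_conc unfolding Let_def U_sol ansatz_def[abs_def] by blast
  \<comment> \<open>The constant from the hypothesis may be negative; enlarging it is harmless
    because \<open>?I5 n\<close> and the tube norms are nonnegative.\<close>
  define K where "K = max 0 K'"

  have eps1: "\<forall>\<^sub>F n in sequentially. \<epsilon> n \<le> e" if "0 < e" for e
    using order_tendstoD(2)[OF eps_lim that] by (rule eventually_mono) simp
  have loc: "\<forall>\<^sub>F n in sequentially. concentrating (\<gamma> n) W (u n) cut (\<epsilon> n) (L n) M1 C0 C X K L0 (\<epsilon> n powr \<rho>)"
    using K' eps1[OF zero_less_one]
  proof eventually_elim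
    fix n
    assume K'n: "\<forall>D \<in> ?DD.
      tubeL2 (2 * M1) (L n) (D (?\<phi> n))
       \<le> K' * \<epsilon> n powr \<rho> / ?I5 n * tubeL2 (2 * M1) (L n) (D (?ub n))"
      and e1: "\<epsilon> n \<le> 1"
    have I: "0 \<le> ?I5 n"
      \<comment> \<open>Either the integrand is integrable and nonnegative, or the integral is 0 by
        convention.\<close>
      by (cases "(\<lambda>\<theta>. sqrt (1 + (\<epsilon> n)\<^sup>2 * W (fermi (\<gamma> n) 0 \<theta>)) ^ 5) integrable_on {0..L n}")
        (auto intro!: Henstock_Kurzweil_Integration.integral_nonneg simp: Bpos not_integrable_integral)
    have KK: "K' * \<epsilon> n powr \<rho> / ?I5 n * tubeL2 M l f \<le> K * \<epsilon> n powr \<rho> / ?I5 n * tubeL2 M l f" for M l f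
      unfolding K_def by (intro mult_right_mono divide_right_mono tubeL2_nonneg I) auto
    interpret arclength_curve "\<gamma> n" by (rule arc)
    show "concentrating (\<gamma> n) W (u n) cut (\<epsilon> n) (L n) M1 C0 C X K L0 (\<epsilon> n powr \<rho>)"
    proof unfold_locales
      show "- (\<epsilon> n)\<^sup>2 * laplacian (u n) y + (1 + (\<epsilon> n)\<^sup>2 * W y) * u n y - u n y ^ 3 = 0" for y
        using u_eq[of n y] by (simp add: power2_eq_square power3_eq_cube)
      show "\<epsilon> n powr \<rho> \<le> 1" using powr_le1[of \<rho> "\<epsilon> n"] rho e1 eps_pos[of n] by simp
      fix t \<theta>
      { assume "\<bar>t\<bar> < 2 * M1"
        then have t: "\<bar>t\<bar> < M0" using C_cutoff(3) by simp
        show "(\<epsilon> n)\<^sup>2 * \<bar>pt (?Wf n) t \<theta>\<bar> \<le> C * (1 + (\<epsilon> n)\<^sup>2 * ?Wf n 0 \<theta>)" by (rule up[OF C'(1)[OF t]])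
        show "(\<epsilon> n)\<^sup>2 * \<bar>pt (pt (?Wf n)) t \<theta>\<bar> \<le> C * (1 + (\<epsilon> n)\<^sup>2 * ?Wf n 0 \<theta>)" by (rule up[OF C'(2)[OF t]]) }
      show "(\<epsilon> n)\<^sup>2 * \<bar>pth (?Wf n) 0 \<theta>\<bar> \<le> C * (1 + (\<epsilon> n)\<^sup>2 * ?Wf n 0 \<theta>)"
        "(\<epsilon> n)\<^sup>2 * \<bar>pth (pth (?Wf n)) 0 \<theta>\<bar> \<le> C * (1 + (\<epsilon> n)\<^sup>2 * ?Wf n 0 \<theta>)"
        "(\<epsilon> n)\<^sup>2 * \<bar>pth (pth (pth (?Wf n))) 0 \<theta>\<bar> \<le> C * (1 + (\<epsilon> n)\<^sup>2 * ?Wf n 0 \<theta>)"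
        by (rule up[OF C'(3)] up[OF C'(4)] up[OF C'(5)])+
    next
      fix D :: "(real \<Rightarrow> real \<Rightarrow> real) \<Rightarrow> real \<Rightarrow> real \<Rightarrow> real"
      assume D: "D \<in> ?DD"
      show "tubeL2 (2 * M1) (L n) (D (?\<phi> n))
       \<le> K * \<epsilon> n powr \<rho> / ?I5 n * tubeL2 (2 * M1) (L n) (D (?ub n))"
        by (rule order.trans[OF K'n[rule_format, OF D] KK])
    qed (use W_smooth W_pos u_smooth eps_pos[of n] e1 L0 C0 C1 C_cutoff X in \<open>auto simp: K_def\<close>)
  qed

  \<comment> \<open>\<open>M1 / 2\<close> keeps the strip where the cut-off is 1, and
    \<open>1 / (2 * C0)\<close> keeps the Jacobian at least 1/2. The width is fixed while \<epsilon>
    tends to 0.\<close>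
  define \<delta> where "\<delta> = min (M1 / 2) (1 / (2 * C0))"
  have \<delta>: "0 < \<delta>" "\<delta> \<le> 1" "\<delta> < M1" "C0 * \<delta> \<le> 1/2"
  proof -
    have le: "\<delta> \<le> 1 / (2 * C0)" unfolding \<delta>_def by simp
    show "0 < \<delta>" "\<delta> < M1" unfolding \<delta>_def using C0(1) C_cutoff(2) by auto
    have "C0 * \<delta> \<le> C0 * (1 / (2 * C0))" using le C0(1) by (intro mult_left_mono) auto
    then show "C0 * \<delta> \<le> 1/2" using C0(1) by simp
    have "1 / (2 * C0) \<le> 1" using C0(1) by simp
    then show "\<delta> \<le> 1" using le by linarith
  qed
  \<comment> \<open>Seen from outside the locale, these constants take only arguments that do not
    depend on n, so they pass through the limits below as fixed numbers.\<close>
  let ?E1 = "concentrating.E1 C X K L0" and ?CP = "concentrating.CP C0 C X K L0 \<delta>"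
  have m0: "(\<lambda>n. \<epsilon> n powr \<rho>) \<longlonglongrightarrow> 0"
    
    by (rule tendsto_zero_powrI[OF eps_lim tendsto_const _ rho(1)]) (simp add: eps_pos less_imp_le)

  have part2: "filterlim a at_top sequentially"
  proof -
    have "(\<lambda>n. ?E1 * (\<epsilon> n powr \<rho>)\<^sup>2) \<longlonglongrightarrow> ?E1 * 0\<^sup>2" by (intro tendsto_intros m0)
    then have "\<forall>\<^sub>F n in sequentially. ?E1 * (\<epsilon> n powr \<rho>)\<^sup>2 < 1/2" by (rule order_tendstoD) simp
    moreover have "\<forall>\<^sub>F n in sequentially. \<epsilon> n \<le> \<delta> / 2" by (rule eps1) (use \<delta>(1) in simp)
    ultimately have ge: "\<forall>\<^sub>F n in sequentially. L0 / 4 * inverse (\<epsilon> n) \<le> a n"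
      using loc
    proof eventually_elim
      case (elim n)
      interpret concentrating "\<gamma> n" W "u n" cut "\<epsilon> n" "L n" M1 C0 C X K L0 "\<epsilon> n powr \<rho>" by (rule elim(3))
      have sub: "{-\<delta><..<\<delta>} \<times> {0..<L n} \<subseteq> {-M0<..<M0} \<times> {0..<L n}" using \<delta>(3) C_cutoff(2,3) by auto
      \<comment> \<open>The total mass is \<open>a n * (\<epsilon> n)\<^sup>2\<close> but at least
        of order \<open>\<epsilon> n\<close>, so one factor \<open>\<epsilon> n\<close> is left to
        force \<open>a n\<close> to infinity.\<close>
      have "L0 * \<epsilon> n / 4 \<le> a n * (\<epsilon> n)\<^sup>2"
        using mass_ge[OF \<delta> _ _ u_L2 inj_on_subset[OF A1_fermi sub]] elim(1,2) u_mass[of n] by simp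
      then have "L0 / 4 * \<epsilon> n \<le> a n * \<epsilon> n * \<epsilon> n" by (simp add: power2_eq_square)
      then have "L0 / 4 \<le> a n * \<epsilon> n" using eps_pos[of n] by (simp only: mult_le_cancel_right_pos)
      then show ?case using eps_pos[of n] by (simp add: field_simps)
    qed
    have "filterlim (\<lambda>n. inverse (\<epsilon> n)) at_top sequentially"
      by (rule filterlim_inverse_at_top[OF eps_lim]) (simp add: eps_pos)
    then have "filterlim (\<lambda>n. L0 / 4 * inverse (\<epsilon> n)) at_top sequentially"
      using L0(1) by (intro filterlim_tendsto_pos_mult_at_top[OF tendsto_const]) auto
    then show ?thesis using ge by (rule filterlim_at_top_mono)
  qed

  have part3: "\<forall>e>0. \<forall>\<^sub>F n in sequentially. \<forall>\<theta>\<in>{0..<L n}.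
            \<bar>3 * (\<epsilon> n)\<^sup>2 * pt (\<lambda>t \<theta>. W (fermi (\<gamma> n) t \<theta>)) 0 \<theta>
               / (2 * (1 + (\<epsilon> n)\<^sup>2 * W (fermi (\<gamma> n) 0 \<theta>))) + curv (\<gamma> n) \<theta>\<bar> < e"
  proof (intro allI impI)
    fix e :: real assume e: "0 < e"
    have "(\<lambda>n. 63 * ?CP\<^sup>2 / \<delta>\<^sup>2 * (\<epsilon> n + \<epsilon> n powr \<rho>) + 5 * ?CP * (\<epsilon> n / \<delta>))
       \<longlonglongrightarrow> 63 * ?CP\<^sup>2 / \<delta>\<^sup>2 * (0 + 0) + 5 * ?CP * (0 / \<delta>)"
      using \<delta>(1) by (intro tendsto_intros m0 eps_lim) auto
    then have "\<forall>\<^sub>F n in sequentially. 63 * ?CP\<^sup>2 / \<delta>\<^sup>2 * (\<epsilon> n + \<epsilon> n powr \<rho>) + 5 * ?CP * (\<epsilon> n / \<delta>) < e"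
      by (rule order_tendstoD) (use e in simp)
    then show "\<forall>\<^sub>F n in sequentially. \<forall>\<theta>\<in>{0..<L n}.
            \<bar>3 * (\<epsilon> n)\<^sup>2 * pt (\<lambda>t \<theta>. W (fermi (\<gamma> n) t \<theta>)) 0 \<theta>
               / (2 * (1 + (\<epsilon> n)\<^sup>2 * W (fermi (\<gamma> n) 0 \<theta>))) + curv (\<gamma> n) \<theta>\<bar> < e"
      using loc
    proof eventually_elim
      case (elim n)
      interpret concentrating "\<gamma> n" W "u n" cut "\<epsilon> n" "L n" M1 C0 C X K L0 "\<epsilon> n powr \<rho>" by (rule elim(2))
      show ?case
      proof
        fix \<theta> assume "\<theta> \<in> {0..<L n}"
        then have "\<theta> \<in> {0..L n}" by simp
        from curvature_balance[OF this \<delta>] elim(1)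
        have "\<bar>3 / 2 * ((\<epsilon> n)\<^sup>2 * pt Wf 0 \<theta> / (\<beta> \<theta>)\<^sup>2) + curv (\<gamma> n) \<theta>\<bar> < e" by linarith
        then show "\<bar>3 * (\<epsilon> n)\<^sup>2 * pt (\<lambda>t \<theta>. W (fermi (\<gamma> n) t \<theta>)) 0 \<theta>
               / (2 * (1 + (\<epsilon> n)\<^sup>2 * W (fermi (\<gamma> n) 0 \<theta>))) + curv (\<gamma> n) \<theta>\<bar> < e"
          unfolding \<beta>_sq Wf_def[abs_def] by simp
      qed
    qed
  qed
  show ?thesis using part1 part2 part3 by blast
qed

end
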